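(* Let $\mathfrak g$ and $\mathfrak n$ be topological Lie algebras over $\mathbb K$. The assignment $$\Gamma: Z^2(\mathfrak g,\mathfrak n)\to \mathrm{Ext}(\mathfrak g,\mathfrak n),\quad (S,\omega)\mapsto [\mathfrak n\times_{(S,\omega)}\mathfrak g]$$ factors through a bijection $\overline\Gamma: Z^2(\mathfrak g,\mathfrak n)/C^1(\mathfrak g,\mathfrak n)\to \mathrm{Ext}(\mathfrak g,\mathfrak n)$ (orbit space of the $C^1(\mathfrak g,\mathfrak n)$-action given in the context). For every continuous outer action $S$ of $\mathfrak g$ on $\mathfrak n$ with $\mathrm{Ext}(\mathfrak g,\mathfrak n)_{[S]}\neq\emptyset$ the map $$Z^2(\mathfrak g,\mathfrak n)_S\to \mathrm{Ext}(\mathfrak g,\mathfrak n)_{[S]},\quad \omega\mapsto[\mathfrak n\times_{(S,\omega)}\mathfrak g]$$ is surjective, and its fibers are the cosets of $B^2(\mathfrak g,\mathfrak z(\mathfrak n))_S$ in the affine space $Z^2(\mathfrak g,\mathfrak n)_S$ with translation group $Z^2(\mathfrak g,\mathfrak z(\mathfrak n))_S$. Thus $\mathrm{Ext}(\mathfrak g,\mathfrak n)_{[S]}$ inherits the structure of an affine space with translation group $H^2(\mathfrak g,\mathfrak z(\mathfrak n))_S$.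
   Context: $\mathbb K$ is a topological field of characteristic $0$ (the discrete topology is allowed); topological vector spaces over $\mathbb K$ are Hausdorff; a topological Lie algebra is a topological vector space with a continuous Lie bracket. $C^p(\mathfrak g,V)$ is the space of continuous alternating $p$-linear maps $\mathfrak g^p\to V$, $C^0(\mathfrak g,V)=V$. $\mathrm{der}\,\mathfrak n$ is the Lie algebra of continuous derivations of $\mathfrak n$ and $\mathfrak z(\mathfrak n)$ the center. $C^1_c(\mathfrak g,\mathrm{der}\,\mathfrak n)$ is the set of linear maps $S:\mathfrak g\to\mathrm{der}\,\mathfrak n$ with $\mathfrak g\times\mathfrak n\to\mathfrak n$, $(x,n)\mapsto S(x)n$ continuous. Put $R_S(x,y)=[S(x),S(y)]-S([x,y])$ and, for $\alpha\in C^p(\mathfrak g,\mathfrak n)$, $$(d_S\alpha)(x_0,\dots,x_p)=\sum_j(-1)^jS(x_j).\alpha(x_0,\dots,\widehat{x_j},\dots,x_p)+\sum_{i<j}(-1)^{i+j}\alpha([x_i,x_j],x_0,\dots,\widehat{x_i},\dots,\widehat{x_j},\dots,x_p).$$ A continuous outer action is an $S\in C^1_c(\mathfrak g,\mathrm{der}\,\mathfrak n)$ for which there is $\omega\in C^2(\mathfrak g,\mathfrak n)$ with $R_S=\mathrm{ad}\circ\omega$. If in addition $d_S\omega=0$, then $(S,\omega)$ is a continuous factor system. $Z^2(\mathfrak g,\mathfrak n)$ is the set of all continuous factor systems, and $Z^2(\mathfrak g,\mathfrak n)_S=\{\omega\in C^2(\mathfrak g,\mathfrak n): R_S=\mathrm{ad}\circ\omega,\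 d_S\omega=0\}$. Two continuous outer actions are equivalent, $S\sim S'$, if $S=S'+\mathrm{ad}\circ\gamma$ for some $\gamma\in C^1(\mathfrak g,\mathfrak n)$; $[S]$ is the equivalence class. Each $S$ makes $\mathfrak z(\mathfrak n)$ a topological $\mathfrak g$-module via $x.z=S(x)z$; $Z^p,B^p,H^p(\mathfrak g,\mathfrak z(\mathfrak n))_S$ are the continuous cocycles, coboundaries and cohomology for this module structure (differential $d_S$). The abelian group $C^1(\mathfrak g,\mathfrak n)$ acts on $Z^2(\mathfrak g,\mathfrak n)$ by $\gamma.(S,\omega)=(S+\mathrm{ad}\circ\gamma,\ \omega+d_S\gamma+\frac12[\gamma,\gamma])$, where $\frac12[\gamma,\gamma](x,y)=[\gamma(x),\gamma(y)]$. A subspace $W$ of a topological vector space $V$ is topologically split if it is closed and $V\to V/W$ has a continuous linear section $\sigma$ such that $W\times V/W\to V$, $(w,x)\mapsto w+\sigma(x)$ is a topological isomorphism. A (topologically split) extension of $\mathfrak g$ by $\mathfrak n$ is a topological Lie algebra $\hat{\mathfrak g}$ containing $\mathfrak n$ as a topologically split ideal together with a quotient morphism $q:\hat{\mathfrak g}\to\mathfrak g$ with kernel $\mathfrak n$ (so $\hat{\mathfrak g}/\mathfrak n\cong\mathfrak g$ as topological Lie algebras). Two extensions are equivalent if there is a morphism of topological Lie algebras $\hat{\mathfrak g}_1\to\hat{\mathfrak g}_2$ inducing the identity on $\mathfrak n$ and $\mathfrak g$. $\mathrm{Ext}(\mathfrak g,\mathfrak n)$ is the set of equivalence classes. For a continuous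 linear section $\sigma$ of $q$, $S_\sigma(x)=\mathrm{ad}(\sigma(x))|_{\mathfrak n}$ is a continuous outer action whose class does not depend on $\sigma$; $\mathrm{Ext}(\mathfrak g,\mathfrak n)_{[S]}$ is the set of classes of extensions with $[S_\sigma]=[S]$. For a continuous factor system $(S,\omega)$, $\mathfrak n\times_{(S,\omega)}\mathfrak g$ is the topological vector space $\mathfrak n\times\mathfrak g$ with the Lie bracket $[(n,x),(n',x')]=([n,n']+S(x)n'-S(x')n+\omega(x,x'),[x,x'])$, regarded as an extension of $\mathfrak g$ by $\mathfrak n$ via the projection $(n,x)\mapsto x$. *)

theory Defs
  imports "HOL-Analysis.Analysis" "HOL-Algebra.Algebra"
begin

section \<open>Topological fields, vector spaces and Lie algebras\<close>

record 'k top_field = "'k ring" +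
  ftopo :: "'k topology"

record ('k, 'v) lie_alg = "('k, 'v) module" +
  lie :: "'v \<Rightarrow> 'v \<Rightarrow> 'v"

record ('k, 'v) top_lie_alg = "('k, 'v) lie_alg" +
  topo :: "'v topology"

text \<open>The records for modules inherit from rings the fields \<open>mult\<close> and \<open>one\<close>, which modules never use.
  No separation axiom is imposed on the field, and the discrete topology is allowed.\<close>

locale topological_field_char_0 = field K for K :: "'k top_field" (structure) +
  assumes char_0: "\<And>m::nat. m > 0 \<Longrightarrow> [m] \<cdot> \<one> \<noteq> \<zero>"
    and topspace_field: "topspace (ftopo K) = carrier K"
    and continuous_field_add:
      "continuous_map (prod_topology (ftopo K) (ftopo K)) (ftopo K) (\<lambda>(a, b). a \<oplus> b)"
    and continuous_field_minus: "continuous_map (ftopo K) (ftopo K) (\<lambda>a. \<ominus> a)"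
    and continuous_field_mult:
      "continuous_map (prod_topology (ftopo K) (ftopo K)) (ftopo K) (\<lambda>(a, b). a \<otimes> b)"
    and continuous_field_inverse:
      "continuous_map (subtopology (ftopo K) (carrier K - {\<zero>})) (ftopo K) (\<lambda>a. inv\<^bsub>K\<^esub> a)"

locale topological_vector_space =
  topological_field_char_0 K + module K V
  for K :: "'k top_field" and V :: "('k, 'v, 'm) module_scheme" and T :: "'v topology" +
  assumes topspace_vector: "topspace T = carrier V"
    and Hausdorff: "Hausdorff_space T"
    and continuous_add: "continuous_map (prod_topology T T) T (\<lambda>(v, w). v \<oplus>\<^bsub>V\<^esub> w)"
    and continuous_smult: "continuous_map (prod_topology (ftopo K) T) T (\<lambda>(a, v). a \<odot>\<^bsub>V\<^esub> v)"

locale lie_algebra = module K L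
  for K :: "('k, 'r) ring_scheme" and L :: "('k, 'v, 'm) lie_alg_scheme" +
  assumes lie_closed: "\<lbrakk>x \<in> carrier L; y \<in> carrier L\<rbrakk> \<Longrightarrow> lie L x y \<in> carrier L"
    and lie_add_left: "\<lbrakk>x \<in> carrier L; y \<in> carrier L; z \<in> carrier L\<rbrakk>
      \<Longrightarrow> lie L (x \<oplus>\<^bsub>L\<^esub> y) z = lie L x z \<oplus>\<^bsub>L\<^esub> lie L y z"
    and lie_add_right: "\<lbrakk>x \<in> carrier L; y \<in> carrier L; z \<in> carrier L\<rbrakk>
      \<Longrightarrow> lie L x (y \<oplus>\<^bsub>L\<^esub> z) = lie L x y \<oplus>\<^bsub>L\<^esub> lie L x z"
    and lie_smult_left: "\<lbrakk>a \<in> carrier K; x \<in> carrier L; y \<in> carrier L\<rbrakk>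
      \<Longrightarrow> lie L (a \<odot>\<^bsub>L\<^esub> x) y = a \<odot>\<^bsub>L\<^esub> lie L x y"
    and lie_smult_right: "\<lbrakk>a \<in> carrier K; x \<in> carrier L; y \<in> carrier L\<rbrakk>
      \<Longrightarrow> lie L x (a \<odot>\<^bsub>L\<^esub> y) = a \<odot>\<^bsub>L\<^esub> lie L x y"
    and lie_self: "x \<in> carrier L \<Longrightarrow> lie L x x = \<zero>\<^bsub>L\<^esub>"
    and jacobi: "\<lbrakk>x \<in> carrier L; y \<in> carrier L; z \<in> carrier L\<rbrakk>
      \<Longrightarrow> lie L x (lie L y z) \<oplus>\<^bsub>L\<^esub> lie L y (lie L z x) \<oplus>\<^bsub>L\<^esub> lie L z (lie L x y) = \<zero>\<^bsub>L\<^esub>"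

locale topological_lie_algebra =
  topological_vector_space K L "topo L" + lie_algebra K L
  for K :: "'k top_field" and L :: "('k, 'v) top_lie_alg" +
  assumes continuous_lie:
    "continuous_map (prod_topology (topo L) (topo L)) (topo L) (\<lambda>(x, y). lie L x y)"


section \<open>Linear maps, derivations, centre\<close>

text \<open>All sets of maps below consist of maps that are \<open>undefined\<close> off their domain, so that equality of
  maps is equality on the carriers.\<close>

definition linear_maps ::
    "('k, 'r) ring_scheme \<Rightarrow> ('k, 'v, 'm) module_scheme \<Rightarrow> ('k, 'w, 'l) module_scheme \<Rightarrow> ('v \<Rightarrow> 'w) set"
  where "linear_maps K V W = {f \<in> carrier V \<rightarrow>\<^sub>E carrier W.
    (\<forall>x\<in>carrier V. \<forall>y\<in>carrier V. f (x \<oplus>\<^bsub>V\<^esub> y) = f x \<oplus>\<^bsub>W\<^esub> f y) \<and>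
    (\<forall>a\<in>carrier K. \<forall>x\<in>carrier V. f (a \<odot>\<^bsub>V\<^esub> x) = a \<odot>\<^bsub>W\<^esub> f x)}"

definition der :: "'k top_field \<Rightarrow> ('k, 'n) top_lie_alg \<Rightarrow> ('k, 'n \<Rightarrow> 'n) lie_alg"
  where "der K n = \<lparr>
    carrier = {D \<in> linear_maps K n n. continuous_map (topo n) (topo n) D \<and>
      (\<forall>x\<in>carrier n. \<forall>y\<in>carrier n. D (lie n x y) = lie n (D x) y \<oplus>\<^bsub>n\<^esub> lie n x (D y))},
    monoid.mult = undefined,
    one = undefined,
    ring.zero = (\<lambda>x\<in>carrier n. \<zero>\<^bsub>n\<^esub>),
    ring.add = (\<lambda>D E. \<lambda>x\<in>carrier n. D x \<oplus>\<^bsub>n\<^esub> E x),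
    smult = (\<lambda>a D. \<lambda>x\<in>carrier n. a \<odot>\<^bsub>n\<^esub> D x),
    lie = (\<lambda>D E. \<lambda>x\<in>carrier n. D (E x) \<ominus>\<^bsub>n\<^esub> E (D x))\<rparr>"

definition ad :: "('k, 'n) top_lie_alg \<Rightarrow> 'n \<Rightarrow> 'n \<Rightarrow> 'n"
  where "ad n x = (\<lambda>y\<in>carrier n. lie n x y)"

definition center :: "('k, 'n) top_lie_alg \<Rightarrow> ('k, 'n) top_lie_alg"
  where "center n = (let Z = {z \<in> carrier n. \<forall>x\<in>carrier n. lie n z x = \<zero>\<^bsub>n\<^esub>}
    in n\<lparr>carrier := Z, topo := subtopology (topo n) Z\<rparr>)"


section \<open>Cochains\<close>

text \<open>The elements of the \<open>p\<close>-fold product of \<open>g\<close> are lists of length \<open>p\<close>; a \<open>p\<close>-cochain is a function of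
  such lists. Continuity refers to the product topology, read through the bijection of lists with
  families indexed by \<open>{..<p}\<close>.\<close>

definition tuples :: "('g, 'm) partial_object_scheme \<Rightarrow> nat \<Rightarrow> 'g list set"
  where "tuples g p = {xs. length xs = p \<and> set xs \<subseteq> carrier g}"

definition cochains ::
    "'k top_field \<Rightarrow> nat \<Rightarrow> ('k, 'g) top_lie_alg \<Rightarrow> ('k, 'v) top_lie_alg \<Rightarrow> ('g list \<Rightarrow> 'v) set"
  where "cochains K p g V = {\<alpha> \<in> tuples g p \<rightarrow>\<^sub>E carrier V.
    (\<forall>xs\<in>tuples g p. \<forall>i<p. (\<lambda>x\<in>carrier g. \<alpha> (xs[i := x])) \<in> linear_maps K g V) \<and>
    (\<forall>xs\<in>tuples g p. \<not> distinct xs \<longrightarrow> \<alpha> xs = \<zero>\<^bsub>V\<^esub>) \<and>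
    continuous_map (product_topology (\<lambda>_. topo g) {..<p}) (topo V) (\<lambda>x. \<alpha> (map x [0..<p]))}"

definition cochain_group ::
    "'k top_field \<Rightarrow> nat \<Rightarrow> ('k, 'g) top_lie_alg \<Rightarrow> ('k, 'v) top_lie_alg \<Rightarrow> ('g list \<Rightarrow> 'v) monoid"
  where "cochain_group K p g V = \<lparr>
    carrier = cochains K p g V,
    monoid.mult = (\<lambda>\<alpha> \<beta>. \<lambda>xs\<in>tuples g p. \<alpha> xs \<oplus>\<^bsub>V\<^esub> \<beta> xs),
    one = (\<lambda>xs\<in>tuples g p. \<zero>\<^bsub>V\<^esub>)\<rparr>"

definition omit :: "nat \<Rightarrow> 'a list \<Rightarrow> 'a list"
  where "omit j xs = take j xs @ drop (Suc j) xs"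

definition neg_one_pow :: "('k, 'r) ring_scheme \<Rightarrow> nat \<Rightarrow> 'k"
  where "neg_one_pow K j = (\<ominus>\<^bsub>K\<^esub> \<one>\<^bsub>K\<^esub>) [^]\<^bsub>K\<^esub> j"

text \<open>In the second sum \<open>i < j\<close>, so \<open>omit i (omit j xs)\<close> removes the entries with the original indices
  \<open>i\<close> and \<open>j\<close>.\<close>

definition differential ::
    "'k top_field \<Rightarrow> ('k, 'g) top_lie_alg \<Rightarrow> ('k, 'n) top_lie_alg \<Rightarrow> ('g \<Rightarrow> 'n \<Rightarrow> 'n) \<Rightarrow> nat
      \<Rightarrow> ('g list \<Rightarrow> 'n) \<Rightarrow> 'g list \<Rightarrow> 'n"
  where "differential K g n S p \<alpha> = (\<lambda>xs\<in>tuples g (Suc p).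
    (\<Oplus>\<^bsub>n\<^esub>j\<in>{..p}. neg_one_pow K j \<odot>\<^bsub>n\<^esub> S (xs ! j) (\<alpha> (omit j xs)))
    \<oplus>\<^bsub>n\<^esub> (\<Oplus>\<^bsub>n\<^esub>ij\<in>{(i, j). i < j \<and> j \<le> p}. neg_one_pow K (fst ij + snd ij) \<odot>\<^bsub>n\<^esub>
          \<alpha> (lie g (xs ! fst ij) (xs ! snd ij) # omit (fst ij) (omit (snd ij) xs))))"


section \<open>Outer actions and factor systems\<close>

definition C1c ::
    "'k top_field \<Rightarrow> ('k, 'g) top_lie_alg \<Rightarrow> ('k, 'n) top_lie_alg \<Rightarrow> ('g \<Rightarrow> 'n \<Rightarrow> 'n) set"
  where "C1c K g n = {S \<in> linear_maps K g (der K n).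
    continuous_map (prod_topology (topo g) (topo n)) (topo n) (\<lambda>(x, v). S x v)}"

definition curvature ::
    "'k top_field \<Rightarrow> ('k, 'g) top_lie_alg \<Rightarrow> ('k, 'n) top_lie_alg \<Rightarrow> ('g \<Rightarrow> 'n \<Rightarrow> 'n)
      \<Rightarrow> 'g \<Rightarrow> 'g \<Rightarrow> 'n \<Rightarrow> 'n"
  where "curvature K g n S x y = lie (der K n) (S x) (S y) \<ominus>\<^bsub>der K n\<^esub> S (lie g x y)"

definition curvature_inner ::
    "'k top_field \<Rightarrow> ('k, 'g) top_lie_alg \<Rightarrow> ('k, 'n) top_lie_alg \<Rightarrow> ('g \<Rightarrow> 'n \<Rightarrow> 'n)
      \<Rightarrow> ('g list \<Rightarrow> 'n) \<Rightarrow> bool"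
  where "curvature_inner K g n S \<omega> \<longleftrightarrow>
    (\<forall>x\<in>carrier g. \<forall>y\<in>carrier g. curvature K g n S x y = ad n (\<omega> [x, y]))"

definition outer_actions ::
    "'k top_field \<Rightarrow> ('k, 'g) top_lie_alg \<Rightarrow> ('k, 'n) top_lie_alg \<Rightarrow> ('g \<Rightarrow> 'n \<Rightarrow> 'n) set"
  where "outer_actions K g n =
    {S \<in> C1c K g n. \<exists>\<omega>\<in>cochains K 2 g n. curvature_inner K g n S \<omega>}"

definition add_inner ::
    "'k top_field \<Rightarrow> ('k, 'g) top_lie_alg \<Rightarrow> ('k, 'n) top_lie_alg \<Rightarrow> ('g \<Rightarrow> 'n \<Rightarrow> 'n)
      \<Rightarrow> ('g list \<Rightarrow> 'n) \<Rightarrow> 'g \<Rightarrow> 'n \<Rightarrow> 'n"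
  where "add_inner K g n S \<gamma> = (\<lambda>x\<in>carrier g. S x \<oplus>\<^bsub>der K n\<^esub> ad n (\<gamma> [x]))"

definition outer_equiv ::
    "'k top_field \<Rightarrow> ('k, 'g) top_lie_alg \<Rightarrow> ('k, 'n) top_lie_alg
      \<Rightarrow> (('g \<Rightarrow> 'n \<Rightarrow> 'n) \<times> ('g \<Rightarrow> 'n \<Rightarrow> 'n)) set"
  where "outer_equiv K g n = {(S, S'). S \<in> outer_actions K g n \<and> S' \<in> outer_actions K g n \<and>
    (\<exists>\<gamma>\<in>cochains K 1 g n. S = add_inner K g n S' \<gamma>)}"

definition factor_cocycles ::
    "'k top_field \<Rightarrow> ('k, 'g) top_lie_alg \<Rightarrow> ('k, 'n) top_lie_alg \<Rightarrow> ('g \<Rightarrow> 'n \<Rightarrow> 'n)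
      \<Rightarrow> ('g list \<Rightarrow> 'n) set"
  where "factor_cocycles K g n S = {\<omega> \<in> cochains K 2 g n. curvature_inner K g n S \<omega> \<and>
    differential K g n S 2 \<omega> = (\<lambda>xs\<in>tuples g 3. \<zero>\<^bsub>n\<^esub>)}"

definition factor_systems ::
    "'k top_field \<Rightarrow> ('k, 'g) top_lie_alg \<Rightarrow> ('k, 'n) top_lie_alg
      \<Rightarrow> (('g \<Rightarrow> 'n \<Rightarrow> 'n) \<times> ('g list \<Rightarrow> 'n)) set"
  where "factor_systems K g n = {(S, \<omega>). S \<in> outer_actions K g n \<and> \<omega> \<in> factor_cocycles K g n S}"

definition C1_action ::
    "'k top_field \<Rightarrow> ('k, 'g) top_lie_alg \<Rightarrow> ('k, 'n) top_lie_alg \<Rightarrow> ('g list \<Rightarrow> 'n)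
      \<Rightarrow> ('g \<Rightarrow> 'n \<Rightarrow> 'n) \<times> ('g list \<Rightarrow> 'n) \<Rightarrow> ('g \<Rightarrow> 'n \<Rightarrow> 'n) \<times> ('g list \<Rightarrow> 'n)"
  where "C1_action K g n \<gamma> = (\<lambda>(S, \<omega>)\<in>factor_systems K g n.
    (add_inner K g n S \<gamma>,
     \<lambda>xs\<in>tuples g 2. \<omega> xs \<oplus>\<^bsub>n\<^esub> differential K g n S 1 \<gamma> xs
       \<oplus>\<^bsub>n\<^esub> lie n (\<gamma> [xs ! 0]) (\<gamma> [xs ! 1])))"


section \<open>Cohomology with values in the centre\<close>

definition center_cocycles ::
    "'k top_field \<Rightarrow> ('k, 'g) top_lie_alg \<Rightarrow> ('k, 'n) top_lie_alg \<Rightarrow> ('g \<Rightarrow> 'n \<Rightarrow> 'n) \<Rightarrow> nat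
      \<Rightarrow> ('g list \<Rightarrow> 'n) set"
  where "center_cocycles K g n S p = {\<alpha> \<in> cochains K p g (center n).
    differential K g n S p \<alpha> = (\<lambda>xs\<in>tuples g (Suc p). \<zero>\<^bsub>n\<^esub>)}"

definition center_coboundaries ::
    "'k top_field \<Rightarrow> ('k, 'g) top_lie_alg \<Rightarrow> ('k, 'n) top_lie_alg \<Rightarrow> ('g \<Rightarrow> 'n \<Rightarrow> 'n) \<Rightarrow> nat
      \<Rightarrow> ('g list \<Rightarrow> 'n) set"
  where "center_coboundaries K g n S p = (case p of
      0 \<Rightarrow> {\<lambda>xs\<in>tuples g 0. \<zero>\<^bsub>n\<^esub>}
    | Suc r \<Rightarrow> differential K g n S r ` cochains K r g (center n))"

definition center_cocycle_group ::
    "'k top_field \<Rightarrow> ('k, 'g) top_lie_alg \<Rightarrow> ('k, 'n) top_lie_alg \<Rightarrow> ('g \<Rightarrow> 'n \<Rightarrow> 'n) \<Rightarrow> nat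
      \<Rightarrow> ('g list \<Rightarrow> 'n) monoid"
  where "center_cocycle_group K g n S p =
    (cochain_group K p g (center n))\<lparr>carrier := center_cocycles K g n S p\<rparr>"

definition center_cohomology ::
    "'k top_field \<Rightarrow> ('k, 'g) top_lie_alg \<Rightarrow> ('k, 'n) top_lie_alg \<Rightarrow> ('g \<Rightarrow> 'n \<Rightarrow> 'n) \<Rightarrow> nat
      \<Rightarrow> ('g list \<Rightarrow> 'n) set monoid"
  where "center_cohomology K g n S p =
    center_cocycle_group K g n S p Mod center_coboundaries K g n S p"

text \<open>An affine space with translation group \<open>A\<close> is a nonempty set with a simply transitive action of the
  abelian group \<open>A\<close>.\<close>

definition affine_space_over :: "('a, 'm) monoid_scheme \<Rightarrow> 'x set \<Rightarrow> ('a \<Rightarrow> 'x \<Rightarrow> 'x) \<Rightarrow> bool"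
  where "affine_space_over A E \<phi> \<longleftrightarrow> comm_group A \<and> group_action A E \<phi> \<and> E \<noteq> {} \<and>
    (\<forall>x\<in>E. \<forall>y\<in>E. \<exists>!a. a \<in> carrier A \<and> \<phi> a x = y)"


section \<open>Extensions\<close>

definition quotient_space ::
    "('k, 'v, 'm) module_scheme \<Rightarrow> 'v set \<Rightarrow> ('k, 'v set) module"
  where "quotient_space V W = \<lparr>
    carrier = a_rcosets\<^bsub>V\<^esub> W,
    monoid.mult = undefined,
    one = undefined,
    ring.zero = W,
    ring.add = (\<lambda>E F. E <+>\<^bsub>V\<^esub> F),
    smult = (\<lambda>a E. \<Union>x\<in>E. W +>\<^bsub>V\<^esub> (a \<odot>\<^bsub>V\<^esub> x))\<rparr>"

definition quotient_topology ::
    "('k, 'v, 'm) module_scheme \<Rightarrow> 'v topology \<Rightarrow> 'v set \<Rightarrow> 'v set topology"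
  where "quotient_topology V T W = topology (\<lambda>U. U \<subseteq> a_rcosets\<^bsub>V\<^esub> W \<and>
    openin T {x \<in> carrier V. W +>\<^bsub>V\<^esub> x \<in> U})"

definition topologically_split ::
    "'k top_field \<Rightarrow> ('k, 'v) top_lie_alg \<Rightarrow> 'v set \<Rightarrow> bool"
  where "topologically_split K V W \<longleftrightarrow> submodule W K V \<and> closedin (topo V) W \<and>
    (\<exists>\<sigma>\<in>linear_maps K (quotient_space V W) V.
      continuous_map (quotient_topology V (topo V) W) (topo V) \<sigma> \<and>
      (\<forall>E\<in>a_rcosets\<^bsub>V\<^esub> W. W +>\<^bsub>V\<^esub> \<sigma> E = E) \<and>
      homeomorphic_map
        (prod_topology (subtopology (topo V) W) (quotient_topology V (topo V) W)) (topo V)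
        (\<lambda>(w, E). w \<oplus>\<^bsub>V\<^esub> \<sigma> E))"

definition lie_ideal :: "'k top_field \<Rightarrow> ('k, 'v) top_lie_alg \<Rightarrow> 'v set \<Rightarrow> bool"
  where "lie_ideal K L W \<longleftrightarrow> submodule W K L \<and> (\<forall>x\<in>carrier L. \<forall>w\<in>W. lie L x w \<in> W)"

definition top_lie_hom ::
    "'k top_field \<Rightarrow> ('k, 'v) top_lie_alg \<Rightarrow> ('k, 'w) top_lie_alg \<Rightarrow> ('v \<Rightarrow> 'w) set"
  where "top_lie_hom K L M = {f \<in> linear_maps K L M. continuous_map (topo L) (topo M) f \<and>
    (\<forall>x\<in>carrier L. \<forall>y\<in>carrier L. f (lie L x y) = lie M (f x) (f y))}"

record ('k, 'n, 'g, 'e) lie_ext =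
  total :: "('k, 'e) top_lie_alg"
  incl :: "'n \<Rightarrow> 'e"
  proj :: "'e \<Rightarrow> 'g"

text \<open>Extensions whose underlying set is a subset of the type \<open>'e\<close>. Every extension is in bijection
  with the product of \<open>n\<close> and \<open>g\<close>, so a type into which that product can be injected carries
  extensions of every equivalence class. That \<open>n\<close> is contained in the total
  Lie algebra is expressed by the embedding \<open>incl\<close>.\<close>

definition extensions ::
    "'k top_field \<Rightarrow> ('k, 'g) top_lie_alg \<Rightarrow> ('k, 'n) top_lie_alg \<Rightarrow> ('k, 'n, 'g, 'e) lie_ext set"
  where "extensions K g n = {E.
    topological_lie_algebra K (total E) \<and>
    incl E \<in> top_lie_hom K n (total E) \<and>
    embedding_map (topo n) (topo (total E)) (incl E) \<and>
    lie_ideal K (total E) (incl E ` carrier n) \<and>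
    topologically_split K (total E) (incl E ` carrier n) \<and>
    proj E \<in> top_lie_hom K (total E) g \<and>
    quotient_map (topo (total E)) (topo g) (proj E) \<and>
    {e \<in> carrier (total E). proj E e = \<zero>\<^bsub>g\<^esub>} = incl E ` carrier n}"

definition ext_equiv ::
    "'k top_field \<Rightarrow> ('k, 'n) top_lie_alg \<Rightarrow> ('k, 'n, 'g, 'e) lie_ext \<Rightarrow> ('k, 'n, 'g, 'f) lie_ext \<Rightarrow> bool"
  where "ext_equiv K n E F \<longleftrightarrow> (\<exists>\<phi>\<in>top_lie_hom K (total E) (total F).
    (\<forall>v\<in>carrier n. \<phi> (incl E v) = incl F v) \<and>
    (\<forall>e\<in>carrier (total E). proj F (\<phi> e) = proj E e))"

definition Ext ::
    "'k top_field \<Rightarrow> ('k, 'g) top_lie_alg \<Rightarrow> ('k, 'n) top_lie_alg \<Rightarrow> ('k, 'n, 'g, 'e) lie_ext set set"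
  where "Ext K g n = extensions K g n //
    {(E, F). E \<in> extensions K g n \<and> F \<in> extensions K g n \<and> ext_equiv K n E F}"

text \<open>The class, among the extensions on \<open>'f\<close>, of an extension living on a possibly different type \<open>'e\<close>.\<close>

definition ext_class ::
    "'k top_field \<Rightarrow> ('k, 'g) top_lie_alg \<Rightarrow> ('k, 'n) top_lie_alg \<Rightarrow> ('k, 'n, 'g, 'e) lie_ext
      \<Rightarrow> ('k, 'n, 'g, 'f) lie_ext set"
  where "ext_class K g n E = {F \<in> extensions K g n. ext_equiv K n E F}"

definition sections ::
    "'k top_field \<Rightarrow> ('k, 'g) top_lie_alg \<Rightarrow> ('k, 'n, 'g, 'e) lie_ext \<Rightarrow> ('g \<Rightarrow> 'e) set"
  where "sections K g E = {\<sigma> \<in> linear_maps K g (total E).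
    continuous_map (topo g) (topo (total E)) \<sigma> \<and> (\<forall>x\<in>carrier g. proj E (\<sigma> x) = x)}"

definition section_action ::
    "('k, 'g) top_lie_alg \<Rightarrow> ('k, 'n) top_lie_alg \<Rightarrow> ('k, 'n, 'g, 'e) lie_ext \<Rightarrow> ('g \<Rightarrow> 'e)
      \<Rightarrow> 'g \<Rightarrow> 'n \<Rightarrow> 'n"
  where "section_action g n E \<sigma> = (\<lambda>x\<in>carrier g. \<lambda>v\<in>carrier n.
    inv_into (carrier n) (incl E) (lie (total E) (\<sigma> x) (incl E v)))"

definition Ext_outer ::
    "'k top_field \<Rightarrow> ('k, 'g) top_lie_alg \<Rightarrow> ('k, 'n) top_lie_alg \<Rightarrow> ('g \<Rightarrow> 'n \<Rightarrow> 'n)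
      \<Rightarrow> ('k, 'n, 'g, 'e) lie_ext set set"
  where "Ext_outer K g n S = {c \<in> Ext K g n. \<exists>E\<in>c. \<exists>\<sigma>\<in>sections K g E.
    outer_equiv K g n `` {section_action g n E \<sigma>} = outer_equiv K g n `` {S}}"

definition crossed_product ::
    "('k, 'g) top_lie_alg \<Rightarrow> ('k, 'n) top_lie_alg \<Rightarrow> ('g \<Rightarrow> 'n \<Rightarrow> 'n) \<Rightarrow> ('g list \<Rightarrow> 'n)
      \<Rightarrow> ('k, 'n \<times> 'g) top_lie_alg"
  where "crossed_product g n S \<omega> = \<lparr>
    carrier = carrier n \<times> carrier g,
    monoid.mult = undefined,
    one = undefined,
    ring.zero = (\<zero>\<^bsub>n\<^esub>, \<zero>\<^bsub>g\<^esub>),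
    ring.add = (\<lambda>(v, x) (w, y). (v \<oplus>\<^bsub>n\<^esub> w, x \<oplus>\<^bsub>g\<^esub> y)),
    smult = (\<lambda>a (v, x). (a \<odot>\<^bsub>n\<^esub> v, a \<odot>\<^bsub>g\<^esub> x)),
    lie = (\<lambda>(v, x) (w, y).
      (((lie n v w \<oplus>\<^bsub>n\<^esub> S x w) \<ominus>\<^bsub>n\<^esub> S y v) \<oplus>\<^bsub>n\<^esub> \<omega> [x, y], lie g x y)),
    topo = prod_topology (topo n) (topo g)\<rparr>"

definition crossed_extension ::
    "('k, 'g) top_lie_alg \<Rightarrow> ('k, 'n) top_lie_alg \<Rightarrow> ('g \<Rightarrow> 'n \<Rightarrow> 'n) \<Rightarrow> ('g list \<Rightarrow> 'n)
      \<Rightarrow> ('k, 'n, 'g, 'n \<times> 'g) lie_ext"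
  where "crossed_extension g n S \<omega> = \<lparr>
    total = crossed_product g n S \<omega>,
    incl = (\<lambda>v\<in>carrier n. (v, \<zero>\<^bsub>g\<^esub>)),
    proj = (\<lambda>e\<in>carrier n \<times> carrier g. snd e)\<rparr>"

definition ext_of_factor_system ::
    "'k top_field \<Rightarrow> ('k, 'g) top_lie_alg \<Rightarrow> ('k, 'n) top_lie_alg
      \<Rightarrow> ('g \<Rightarrow> 'n \<Rightarrow> 'n) \<times> ('g list \<Rightarrow> 'n) \<Rightarrow> ('k, 'n, 'g, 'e) lie_ext set"
  where "ext_of_factor_system K g n = (\<lambda>(S, \<omega>). ext_class K g n (crossed_extension g n S \<omega>))"

end

theory Submission
  imports Defs
begin

text \<open>A continuous linear section \<open>\<sigma>\<close> of an extension yields the factor system \<open>S(x) = [\<sigma>(x), -]\<close>,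
  \<open>\<omega>(x, y) = [\<sigma>(x), \<sigma>(y)] - \<sigma>([x, y])\<close>, whose cocycle identity is the Jacobi identity of the extension,
  and \<open>(v, x) \<mapsto> v + \<sigma>(x)\<close> is then an equivalence from the crossed product to the extension. Conversely
  the section \<open>x \<mapsto> (0, x)\<close> of a crossed product gives back its factor system. Two sections of one
  extension differ by a \<open>1\<close>-cochain \<open>\<gamma>\<close>, and replacing \<open>\<sigma>\<close> by \<open>\<sigma> + \<gamma>\<close> amounts to acting with \<open>\<gamma>\<close> on the
  factor system, while an equivalence of extensions carries sections to sections with the same factor
  system. Hence two crossed products are equivalent if and only if their factor systems lie in one
  orbit. Finally \<open>\<gamma>\<close> fixes \<open>S\<close> if and only if its values are central, and it then adds \<open>d\<^sub>S \<gamma>\<close> to \<open>\<omega>\<close>;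
  this describes the fibres over the classes with a given outer action.\<close>

section \<open>Abelian groups, modules, Lie algebras\<close>

text \<open>Two obstacles shape the proof. An extension is required to be topologically split, a
  condition on cosets and a quotient topology; \<open>extensions_iff\<close> trades it for a
  continuous linear section, because the cosets of the ideal are the fibres of the projection. And a
  crossed product lives on pairs, while \<open>Ext\<close> collects extensions on an arbitrary type;
  \<open>transport_ext\<close> moves it there along the injection \<open>copy\<close>, so that its
  class is nonempty. This matters because equality of two classes is turned into an equivalence of
  crossed products by passing through a common member. Identities between S and \<omega> are checked
  after applying the injective map \<open>incl E\<close>: the action and the cocycle become brackets
  of section values, and the claims reduce to bilinearity and the Jacobi identity. The quotient
  statements are read off from fibres of \<Gamma>: the orbits are such fibres, and the
  2-coboundaries with central values are the translations that keep a factor cocycle in its fibre,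
  from which it follows that they are cocycles and form a subgroup.\<close>

context abelian_group
begin

lemma add_diff: "\<lbrakk>x \<in> carrier G; y \<in> carrier G; z \<in> carrier G\<rbrakk> \<Longrightarrow> x \<oplus> (y \<ominus> z) = (x \<oplus> y) \<ominus> z"
  by (simp add: minus_eq a_ac)

lemma diff_add: "\<lbrakk>x \<in> carrier G; y \<in> carrier G; z \<in> carrier G\<rbrakk> \<Longrightarrow> (x \<ominus> y) \<oplus> z = (x \<oplus> z) \<ominus> y"
  by (simp add: minus_eq a_ac)

lemma diff_diff_left: "\<lbrakk>x \<in> carrier G; y \<in> carrier G; z \<in> carrier G\<rbrakk> \<Longrightarrow> (x \<ominus> y) \<ominus> z = x \<ominus> (y \<oplus> z)"
  by (simp add: minus_eq a_ac minus_add)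

lemma diff_diff_right: "\<lbrakk>x \<in> carrier G; y \<in> carrier G; z \<in> carrier G\<rbrakk> \<Longrightarrow> x \<ominus> (y \<ominus> z) = (x \<oplus> z) \<ominus> y"
  by (simp add: minus_eq a_ac minus_add)

lemma diff_eq_iff: "\<lbrakk>x \<in> carrier G; y \<in> carrier G; z \<in> carrier G\<rbrakk> \<Longrightarrow> x \<ominus> y = z \<longleftrightarrow> x = z \<oplus> y"
  by (metis minus_eq a_inv_closed add.m_assoc l_neg r_neg r_zero)

lemma eq_diff_iff: "\<lbrakk>x \<in> carrier G; y \<in> carrier G; z \<in> carrier G\<rbrakk> \<Longrightarrow> z = x \<ominus> y \<longleftrightarrow> z \<oplus> y = x"
  by (metis diff_eq_iff)

lemma neg_add_eq_diff: "\<lbrakk>x \<in> carrier G; y \<in> carrier G\<rbrakk> \<Longrightarrow> \<ominus> x \<oplus> y = y \<ominus> x"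
  by (simp add: minus_eq a_ac)

lemma add_neg_eq_diff: "\<lbrakk>x \<in> carrier G; y \<in> carrier G\<rbrakk> \<Longrightarrow> x \<oplus> \<ominus> y = x \<ominus> y"
  by (simp add: minus_eq a_ac)

lemma diff_neg: "\<lbrakk>x \<in> carrier G; y \<in> carrier G\<rbrakk> \<Longrightarrow> x \<ominus> \<ominus> y = x \<oplus> y"
  by (simp add: minus_eq)

lemma neg_diff: "\<lbrakk>x \<in> carrier G; y \<in> carrier G\<rbrakk> \<Longrightarrow> \<ominus> (x \<ominus> y) = y \<ominus> x"
  by (simp add: minus_eq a_ac minus_add)

lemma neg_diff_left: "\<lbrakk>x \<in> carrier G; y \<in> carrier G\<rbrakk> \<Longrightarrow> \<ominus> x \<ominus> y = \<ominus> (x \<oplus> y)"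
  by (simp add: minus_eq a_ac minus_add)

lemma neg_eq_iff: "\<lbrakk>x \<in> carrier G; y \<in> carrier G\<rbrakk> \<Longrightarrow> \<ominus> x = y \<longleftrightarrow> \<zero> = y \<oplus> x"
  by (metis minus_equality l_neg)

lemma eq_neg_iff: "\<lbrakk>x \<in> carrier G; y \<in> carrier G\<rbrakk> \<Longrightarrow> y = \<ominus> x \<longleftrightarrow> y \<oplus> x = \<zero>"
  by (metis minus_equality l_neg)

lemma diff_zero: "x \<in> carrier G \<Longrightarrow> x \<ominus> \<zero> = x"
  by (simp add: minus_eq)

lemma diff_self: "x \<in> carrier G \<Longrightarrow> x \<ominus> x = \<zero>"
  by (simp add: minus_eq r_neg)

text \<open>As in \<open>algebra_simps\<close>: negative terms are collected behind a single \<open>\<ominus>\<close> and moved to the other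
  side, which leaves an identity that holds up to associativity and commutativity.\<close>

lemmas diff_simps = add_diff diff_add diff_diff_left diff_diff_right diff_eq_iff eq_diff_iff
  neg_add_eq_diff add_neg_eq_diff diff_neg neg_diff neg_diff_left neg_eq_iff eq_neg_iff diff_zero

end

lemma (in module) smult_diff:
  assumes "a \<in> carrier R" "x \<in> carrier M" "y \<in> carrier M"
  shows "a \<odot>\<^bsub>M\<^esub> (x \<ominus>\<^bsub>M\<^esub> y) = a \<odot>\<^bsub>M\<^esub> x \<ominus>\<^bsub>M\<^esub> a \<odot>\<^bsub>M\<^esub> y"
  using assms by (simp add: M.minus_eq smult_r_distr smult_r_minus)

section \<open>Linear maps between modules and additive maps on carriers\<close>

lemma linear_mapsI:
  assumes "\<And>x. x \<in> carrier V \<Longrightarrow> f x \<in> carrier W" "f \<in> extensional (carrier V)"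
    and "\<And>x y. \<lbrakk>x \<in> carrier V; y \<in> carrier V\<rbrakk> \<Longrightarrow> f (x \<oplus>\<^bsub>V\<^esub> y) = f x \<oplus>\<^bsub>W\<^esub> f y"
    and "\<And>a x. \<lbrakk>a \<in> carrier K; x \<in> carrier V\<rbrakk> \<Longrightarrow> f (a \<odot>\<^bsub>V\<^esub> x) = a \<odot>\<^bsub>W\<^esub> f x"
  shows "f \<in> linear_maps K V W"
  using assms by (auto simp: linear_maps_def PiE_def)

lemma linear_mapsD:
  assumes "f \<in> linear_maps K V W"
  shows "x \<in> carrier V \<Longrightarrow> f x \<in> carrier W"
    and "f \<in> extensional (carrier V)"
    and "\<lbrakk>x \<in> carrier V; y \<in> carrier V\<rbrakk> \<Longrightarrow> f (x \<oplus>\<^bsub>V\<^esub> y) = f x \<oplus>\<^bsub>W\<^esub> f y"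
    and "\<lbrakk>a \<in> carrier K; x \<in> carrier V\<rbrakk> \<Longrightarrow> f (a \<odot>\<^bsub>V\<^esub> x) = a \<odot>\<^bsub>W\<^esub> f x"
  using assms by (auto simp: linear_maps_def PiE_def)

text \<open>Stated for functions that are merely additive on the carrier, so that it also applies to
  partial brackets such as \<open>\<lambda>y. lie L y x\<close>, which are not undefined off the
  carrier and hence not members of \<open>linear_maps\<close>.\<close>

lemma additive_zero:
  assumes "abelian_group V" "abelian_group W"
    and "\<And>x. x \<in> carrier V \<Longrightarrow> f x \<in> carrier W"
    and "\<And>x y. \<lbrakk>x \<in> carrier V; y \<in> carrier V\<rbrakk> \<Longrightarrow> f (x \<oplus>\<^bsub>V\<^esub> y) = f x \<oplus>\<^bsub>W\<^esub> f y"
  shows "f \<zero>\<^bsub>V\<^esub> = \<zero>\<^bsub>W\<^esub>"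
proof -
  interpret V: abelian_group V by fact
  interpret W: abelian_group W by fact
  have "f \<zero>\<^bsub>V\<^esub> \<oplus>\<^bsub>W\<^esub> f \<zero>\<^bsub>V\<^esub> = f \<zero>\<^bsub>V\<^esub>"
    using assms(4)[of "\<zero>\<^bsub>V\<^esub>" "\<zero>\<^bsub>V\<^esub>"] by simp
  then show ?thesis
    using assms(3)[OF V.zero_closed] by (metis W.add.r_cancel_one)
qed

lemma additive_neg:
  assumes "abelian_group V" "abelian_group W"
    and "\<And>x. x \<in> carrier V \<Longrightarrow> f x \<in> carrier W"
    and "\<And>x y. \<lbrakk>x \<in> carrier V; y \<in> carrier V\<rbrakk> \<Longrightarrow> f (x \<oplus>\<^bsub>V\<^esub> y) = f x \<oplus>\<^bsub>W\<^esub> f y"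
    and "x \<in> carrier V"
  shows "f (\<ominus>\<^bsub>V\<^esub> x) = \<ominus>\<^bsub>W\<^esub> f x"
proof -
  interpret V: abelian_group V by fact
  interpret W: abelian_group W by fact
  have "f (\<ominus>\<^bsub>V\<^esub> x) \<oplus>\<^bsub>W\<^esub> f x = \<zero>\<^bsub>W\<^esub>"
    using assms(4)[of "\<ominus>\<^bsub>V\<^esub> x" x] additive_zero[OF assms(1-4)] assms(5) by (simp add: V.l_neg)
  then show ?thesis
    using assms(3,5) by (simp add: W.minus_equality)
qed

lemma additive_diff:
  assumes "abelian_group V" "abelian_group W"
    and "\<And>x. x \<in> carrier V \<Longrightarrow> f x \<in> carrier W"
    and "\<And>x y. \<lbrakk>x \<in> carrier V; y \<in> carrier V\<rbrakk> \<Longrightarrow> f (x \<oplus>\<^bsub>V\<^esub> y) = f x \<oplus>\<^bsub>W\<^esub> f y"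
    and "x \<in> carrier V" "y \<in> carrier V"
  shows "f (x \<ominus>\<^bsub>V\<^esub> y) = f x \<ominus>\<^bsub>W\<^esub> f y"
proof -
  interpret V: abelian_group V by fact
  interpret W: abelian_group W by fact
  show ?thesis
    using assms(3-6) by (simp add: V.minus_eq W.minus_eq additive_neg[OF assms(1-4)])
qed

lemma linear_maps_zero:
  assumes "f \<in> linear_maps K V W" "abelian_group V" "abelian_group W"
  shows "f \<zero>\<^bsub>V\<^esub> = \<zero>\<^bsub>W\<^esub>"
  by (rule additive_zero[OF assms(2,3)]) (use linear_mapsD[OF assms(1)] in auto)

lemma linear_maps_neg:
  assumes "f \<in> linear_maps K V W" "abelian_group V" "abelian_group W" "x \<in> carrier V"
  shows "f (\<ominus>\<^bsub>V\<^esub> x) = \<ominus>\<^bsub>W\<^esub> f x"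
  by (rule additive_neg[OF assms(2,3)]) (use linear_mapsD[OF assms(1)] assms(4) in auto)

lemma linear_maps_diff:
  assumes "f \<in> linear_maps K V W" "abelian_group V" "abelian_group W"
    and "x \<in> carrier V" "y \<in> carrier V"
  shows "f (x \<ominus>\<^bsub>V\<^esub> y) = f x \<ominus>\<^bsub>W\<^esub> f y"
  by (rule additive_diff[OF assms(2,3)]) (use linear_mapsD[OF assms(1)] assms(4,5) in auto)

section \<open>Consequences of the Lie algebra axioms\<close>

context lie_algebra
begin

lemma lie_zero_right [simp]: "x \<in> carrier L \<Longrightarrow> lie L x \<zero>\<^bsub>L\<^esub> = \<zero>\<^bsub>L\<^esub>"
  by (rule additive_zero[OF M.abelian_group_axioms M.abelian_group_axioms])
     (auto simp: lie_closed lie_add_right)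

lemma lie_zero_left [simp]: "x \<in> carrier L \<Longrightarrow> lie L \<zero>\<^bsub>L\<^esub> x = \<zero>\<^bsub>L\<^esub>"
  by (rule additive_zero[OF M.abelian_group_axioms M.abelian_group_axioms, where f = "\<lambda>y. lie L y x"])
     (auto simp: lie_closed lie_add_left)

lemma lie_diff_right:
  "\<lbrakk>x \<in> carrier L; y \<in> carrier L; z \<in> carrier L\<rbrakk> \<Longrightarrow> lie L x (y \<ominus>\<^bsub>L\<^esub> z) = lie L x y \<ominus>\<^bsub>L\<^esub> lie L x z"
  by (rule additive_diff[OF M.abelian_group_axioms M.abelian_group_axioms])
     (auto simp: lie_closed lie_add_right)

lemma lie_diff_left:
  "\<lbrakk>x \<in> carrier L; y \<in> carrier L; z \<in> carrier L\<rbrakk> \<Longrightarrow> lie L (x \<ominus>\<^bsub>L\<^esub> y) z = lie L x z \<ominus>\<^bsub>L\<^esub> lie L y z"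
  by (rule additive_diff[OF M.abelian_group_axioms M.abelian_group_axioms, where f = "\<lambda>y. lie L y z"])
     (auto simp: lie_closed lie_add_left)

text \<open>Polarisation: expanding [x + y, x + y] = 0 leaves only the two mixed brackets.\<close>

lemma lie_antisym:
  assumes "x \<in> carrier L" "y \<in> carrier L"
  shows "lie L y x = \<ominus>\<^bsub>L\<^esub> lie L x y"
proof -
  have "lie L x y \<in> carrier L" "lie L y x \<in> carrier L"
    using assms by (simp_all add: lie_closed)
  moreover have "lie L (x \<oplus>\<^bsub>L\<^esub> y) (x \<oplus>\<^bsub>L\<^esub> y) = \<zero>\<^bsub>L\<^esub>"
    using assms by (intro lie_self) simp
  ultimately have "lie L y x \<oplus>\<^bsub>L\<^esub> lie L x y = \<zero>\<^bsub>L\<^esub>"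
    using assms lie_add_left[of x y "x \<oplus>\<^bsub>L\<^esub> y"]
    by (simp add: lie_add_right lie_self M.a_comm)
  then show ?thesis
    using assms by (simp add: M.minus_equality lie_closed)
qed

lemma lie_neg_right:
  "\<lbrakk>x \<in> carrier L; y \<in> carrier L\<rbrakk> \<Longrightarrow> lie L x (\<ominus>\<^bsub>L\<^esub> y) = \<ominus>\<^bsub>L\<^esub> lie L x y"
  by (rule additive_neg[OF M.abelian_group_axioms M.abelian_group_axioms])
     (auto simp: lie_closed lie_add_right)

lemma lie_neg_left:
  "\<lbrakk>x \<in> carrier L; y \<in> carrier L\<rbrakk> \<Longrightarrow> lie L (\<ominus>\<^bsub>L\<^esub> x) y = \<ominus>\<^bsub>L\<^esub> lie L x y"
  by (rule additive_neg[OF M.abelian_group_axioms M.abelian_group_axioms, where f = "\<lambda>x. lie L x y"])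
     (auto simp: lie_closed lie_add_left)

text \<open>The Jacobi identity oriented as a rewrite rule: a left-nested bracket becomes
  right-nested ones, so that both sides of a bracket identity can be brought to the same
  terms.\<close>

lemma jacobi_left:
  assumes "x \<in> carrier L" "y \<in> carrier L" "z \<in> carrier L"
  shows "lie L (lie L x y) z = lie L x (lie L y z) \<ominus>\<^bsub>L\<^esub> lie L y (lie L x z)"
proof -
  have 1: "lie L y (lie L z x) = \<ominus>\<^bsub>L\<^esub> lie L y (lie L x z)"
    using assms by (simp add: lie_antisym[of x z] lie_neg_right lie_closed)
  have 2: "lie L z (lie L x y) = \<ominus>\<^bsub>L\<^esub> lie L (lie L x y) z"
    using assms by (intro lie_antisym lie_closed)
  show ?thesis
    using jacobi[OF assms, unfolded 1 2] assms by (simp add: lie_closed M.diff_simps M.a_ac)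
qed

end

section \<open>Continuity of the operations\<close>

context topological_vector_space
begin

lemma continuous_map_vector_add:
  assumes "continuous_map Z T f" "continuous_map Z T h"
  shows "continuous_map Z T (\<lambda>x. f x \<oplus>\<^bsub>V\<^esub> h x)"
  using continuous_map_compose[OF _ continuous_add, of Z "\<lambda>x. (f x, h x)"] assms
  by (simp add: continuous_map_paired o_def)

lemma continuous_map_vector_smult:
  assumes "continuous_map Z (ftopo K) f" "continuous_map Z T h"
  shows "continuous_map Z T (\<lambda>x. f x \<odot>\<^bsub>V\<^esub> h x)"
  using continuous_map_compose[OF _ continuous_smult, of Z "\<lambda>x. (f x, h x)"] assms
  by (simp add: continuous_map_paired o_def)

text \<open>Negation is scaling by -1, so its continuity comes from that of the scalar
  multiplication.\<close>

lemma continuous_map_vector_neg: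
  assumes "continuous_map Z T f"
  shows "continuous_map Z T (\<lambda>x. \<ominus>\<^bsub>V\<^esub> f x)"
proof -
  have "continuous_map Z T (\<lambda>x. (\<ominus>\<^bsub>K\<^esub> \<one>\<^bsub>K\<^esub>) \<odot>\<^bsub>V\<^esub> f x)"
    using assms by (intro continuous_map_vector_smult) (simp_all add: topspace_field)
  then show ?thesis
  proof (rule continuous_map_eq)
    fix x assume "x \<in> topspace Z"
    then have "f x \<in> carrier V"
      using assms topspace_vector by (auto simp: continuous_map_def)
    then show "(\<ominus>\<^bsub>K\<^esub> \<one>\<^bsub>K\<^esub>) \<odot>\<^bsub>V\<^esub> f x = \<ominus>\<^bsub>V\<^esub> f x"
      by (simp add: smult_l_minus)
  qed
qed

lemma continuous_map_vector_diff:
  assumes "continuous_map Z T f" "continuous_map Z T h"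
  shows "continuous_map Z T (\<lambda>x. f x \<ominus>\<^bsub>V\<^esub> h x)"
  unfolding a_minus_def using assms by (intro continuous_map_vector_add continuous_map_vector_neg)

end

lemma (in topological_lie_algebra) continuous_map_lie:
  assumes "continuous_map Z (topo L) f" "continuous_map Z (topo L) h"
  shows "continuous_map Z (topo L) (\<lambda>x. lie L (f x) (h x))"
  using continuous_map_compose[OF _ continuous_lie, of Z "\<lambda>x. (f x, h x)"] assms
  by (simp add: continuous_map_paired o_def)

section \<open>Derivations and the centre\<close>

context topological_lie_algebra
begin

lemma mem_der_iff:
  "D \<in> carrier (der K L) \<longleftrightarrow> D \<in> linear_maps K L L \<and> continuous_map (topo L) (topo L) D \<and>
    (\<forall>x\<in>carrier L. \<forall>y\<in>carrier L. D (lie L x y) = lie L (D x) y \<oplus>\<^bsub>L\<^esub> lie L x (D y))"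
  by (simp add: der_def)

lemma der_add: "D \<oplus>\<^bsub>der K L\<^esub> E = (\<lambda>x\<in>carrier L. D x \<oplus>\<^bsub>L\<^esub> E x)"
  by (simp add: der_def)

lemma der_zero: "\<zero>\<^bsub>der K L\<^esub> = (\<lambda>x\<in>carrier L. \<zero>\<^bsub>L\<^esub>)"
  by (simp add: der_def)

lemma der_smult: "a \<odot>\<^bsub>der K L\<^esub> D = (\<lambda>x\<in>carrier L. a \<odot>\<^bsub>L\<^esub> D x)"
  by (simp add: der_def)

lemma der_lie: "lie (der K L) D E = (\<lambda>x\<in>carrier L. D (E x) \<ominus>\<^bsub>L\<^esub> E (D x))"
  by (simp add: der_def)

lemma der_add_closed:
  assumes "D \<in> carrier (der K L)" "E \<in> carrier (der K L)"
  shows "D \<oplus>\<^bsub>der K L\<^esub> E \<in> carrier (der K L)"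
proof -
  note D = assms(1)[unfolded mem_der_iff] and E = assms(2)[unfolded mem_der_iff]
  note LD = linear_mapsD[OF conjunct1[OF D]] and LE = linear_mapsD[OF conjunct1[OF E]]
  have "continuous_map (topo L) (topo L) (\<lambda>x\<in>carrier L. D x \<oplus>\<^bsub>L\<^esub> E x)"
    using continuous_map_vector_add[of "topo L" D E] D E
    by (auto simp: topspace_vector elim: continuous_map_eq)
  moreover have "(\<lambda>x\<in>carrier L. D x \<oplus>\<^bsub>L\<^esub> E x) \<in> linear_maps K L L"
    by (rule linear_mapsI) (auto simp: LD LE M.a_ac smult_r_distr)
  ultimately show ?thesis
    unfolding mem_der_iff der_add using D E LD(1) LE(1)
    by (simp add: lie_closed lie_add_left lie_add_right M.a_ac)
qed

lemma der_neg_closed: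
  assumes "D \<in> carrier (der K L)"
  shows "(\<lambda>x\<in>carrier L. \<ominus>\<^bsub>L\<^esub> D x) \<in> carrier (der K L)"
proof -
  note D = assms(1)[unfolded mem_der_iff]
  note LD = linear_mapsD[OF conjunct1[OF D]]
  have "continuous_map (topo L) (topo L) (\<lambda>x\<in>carrier L. \<ominus>\<^bsub>L\<^esub> D x)"
    using continuous_map_vector_neg[of "topo L" D] D
    by (auto simp: topspace_vector elim: continuous_map_eq)
  moreover have "(\<lambda>x\<in>carrier L. \<ominus>\<^bsub>L\<^esub> D x) \<in> linear_maps K L L"
    by (rule linear_mapsI) (auto simp: LD M.minus_add smult_r_minus)
  ultimately show ?thesis
    unfolding mem_der_iff using D LD(1)
    by (simp add: lie_closed lie_neg_left lie_neg_right M.minus_add)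
qed

text \<open>The record of \<open>der K L\<close> lists zero and addition only, and its negatives are
  given abstractly. Uniqueness of inverses in this group lets \<open>der_diff\<close> compute
  differences, and hence the curvature, pointwise.\<close>

lemma abelian_group_der: "abelian_group (der K L)"
proof (rule abelian_groupI)
  show "\<zero>\<^bsub>der K L\<^esub> \<in> carrier (der K L)"
    unfolding mem_der_iff der_zero
    by (auto intro!: linear_mapsI simp: lie_closed topspace_vector intro: continuous_map_eq[of _ _ "\<lambda>_. \<zero>\<^bsub>L\<^esub>"])
  fix D assume D: "D \<in> carrier (der K L)"
  note LD = linear_mapsD[OF conjunct1[OF D[unfolded mem_der_iff]]]
  show "\<zero>\<^bsub>der K L\<^esub> \<oplus>\<^bsub>der K L\<^esub> D = D"
    unfolding der_zero der_add by (rule extensionalityI[OF _ LD(2)]) (auto simp: LD)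
  show "\<exists>E\<in>carrier (der K L). E \<oplus>\<^bsub>der K L\<^esub> D = \<zero>\<^bsub>der K L\<^esub>"
    using LD(1) by (intro bexI[OF _ der_neg_closed[OF D]]) (auto simp: der_add der_zero M.l_neg)
next
  fix D E assume DE: "D \<in> carrier (der K L)" "E \<in> carrier (der K L)"
  then show "D \<oplus>\<^bsub>der K L\<^esub> E = E \<oplus>\<^bsub>der K L\<^esub> D"
    unfolding der_add mem_der_iff by (auto simp: linear_mapsD(1) M.a_ac)
  fix F assume "F \<in> carrier (der K L)"
  then show "D \<oplus>\<^bsub>der K L\<^esub> E \<oplus>\<^bsub>der K L\<^esub> F = D \<oplus>\<^bsub>der K L\<^esub> (E \<oplus>\<^bsub>der K L\<^esub> F)"
    using DE unfolding der_add mem_der_iff by (auto simp: linear_mapsD(1) M.a_ac)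
qed (rule der_add_closed)

text \<open>For \<open>D\<close> it is enough to map the carrier into itself: in the curvature
  \<open>D\<close> is a bracket of two derivations, and this form avoids proving first that the
  bracket is again a derivation.\<close>

lemma der_diff:
  assumes "E \<in> carrier (der K L)" "\<And>x. x \<in> carrier L \<Longrightarrow> D x \<in> carrier L"
  shows "D \<ominus>\<^bsub>der K L\<^esub> E = (\<lambda>x\<in>carrier L. D x \<ominus>\<^bsub>L\<^esub> E x)"
proof -
  note LE = linear_mapsD[OF conjunct1[OF assms(1)[unfolded mem_der_iff]]]
  have "(\<lambda>x\<in>carrier L. \<ominus>\<^bsub>L\<^esub> E x) \<oplus>\<^bsub>der K L\<^esub> E = \<zero>\<^bsub>der K L\<^esub>"
    using LE(1) by (auto simp: der_add der_zero M.l_neg)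
  then have "\<ominus>\<^bsub>der K L\<^esub> E = (\<lambda>x\<in>carrier L. \<ominus>\<^bsub>L\<^esub> E x)"
    by (intro abelian_group.minus_equality[OF abelian_group_der]) (use assms der_neg_closed in auto)
  then show ?thesis
    unfolding a_minus_def der_add by auto
qed

end

lemma carrier_center:
  "carrier (center n) = {z \<in> carrier n. \<forall>x\<in>carrier n. lie n z x = \<zero>\<^bsub>n\<^esub>}"
  by (simp add: center_def Let_def)

lemma center_simps [simp]:
  "\<zero>\<^bsub>center n\<^esub> = \<zero>\<^bsub>n\<^esub>" "x \<oplus>\<^bsub>center n\<^esub> y = x \<oplus>\<^bsub>n\<^esub> y" "a \<odot>\<^bsub>center n\<^esub> x = a \<odot>\<^bsub>n\<^esub> x"
  "topo (center n) = subtopology (topo n) (carrier (center n))"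
  by (simp_all add: center_def Let_def)

section \<open>Cochains of degree at most two\<close>

lemma list_update_in_tuples:
  "\<lbrakk>xs \<in> tuples g p; x \<in> carrier g\<rbrakk> \<Longrightarrow> xs[i := x] \<in> tuples g p"
  using set_update_subset_insert[of xs i x] by (auto simp: tuples_def)

lemma singleton_in_tuples [simp]: "[x] \<in> tuples g (Suc 0) \<longleftrightarrow> x \<in> carrier g"
  by (auto simp: tuples_def)

lemma pair_in_tuples [simp]: "[x, y] \<in> tuples g 2 \<longleftrightarrow> x \<in> carrier g \<and> y \<in> carrier g"
  by (auto simp: tuples_def)

lemma triple_in_tuples [simp]:
  "[x, y, z] \<in> tuples g 3 \<longleftrightarrow> x \<in> carrier g \<and> y \<in> carrier g \<and> z \<in> carrier g"
  by (auto simp: tuples_def)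

lemma tuples_1E:
  assumes "xs \<in> tuples g (Suc 0)"
  obtains x where "x \<in> carrier g" "xs = [x]"
  using assms by (auto simp: tuples_def length_Suc_conv)

lemma tuples_2E:
  assumes "xs \<in> tuples g 2"
  obtains x y where "x \<in> carrier g" "y \<in> carrier g" "xs = [x, y]"
  using assms by (auto simp: tuples_def length_Suc_conv numeral_eq_Suc)

lemma tuples_3E:
  assumes "xs \<in> tuples g 3"
  obtains x y z where "x \<in> carrier g" "y \<in> carrier g" "z \<in> carrier g" "xs = [x, y, z]"
  using assms by (auto simp: tuples_def length_Suc_conv numeral_eq_Suc)

lemma restrict_tuples_2_eqI:
  assumes "\<alpha> \<in> extensional (tuples g 2)"
    and "\<And>x y. \<lbrakk>x \<in> carrier g; y \<in> carrier g\<rbrakk> \<Longrightarrow> \<alpha> [x, y] = f [x, y]"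
  shows "\<alpha> = (\<lambda>xs\<in>tuples g 2. f xs)"
  by (rule extensionalityI[OF assms(1) restrict_extensional]) (auto elim!: tuples_2E simp: assms(2))

section \<open>Closure properties of cochains, values in the centre, and working rules in degrees
  one and two\<close>

locale lie_pair = G: topological_lie_algebra K g + N: topological_lie_algebra K n
  for K :: "'k top_field" and g :: "('k, 'g) top_lie_alg" and n :: "('k, 'n) top_lie_alg"
begin

lemma cochain_closed: "\<lbrakk>\<alpha> \<in> cochains K p g V; xs \<in> tuples g p\<rbrakk> \<Longrightarrow> \<alpha> xs \<in> carrier V"
  by (auto simp: cochains_def)

lemma cochain_extensional: "\<alpha> \<in> cochains K p g V \<Longrightarrow> \<alpha> \<in> extensional (tuples g p)"
  by (auto simp: cochains_def PiE_def)

lemma topspace_map_in_tuples: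
  "f \<in> topspace (product_topology (\<lambda>_. topo g) {..<p}) \<Longrightarrow> map f [0..<p] \<in> tuples g p"
  by (auto simp: tuples_def G.topspace_vector PiE_def Pi_def)

lemma cochains_addI:
  assumes "\<alpha> \<in> cochains K p g n" "\<beta> \<in> cochains K p g n"
  shows "(\<lambda>xs\<in>tuples g p. \<alpha> xs \<oplus>\<^bsub>n\<^esub> \<beta> xs) \<in> cochains K p g n"
proof -
  have "(\<lambda>x\<in>carrier g. \<alpha> (xs[i := x]) \<oplus>\<^bsub>n\<^esub> \<beta> (xs[i := x])) \<in> linear_maps K g n"
    if xs: "xs \<in> tuples g p" and i: "i < p" for xs i
  proof -
    have "(\<lambda>x\<in>carrier g. \<alpha> (xs[i := x])) \<in> linear_maps K g n" "(\<lambda>x\<in>carrier g. \<beta> (xs[i := x])) \<in> linear_maps K g n"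
      using assms xs i by (auto simp: cochains_def)
    note l = linear_mapsD[OF this(1)] linear_mapsD[OF this(2)]
    show ?thesis
      by (rule linear_mapsI) (use l in \<open>auto simp: N.M.a_ac N.smult_r_distr\<close>)
  qed
  moreover have "continuous_map (product_topology (\<lambda>_. topo g) {..<p}) (topo n)
     (\<lambda>x. (\<lambda>xs\<in>tuples g p. \<alpha> xs \<oplus>\<^bsub>n\<^esub> \<beta> xs) (map x [0..<p]))"
    using assms N.continuous_map_vector_add[of "product_topology (\<lambda>_. topo g) {..<p}"
        "\<lambda>x. \<alpha> (map x [0..<p])" "\<lambda>x. \<beta> (map x [0..<p])"]
    by (auto simp: cochains_def topspace_map_in_tuples elim!: continuous_map_eq)
  ultimately show ?thesis
    using assms unfolding cochains_def
    by (auto simp: list_update_in_tuples cong: restrict_cong)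
qed

lemma cochains_negI:
  assumes "\<alpha> \<in> cochains K p g n"
  shows "(\<lambda>xs\<in>tuples g p. \<ominus>\<^bsub>n\<^esub> \<alpha> xs) \<in> cochains K p g n"
proof -
  have "(\<lambda>x\<in>carrier g. \<ominus>\<^bsub>n\<^esub> \<alpha> (xs[i := x])) \<in> linear_maps K g n"
    if xs: "xs \<in> tuples g p" and i: "i < p" for xs i
  proof -
    have "(\<lambda>x\<in>carrier g. \<alpha> (xs[i := x])) \<in> linear_maps K g n"
      using assms xs i by (auto simp: cochains_def)
    note l = linear_mapsD[OF this(1)]
    show ?thesis
      by (rule linear_mapsI) (use l in \<open>auto simp: N.M.minus_add N.smult_r_minus\<close>)
  qed
  moreover have "continuous_map (product_topology (\<lambda>_. topo g) {..<p}) (topo n)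
     (\<lambda>x. (\<lambda>xs\<in>tuples g p. \<ominus>\<^bsub>n\<^esub> \<alpha> xs) (map x [0..<p]))"
    using assms N.continuous_map_vector_neg[of "product_topology (\<lambda>_. topo g) {..<p}"
        "\<lambda>x. \<alpha> (map x [0..<p])"]
    by (auto simp: cochains_def topspace_map_in_tuples elim!: continuous_map_eq)
  ultimately show ?thesis
    using assms unfolding cochains_def
    by (auto simp: list_update_in_tuples cong: restrict_cong)
qed

lemma cochains_zeroI: "(\<lambda>xs\<in>tuples g p. \<zero>\<^bsub>n\<^esub>) \<in> cochains K p g n"
proof -
  have "(\<lambda>x\<in>carrier g. \<zero>\<^bsub>n\<^esub>) \<in> linear_maps K g n"
    by (rule linear_mapsI) auto
  moreover have "continuous_map (product_topology (\<lambda>_. topo g) {..<p}) (topo n)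
     (\<lambda>x. (\<lambda>xs\<in>tuples g p. \<zero>\<^bsub>n\<^esub>) (map x [0..<p]))"
    by (rule continuous_map_eq[of _ _ "\<lambda>_. \<zero>\<^bsub>n\<^esub>"]) (auto simp: topspace_map_in_tuples N.topspace_vector)
  ultimately show ?thesis
    unfolding cochains_def by (auto simp: list_update_in_tuples cong: restrict_cong)
qed

lemma linear_maps_center_iff:
  "f \<in> linear_maps K g (center n) \<longleftrightarrow> f \<in> linear_maps K g n \<and> (\<forall>x\<in>carrier g. f x \<in> carrier (center n))"
  by (auto simp: linear_maps_def carrier_center PiE_def Pi_def)

text \<open>The centre has the operations of \<open>n\<close> and the subspace topology, so only the
  range condition separates the two sets. Computations with central cochains can therefore be done
  in \<open>n\<close>.\<close>

lemma cochains_center_iff: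
  "\<alpha> \<in> cochains K p g (center n) \<longleftrightarrow>
    \<alpha> \<in> cochains K p g n \<and> (\<forall>xs\<in>tuples g p. \<alpha> xs \<in> carrier (center n))"
proof -
  have "carrier (center n) \<subseteq> carrier n"
    by (auto simp: carrier_center)
  then show ?thesis
    unfolding cochains_def linear_maps_center_iff
    by (auto 0 3 simp: continuous_map_in_subtopology topspace_map_in_tuples list_update_in_tuples PiE_def Pi_def)
qed

text \<open>The one-fold power of \<open>g\<close> is \<open>g\<close>: constant families and the
  projection at index 0 are continuous and inverse to each other. The alternating condition is void,
  since a list of length one is distinct.\<close>

lemma cochains_1_iff:
  "\<gamma> \<in> cochains K (Suc 0) g n \<longleftrightarrow> \<gamma> \<in> extensional (tuples g (Suc 0)) \<and>
    (\<lambda>x\<in>carrier g. \<gamma> [x]) \<in> linear_maps K g n \<and> continuous_map (topo g) (topo n) (\<lambda>x. \<gamma> [x])"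
    (is "?l \<longleftrightarrow> ?e \<and> ?m \<and> ?c")
proof -
  have "continuous_map (product_topology (\<lambda>_. topo g) {..<Suc 0}) (topo n) (\<lambda>x. \<gamma> (map x [0..<Suc 0]))
    \<longleftrightarrow> ?c" (is "?C \<longleftrightarrow> _")
  proof
    assume C: ?C
    have "continuous_map (topo g) (product_topology (\<lambda>_. topo g) {..<Suc 0}) (\<lambda>x. \<lambda>i\<in>{..<Suc 0}. x)"
      by (auto simp: continuous_map_componentwise)
    from continuous_map_compose[OF this C] show ?c
      by (simp add: o_def)
  next
    assume C: ?c
    have "continuous_map (product_topology (\<lambda>_. topo g) {..<Suc 0}) (topo g) (\<lambda>x. x 0)"
      by (rule continuous_map_product_projection) simp
    from continuous_map_compose[OF this C] show ?C
      by (simp add: o_def)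
  qed
  moreover have "?m \<longleftrightarrow> (\<forall>xs\<in>tuples g (Suc 0). \<forall>i<Suc 0. (\<lambda>x\<in>carrier g. \<gamma> (xs[i := x])) \<in> linear_maps K g n)"
  proof
    assume ?m
    then show "\<forall>xs\<in>tuples g (Suc 0). \<forall>i<Suc 0. (\<lambda>x\<in>carrier g. \<gamma> (xs[i := x])) \<in> linear_maps K g n"
      by (auto elim!: tuples_1E)
  next
    assume "\<forall>xs\<in>tuples g (Suc 0). \<forall>i<Suc 0. (\<lambda>x\<in>carrier g. \<gamma> (xs[i := x])) \<in> linear_maps K g n"
    \<comment> \<open>The list only serves to have its single entry overwritten; the zero vector
      supplies one.\<close>
    from this[rule_format, of "[\<zero>\<^bsub>g\<^esub>]" 0] show ?m
      by simp
  qed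
  moreover have "\<forall>xs\<in>tuples g (Suc 0). \<gamma> xs \<in> carrier n" if ?m
    using linear_mapsD(1)[OF that] by (auto elim!: tuples_1E)
  moreover have "\<forall>xs\<in>tuples g (Suc 0). \<not> distinct xs \<longrightarrow> \<gamma> xs = \<zero>\<^bsub>n\<^esub>"
    by (auto elim!: tuples_1E)
  ultimately show ?thesis
    unfolding cochains_def PiE_def Pi_def by auto
qed

text \<open>For maps given by a formula in two variables, such as the cocycle of a section.
  Continuity on families over {0, 1} is inherited from continuity on pairs by evaluating at both
  indices.\<close>

lemma cochains_2I:
  assumes "\<And>x y. \<lbrakk>x \<in> carrier g; y \<in> carrier g\<rbrakk> \<Longrightarrow> f x y \<in> carrier n"
    and "\<And>x y z. \<lbrakk>x \<in> carrier g; y \<in> carrier g; z \<in> carrier g\<rbrakk> \<Longrightarrow> f (x \<oplus>\<^bsub>g\<^esub> y) z = f x z \<oplus>\<^bsub>n\<^esub> f y z"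
    and "\<And>x y z. \<lbrakk>x \<in> carrier g; y \<in> carrier g; z \<in> carrier g\<rbrakk> \<Longrightarrow> f x (y \<oplus>\<^bsub>g\<^esub> z) = f x y \<oplus>\<^bsub>n\<^esub> f x z"
    and "\<And>a x y. \<lbrakk>a \<in> carrier K; x \<in> carrier g; y \<in> carrier g\<rbrakk> \<Longrightarrow> f (a \<odot>\<^bsub>g\<^esub> x) y = a \<odot>\<^bsub>n\<^esub> f x y"
    and "\<And>a x y. \<lbrakk>a \<in> carrier K; x \<in> carrier g; y \<in> carrier g\<rbrakk> \<Longrightarrow> f x (a \<odot>\<^bsub>g\<^esub> y) = a \<odot>\<^bsub>n\<^esub> f x y"
    and "\<And>x. x \<in> carrier g \<Longrightarrow> f x x = \<zero>\<^bsub>n\<^esub>"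
    and "continuous_map (prod_topology (topo g) (topo g)) (topo n) (\<lambda>p. f (fst p) (snd p))"
  shows "(\<lambda>xs\<in>tuples g 2. f (xs ! 0) (xs ! 1)) \<in> cochains K 2 g n"
proof -
  let ?P = "product_topology (\<lambda>_. topo g) {..<2::nat}"
  have "continuous_map ?P (topo g) (\<lambda>x. x i)" if "i < 2" for i :: nat
    using that by (intro continuous_map_product_projection) simp
  then have "continuous_map ?P (prod_topology (topo g) (topo g)) (\<lambda>x. (x 0, x 1))"
    by (simp add: continuous_map_paired)
  from continuous_map_compose[OF this assms(7)]
  have "continuous_map ?P (topo n) (\<lambda>x. f (x 0) (x 1))"
    by (simp add: o_def)
  then have "continuous_map ?P (topo n) (\<lambda>x. (\<lambda>xs\<in>tuples g 2. f (xs ! 0) (xs ! 1)) (map x [0..<2]))"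
    by (rule continuous_map_eq) (use topspace_map_in_tuples[of _ 2] in auto)
  moreover have "(\<lambda>z\<in>carrier g. (\<lambda>xs\<in>tuples g 2. f (xs ! 0) (xs ! 1)) (xs[i := z])) \<in> linear_maps K g n"
    if xs: "xs \<in> tuples g 2" and i: "i < 2" for xs i
  proof -
    obtain x y where "x \<in> carrier g" "y \<in> carrier g" "xs = [x, y]"
      using xs by (rule tuples_2E)
    with i show ?thesis
      by (intro linear_mapsI) (auto simp: less_2_cases_iff assms(1-5))
  qed
  ultimately show ?thesis
    unfolding cochains_def by (auto elim!: tuples_2E simp: assms(1,6))
qed

context
  fixes \<alpha> assumes \<alpha>: "\<alpha> \<in> cochains K 2 g n"
begin

lemma cochains_2_closed: "\<lbrakk>x \<in> carrier g; y \<in> carrier g\<rbrakk> \<Longrightarrow> \<alpha> [x, y] \<in> carrier n"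
  using cochain_closed[OF \<alpha>, of "[x, y]"] by simp

lemma cochains_2_linear:
  assumes "x \<in> carrier g" "y \<in> carrier g"
  shows "(\<lambda>x\<in>carrier g. \<alpha> [x, y]) \<in> linear_maps K g n" "(\<lambda>y\<in>carrier g. \<alpha> [x, y]) \<in> linear_maps K g n"
proof -
  have *: "(\<lambda>z\<in>carrier g. \<alpha> ([x, y][i := z])) \<in> linear_maps K g n" if "i < 2" for i
  proof -
    have "[x, y] \<in> tuples g 2"
      using assms by simp
    with \<alpha> that show ?thesis
      unfolding cochains_def by blast
  qed
  from *[of 0] *[of 1] show "(\<lambda>x\<in>carrier g. \<alpha> [x, y]) \<in> linear_maps K g n" "(\<lambda>y\<in>carrier g. \<alpha> [x, y]) \<in> linear_maps K g n"
    by auto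
qed

lemma cochains_2_add_left:
  assumes "x \<in> carrier g" "y \<in> carrier g" "z \<in> carrier g"
  shows "\<alpha> [x \<oplus>\<^bsub>g\<^esub> y, z] = \<alpha> [x, z] \<oplus>\<^bsub>n\<^esub> \<alpha> [y, z]"
  using linear_mapsD(3)[OF cochains_2_linear(1)[of x z], of x y] assms by simp

lemma cochains_2_add_right:
  assumes "x \<in> carrier g" "y \<in> carrier g" "z \<in> carrier g"
  shows "\<alpha> [x, y \<oplus>\<^bsub>g\<^esub> z] = \<alpha> [x, y] \<oplus>\<^bsub>n\<^esub> \<alpha> [x, z]"
  using linear_mapsD(3)[OF cochains_2_linear(2)[of x y], of y z] assms by simp

lemma cochains_2_smult_left:
  assumes "a \<in> carrier K" "x \<in> carrier g" "y \<in> carrier g"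
  shows "\<alpha> [a \<odot>\<^bsub>g\<^esub> x, y] = a \<odot>\<^bsub>n\<^esub> \<alpha> [x, y]"
  using linear_mapsD(4)[OF cochains_2_linear(1)[of x y], of a x] assms by simp

lemma cochains_2_smult_right:
  assumes "a \<in> carrier K" "x \<in> carrier g" "y \<in> carrier g"
  shows "\<alpha> [x, a \<odot>\<^bsub>g\<^esub> y] = a \<odot>\<^bsub>n\<^esub> \<alpha> [x, y]"
  using linear_mapsD(4)[OF cochains_2_linear(2)[of x y], of a y] assms by simp

lemma cochains_2_self: "x \<in> carrier g \<Longrightarrow> \<alpha> [x, x] = \<zero>\<^bsub>n\<^esub>"
  using \<alpha> by (auto simp: cochains_def)

lemma cochains_2_zero:
  assumes "x \<in> carrier g"
  shows "\<alpha> [\<zero>\<^bsub>g\<^esub>, x] = \<zero>\<^bsub>n\<^esub>" "\<alpha> [x, \<zero>\<^bsub>g\<^esub>] = \<zero>\<^bsub>n\<^esub>"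
  using linear_maps_zero[OF cochains_2_linear(1)[OF assms assms] G.M.abelian_group_axioms N.M.abelian_group_axioms]
    linear_maps_zero[OF cochains_2_linear(2)[OF assms assms] G.M.abelian_group_axioms N.M.abelian_group_axioms]
  by simp_all

lemma cochains_2_neg_right:
  assumes "x \<in> carrier g" "y \<in> carrier g"
  shows "\<alpha> [x, \<ominus>\<^bsub>g\<^esub> y] = \<ominus>\<^bsub>n\<^esub> \<alpha> [x, y]"
  using linear_maps_neg[OF cochains_2_linear(2)[OF assms(1,1)] G.M.abelian_group_axioms N.M.abelian_group_axioms assms(2)]
    assms(2) by simp

lemma cochains_2_antisym:
  assumes "x \<in> carrier g" "y \<in> carrier g"
  shows "\<alpha> [y, x] = \<ominus>\<^bsub>n\<^esub> \<alpha> [x, y]"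
proof -
  have "\<alpha> [x, y] \<in> carrier n" "\<alpha> [y, x] \<in> carrier n"
    using assms by (simp_all add: cochains_2_closed)
  moreover have "\<alpha> [x \<oplus>\<^bsub>g\<^esub> y, x \<oplus>\<^bsub>g\<^esub> y] = \<zero>\<^bsub>n\<^esub>"
    using assms by (intro cochains_2_self) simp
  ultimately have "\<alpha> [y, x] \<oplus>\<^bsub>n\<^esub> \<alpha> [x, y] = \<zero>\<^bsub>n\<^esub>"
    using assms cochains_2_add_left[of x y "x \<oplus>\<^bsub>g\<^esub> y"]
    by (simp add: cochains_2_add_right cochains_2_self N.M.a_comm)
  then show ?thesis
    using assms by (simp add: N.M.minus_equality cochains_2_closed)
qed

lemma cochains_2_continuous:
  assumes "continuous_map Z (topo g) f" "continuous_map Z (topo g) h"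
  shows "continuous_map Z (topo n) (\<lambda>z. \<alpha> [f z, h z])"
proof -
  let ?P = "product_topology (\<lambda>_. topo g) {..<2::nat}"
  have "continuous_map Z ?P (\<lambda>z. \<lambda>i\<in>{..<2}. if i = 0 then f z else h z)"
    using assms by (auto simp: continuous_map_componentwise less_2_cases_iff)
  moreover have "continuous_map ?P (topo n) (\<lambda>x. \<alpha> (map x [0..<2]))"
    using \<alpha> by (simp add: cochains_def)
  ultimately show ?thesis
    using continuous_map_compose[of Z ?P _ "topo n" "\<lambda>x. \<alpha> (map x [0..<2])"]
    by (fastforce simp: o_def upt_rec)
qed

end

context
  fixes \<gamma> assumes \<gamma>: "\<gamma> \<in> cochains K (Suc 0) g n"
begin

lemma cochains_1_closed: "x \<in> carrier g \<Longrightarrow> \<gamma> [x] \<in> carrier n"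
  using cochain_closed[OF \<gamma>, of "[x]"] by simp

lemma cochains_1_add: "\<lbrakk>x \<in> carrier g; y \<in> carrier g\<rbrakk> \<Longrightarrow> \<gamma> [x \<oplus>\<^bsub>g\<^esub> y] = \<gamma> [x] \<oplus>\<^bsub>n\<^esub> \<gamma> [y]"
  using \<gamma> linear_mapsD(3)[of "\<lambda>x\<in>carrier g. \<gamma> [x]" K g n x y] by (simp add: cochains_1_iff)

lemma cochains_1_smult: "\<lbrakk>a \<in> carrier K; x \<in> carrier g\<rbrakk> \<Longrightarrow> \<gamma> [a \<odot>\<^bsub>g\<^esub> x] = a \<odot>\<^bsub>n\<^esub> \<gamma> [x]"
  using \<gamma> linear_mapsD(4)[of "\<lambda>x\<in>carrier g. \<gamma> [x]" K g n a x] by (simp add: cochains_1_iff)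

lemma cochains_1_continuous: "continuous_map (topo g) (topo n) (\<lambda>x. \<gamma> [x])"
  using \<gamma> by (simp add: cochains_1_iff)

end

text \<open>The degree 2 differential freed from lists and finite sums;
  \<open>differential_2\<close> shows the agreement. Being an abbreviation, it is transparent to
  rewriting.\<close>

abbreviation d2 :: "('g \<Rightarrow> 'n \<Rightarrow> 'n) \<Rightarrow> ('g list \<Rightarrow> 'n) \<Rightarrow> 'g \<Rightarrow> 'g \<Rightarrow> 'g \<Rightarrow> 'n"
  where "d2 S \<alpha> x y z \<equiv>
    S x (\<alpha> [y, z]) \<ominus>\<^bsub>n\<^esub> S y (\<alpha> [x, z]) \<oplus>\<^bsub>n\<^esub> S z (\<alpha> [x, y])
    \<ominus>\<^bsub>n\<^esub> \<alpha> [lie g x y, z] \<oplus>\<^bsub>n\<^esub> \<alpha> [lie g x z, y] \<ominus>\<^bsub>n\<^esub> \<alpha> [lie g y z, x]"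

section \<open>Maps in \<open>C1c\<close>, their curvature, and the differential in degrees one and
  two\<close>

lemma C1cI:
  assumes "S \<in> extensional (carrier g)"
    and "\<And>x. x \<in> carrier g \<Longrightarrow> S x \<in> extensional (carrier n)"
    and closed: "\<And>x v. \<lbrakk>x \<in> carrier g; v \<in> carrier n\<rbrakk> \<Longrightarrow> S x v \<in> carrier n"
    and "\<And>x v w. \<lbrakk>x \<in> carrier g; v \<in> carrier n; w \<in> carrier n\<rbrakk> \<Longrightarrow> S x (v \<oplus>\<^bsub>n\<^esub> w) = S x v \<oplus>\<^bsub>n\<^esub> S x w"
    and "\<And>a x v. \<lbrakk>a \<in> carrier K; x \<in> carrier g; v \<in> carrier n\<rbrakk> \<Longrightarrow> S x (a \<odot>\<^bsub>n\<^esub> v) = a \<odot>\<^bsub>n\<^esub> S x v"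
    and add: "\<And>x y v. \<lbrakk>x \<in> carrier g; y \<in> carrier g; v \<in> carrier n\<rbrakk> \<Longrightarrow> S (x \<oplus>\<^bsub>g\<^esub> y) v = S x v \<oplus>\<^bsub>n\<^esub> S y v"
    and smult: "\<And>a x v. \<lbrakk>a \<in> carrier K; x \<in> carrier g; v \<in> carrier n\<rbrakk> \<Longrightarrow> S (a \<odot>\<^bsub>g\<^esub> x) v = a \<odot>\<^bsub>n\<^esub> S x v"
    and "\<And>x v w. \<lbrakk>x \<in> carrier g; v \<in> carrier n; w \<in> carrier n\<rbrakk>
      \<Longrightarrow> S x (lie n v w) = lie n (S x v) w \<oplus>\<^bsub>n\<^esub> lie n v (S x w)"
    and cont: "continuous_map (prod_topology (topo g) (topo n)) (topo n) (\<lambda>p. S (fst p) (snd p))"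
  shows "S \<in> C1c K g n"
proof -
  \<comment> \<open>Each single operator is continuous as the restriction of the jointly continuous
    map to the slice over x.\<close>
  have "continuous_map (topo n) (topo n) (S x)" if "x \<in> carrier g" for x
  proof -
    have "continuous_map (topo n) (prod_topology (topo g) (topo n)) (\<lambda>v. (x, v))"
      using that by (simp add: continuous_map_paired G.topspace_vector)
    from continuous_map_compose[OF this cont] show ?thesis
      by (simp add: o_def)
  qed
  then have der: "S x \<in> carrier (der K n)" if "x \<in> carrier g" for x
    using that assms by (simp add: N.mem_der_iff linear_mapsI)
  have "S (x \<oplus>\<^bsub>g\<^esub> y) = S x \<oplus>\<^bsub>der K n\<^esub> S y" if "x \<in> carrier g" "y \<in> carrier g" for x y
    unfolding N.der_add by (rule extensionalityI[OF assms(2) restrict_extensional]) (use that add in auto)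
  moreover have "S (a \<odot>\<^bsub>g\<^esub> x) = a \<odot>\<^bsub>der K n\<^esub> S x" if "a \<in> carrier K" "x \<in> carrier g" for a x
    unfolding N.der_smult by (rule extensionalityI[OF assms(2) restrict_extensional]) (use that smult in auto)
  ultimately have "S \<in> linear_maps K g (der K n)"
    using assms(1) der by (intro linear_mapsI)
  with cont show ?thesis
    by (simp add: C1c_def case_prod_beta')
qed

context
  fixes S assumes S: "S \<in> C1c K g n"
begin

lemma C1c_linear: "S \<in> linear_maps K g (der K n)"
  using S by (simp add: C1c_def)

lemma C1c_extensional: "S \<in> extensional (carrier g)"
  using linear_mapsD(2)[OF C1c_linear] .

lemma C1c_der: "x \<in> carrier g \<Longrightarrow> S x \<in> carrier (der K n)"
  using linear_mapsD(1)[OF C1c_linear] .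

lemma C1c_value_linear: "x \<in> carrier g \<Longrightarrow> S x \<in> linear_maps K n n"
  using C1c_der by (simp add: N.mem_der_iff)

lemma C1c_value_extensional: "x \<in> carrier g \<Longrightarrow> S x \<in> extensional (carrier n)"
  using linear_mapsD(2)[OF C1c_value_linear] .

lemma C1c_closed: "\<lbrakk>x \<in> carrier g; v \<in> carrier n\<rbrakk> \<Longrightarrow> S x v \<in> carrier n"
  using linear_mapsD(1)[OF C1c_value_linear] .

lemma C1c_add_right:
  "\<lbrakk>x \<in> carrier g; v \<in> carrier n; w \<in> carrier n\<rbrakk> \<Longrightarrow> S x (v \<oplus>\<^bsub>n\<^esub> w) = S x v \<oplus>\<^bsub>n\<^esub> S x w"
  using linear_mapsD(3)[OF C1c_value_linear] .

lemma C1c_smult_right: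
  "\<lbrakk>x \<in> carrier g; a \<in> carrier K; v \<in> carrier n\<rbrakk> \<Longrightarrow> S x (a \<odot>\<^bsub>n\<^esub> v) = a \<odot>\<^bsub>n\<^esub> S x v"
  using linear_mapsD(4)[OF C1c_value_linear] .

lemma C1c_zero_right: "x \<in> carrier g \<Longrightarrow> S x \<zero>\<^bsub>n\<^esub> = \<zero>\<^bsub>n\<^esub>"
  using linear_maps_zero[OF C1c_value_linear N.M.abelian_group_axioms N.M.abelian_group_axioms] .

lemma C1c_neg_right: "\<lbrakk>x \<in> carrier g; v \<in> carrier n\<rbrakk> \<Longrightarrow> S x (\<ominus>\<^bsub>n\<^esub> v) = \<ominus>\<^bsub>n\<^esub> S x v"
  using linear_maps_neg[OF C1c_value_linear N.M.abelian_group_axioms N.M.abelian_group_axioms] .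

lemma C1c_add_left:
  "\<lbrakk>x \<in> carrier g; y \<in> carrier g; v \<in> carrier n\<rbrakk> \<Longrightarrow> S (x \<oplus>\<^bsub>g\<^esub> y) v = S x v \<oplus>\<^bsub>n\<^esub> S y v"
  using linear_mapsD(3)[OF C1c_linear, of x y] by (simp add: N.der_add)

lemma C1c_smult_left:
  "\<lbrakk>a \<in> carrier K; x \<in> carrier g; v \<in> carrier n\<rbrakk> \<Longrightarrow> S (a \<odot>\<^bsub>g\<^esub> x) v = a \<odot>\<^bsub>n\<^esub> S x v"
  using linear_mapsD(4)[OF C1c_linear, of a x] by (simp add: N.der_smult)

lemma C1c_zero_left:
  assumes "v \<in> carrier n" shows "S \<zero>\<^bsub>g\<^esub> v = \<zero>\<^bsub>n\<^esub>"
  using assms linear_maps_zero[OF C1c_linear G.M.abelian_group_axioms N.abelian_group_der]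
  by (simp add: N.der_zero)

lemma C1c_derivation:
  "\<lbrakk>x \<in> carrier g; v \<in> carrier n; w \<in> carrier n\<rbrakk>
    \<Longrightarrow> S x (lie n v w) = lie n (S x v) w \<oplus>\<^bsub>n\<^esub> lie n v (S x w)"
  using C1c_der[of x] by (simp add: N.mem_der_iff)

lemma C1c_continuous:
  assumes "continuous_map Z (topo g) f" "continuous_map Z (topo n) h"
  shows "continuous_map Z (topo n) (\<lambda>z. S (f z) (h z))"
  using continuous_map_compose[of Z "prod_topology (topo g) (topo n)" "\<lambda>z. (f z, h z)" "topo n"
      "\<lambda>(x, v). S x v"] S assms
  by (simp add: C1c_def continuous_map_paired o_def)

text \<open>Both the curvature and \<open>ad\<close> are restricted to \<open>carrier n\<close>, so
  equality of the two operators is equality at every vector. From here on the record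
  \<open>der K n\<close> can be left aside in statements about curvature.\<close>

lemma curvature_inner_iff:
  assumes "\<And>x y. \<lbrakk>x \<in> carrier g; y \<in> carrier g\<rbrakk> \<Longrightarrow> \<omega> [x, y] \<in> carrier n"
  shows "curvature_inner K g n S \<omega> \<longleftrightarrow> (\<forall>x\<in>carrier g. \<forall>y\<in>carrier g. \<forall>v\<in>carrier n.
    S x (S y v) \<ominus>\<^bsub>n\<^esub> S y (S x v) \<ominus>\<^bsub>n\<^esub> S (lie g x y) v = lie n (\<omega> [x, y]) v)"
proof -
  have "curvature K g n S x y = ad n (\<omega> [x, y]) \<longleftrightarrow> (\<forall>v\<in>carrier n.
    S x (S y v) \<ominus>\<^bsub>n\<^esub> S y (S x v) \<ominus>\<^bsub>n\<^esub> S (lie g x y) v = lie n (\<omega> [x, y]) v)"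
    if "x \<in> carrier g" "y \<in> carrier g" for x y
  proof -
    have "curvature K g n S x y
      = (\<lambda>v\<in>carrier n. S x (S y v) \<ominus>\<^bsub>n\<^esub> S y (S x v) \<ominus>\<^bsub>n\<^esub> S (lie g x y) v)"
      unfolding curvature_def using that
      by (subst N.der_diff) (auto simp: C1c_der C1c_closed G.lie_closed N.der_lie)
    then show ?thesis
      unfolding ad_def restrict_def fun_eq_iff by auto
  qed
  then show ?thesis
    unfolding curvature_inner_def by simp
qed

lemma neg_one_pow_simps:
  "neg_one_pow K 0 = \<one>\<^bsub>K\<^esub>" "neg_one_pow K (Suc 0) = \<ominus>\<^bsub>K\<^esub> \<one>\<^bsub>K\<^esub>"
  "neg_one_pow K 2 = \<one>\<^bsub>K\<^esub>" "neg_one_pow K (Suc (Suc 0)) = \<one>\<^bsub>K\<^esub>"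
  "neg_one_pow K (Suc (Suc (Suc 0))) = \<ominus>\<^bsub>K\<^esub> \<one>\<^bsub>K\<^esub>"
  by (simp_all add: neg_one_pow_def numeral_eq_Suc G.l_minus G.r_minus)

lemma differential_1:
  assumes \<gamma>: "\<And>x. x \<in> carrier g \<Longrightarrow> \<gamma> [x] \<in> carrier n" and "x \<in> carrier g" "y \<in> carrier g"
  shows "differential K g n S (Suc 0) \<gamma> [x, y] = S x (\<gamma> [y]) \<ominus>\<^bsub>n\<^esub> S y (\<gamma> [x]) \<ominus>\<^bsub>n\<^esub> \<gamma> [lie g x y]"
proof -
  have eqs: "{..Suc 0} = {0, 1}" "{(i::nat, j). i < j \<and> j \<le> Suc 0} = {(0, 1)}"
    by auto
  have "[x, y] \<in> tuples g (Suc (Suc 0))"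
    using assms by (auto simp: tuples_def)
  then show ?thesis
    unfolding differential_def eqs using assms
    by (simp add: omit_def neg_one_pow_simps C1c_closed G.lie_closed N.smult_l_minus
        N.M.minus_eq N.M.a_ac)
qed

lemma differential_2:
  assumes \<alpha>: "\<And>x y. \<lbrakk>x \<in> carrier g; y \<in> carrier g\<rbrakk> \<Longrightarrow> \<alpha> [x, y] \<in> carrier n"
    and "x \<in> carrier g" "y \<in> carrier g" "z \<in> carrier g"
  shows "differential K g n S 2 \<alpha> [x, y, z] =
    d2 S \<alpha> x y z"
proof -
  have eqs: "{..2::nat} = {0, 1, 2}" "{(i::nat, j). i < j \<and> j \<le> 2} = {(0, 1), (0, 2), (1, 2)}"
    by auto
  have finsum_3: "(\<Oplus>\<^bsub>n\<^esub>i\<in>{a, b, c}. f i) = f a \<oplus>\<^bsub>n\<^esub> f b \<oplus>\<^bsub>n\<^esub> f c"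
    if "f a \<in> carrier n" "f b \<in> carrier n" "f c \<in> carrier n" "a \<noteq> b" "a \<noteq> c" "b \<noteq> c" for f :: "'i \<Rightarrow> 'n" and a b c
    using that by (simp add: N.M.a_ac)
  have "(\<Oplus>\<^bsub>n\<^esub>ij\<in>{(0, 1), (0, 2), (1, 2)}. neg_one_pow K (fst ij + snd ij) \<odot>\<^bsub>n\<^esub>
          \<alpha> (lie g ([x, y, z] ! fst ij) ([x, y, z] ! snd ij) # omit (fst ij) (omit (snd ij) [x, y, z])))
      = \<ominus>\<^bsub>n\<^esub> \<alpha> [lie g x y, z] \<oplus>\<^bsub>n\<^esub> \<alpha> [lie g x z, y] \<oplus>\<^bsub>n\<^esub> \<ominus>\<^bsub>n\<^esub> \<alpha> [lie g y z, x]"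
    using assms by (subst finsum_3) (simp_all add: omit_def neg_one_pow_simps G.lie_closed N.smult_l_minus)
  moreover have "(\<Oplus>\<^bsub>n\<^esub>j\<in>{0, 1, 2}. neg_one_pow K j \<odot>\<^bsub>n\<^esub> S ([x, y, z] ! j) (\<alpha> (omit j [x, y, z])))
      = S x (\<alpha> [y, z]) \<oplus>\<^bsub>n\<^esub> \<ominus>\<^bsub>n\<^esub> S y (\<alpha> [x, z]) \<oplus>\<^bsub>n\<^esub> S z (\<alpha> [x, y])"
    using assms by (subst finsum_3) (simp_all add: omit_def neg_one_pow_simps C1c_closed N.smult_l_minus)
  moreover have "[x, y, z] \<in> tuples g (Suc 2)"
    using assms by (auto simp: tuples_def)
  ultimately show ?thesis
    unfolding differential_def eqs using assms
    by (simp add: C1c_closed G.lie_closed N.M.diff_simps N.M.a_ac)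
qed

lemma differential_2_eq_zero_iff:
  assumes \<alpha>: "\<And>x y. \<lbrakk>x \<in> carrier g; y \<in> carrier g\<rbrakk> \<Longrightarrow> \<alpha> [x, y] \<in> carrier n"
  shows "differential K g n S 2 \<alpha> = (\<lambda>xs\<in>tuples g 3. \<zero>\<^bsub>n\<^esub>) \<longleftrightarrow>
    (\<forall>x\<in>carrier g. \<forall>y\<in>carrier g. \<forall>z\<in>carrier g.
      d2 S \<alpha> x y z = \<zero>\<^bsub>n\<^esub>)"
    (is "?D = ?Z \<longleftrightarrow> ?R")
proof -
  have "?D \<in> extensional (tuples g 3)"
    by (simp add: differential_def)
  then have "?D = ?Z \<longleftrightarrow> (\<forall>xs\<in>tuples g 3. ?D xs = ?Z xs)"
    by (metis extensionalityI restrict_extensional)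
  also have "\<dots> \<longleftrightarrow> (\<forall>x\<in>carrier g. \<forall>y\<in>carrier g. \<forall>z\<in>carrier g. ?D [x, y, z] = \<zero>\<^bsub>n\<^esub>)"
    (is "?l \<longleftrightarrow> ?r")
  proof
    assume ?r
    show ?l
    proof
      fix xs assume "xs \<in> tuples g 3"
      then obtain x y z where "x \<in> carrier g" "y \<in> carrier g" "z \<in> carrier g" "xs = [x, y, z]"
        by (rule tuples_3E)
      with \<open>?r\<close> show "?D xs = ?Z xs"
        by simp
    qed
  next
    assume ?l
    then show ?r
      by (metis restrict_apply' triple_in_tuples)
  qed
  also have "\<dots> \<longleftrightarrow> ?R"
    by (intro ball_cong refl) (simp only: differential_2 \<alpha>)
  finally show ?thesis .
qed

lemma add_inner_eq:
  assumes "\<And>x. x \<in> carrier g \<Longrightarrow> \<gamma> [x] \<in> carrier n"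
  shows "add_inner K g n S \<gamma> = (\<lambda>x\<in>carrier g. \<lambda>v\<in>carrier n. S x v \<oplus>\<^bsub>n\<^esub> lie n (\<gamma> [x]) v)"
  unfolding add_inner_def N.der_add ad_def by (intro restrict_ext) simp

end

text \<open>The form in which factor systems are checked and used below: only equations between
  vectors of \<open>n\<close> remain, without operator records, index sets or finite sums.\<close>

lemma factor_cocycles_iff:
  assumes S: "S \<in> C1c K g n"
  shows "\<omega> \<in> factor_cocycles K g n S \<longleftrightarrow> \<omega> \<in> cochains K 2 g n \<and>
    (\<forall>x\<in>carrier g. \<forall>y\<in>carrier g. \<forall>v\<in>carrier n.
      S x (S y v) \<ominus>\<^bsub>n\<^esub> S y (S x v) \<ominus>\<^bsub>n\<^esub> S (lie g x y) v = lie n (\<omega> [x, y]) v) \<and>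
    (\<forall>x\<in>carrier g. \<forall>y\<in>carrier g. \<forall>z\<in>carrier g.
      d2 S \<omega> x y z = \<zero>\<^bsub>n\<^esub>)"
proof (cases "\<omega> \<in> cochains K 2 g n")
  case True
  then show ?thesis
    unfolding factor_cocycles_def mem_Collect_eq
    using curvature_inner_iff[OF S, of \<omega>] differential_2_eq_zero_iff[OF S, of \<omega>] cochains_2_closed
    by blast
qed (simp add: factor_cocycles_def)

text \<open>The existential in the definition of an outer action is witnessed by \<omega>
  itself.\<close>

lemma factor_systems_iff:
  "(S, \<omega>) \<in> factor_systems K g n \<longleftrightarrow> S \<in> C1c K g n \<and> \<omega> \<in> factor_cocycles K g n S"
  unfolding factor_systems_def outer_actions_def factor_cocycles_def by auto

text \<open>The entries of the tuple and the degree 1 differential are written out because this is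
  the shape in which a change of section produces the new factor system, see
  \<open>factor_system_shift\<close>.\<close>

lemma C1_action_eq:
  assumes "(S, \<omega>) \<in> factor_systems K g n" and \<gamma>: "\<gamma> \<in> cochains K (Suc 0) g n"
  shows "C1_action K g n \<gamma> (S, \<omega>) =
    (\<lambda>x\<in>carrier g. \<lambda>v\<in>carrier n. S x v \<oplus>\<^bsub>n\<^esub> lie n (\<gamma> [x]) v,
     \<lambda>xs\<in>tuples g 2. \<omega> [xs ! 0, xs ! 1]
      \<oplus>\<^bsub>n\<^esub> (S (xs ! 0) (\<gamma> [xs ! 1]) \<ominus>\<^bsub>n\<^esub> S (xs ! 1) (\<gamma> [xs ! 0]) \<ominus>\<^bsub>n\<^esub> \<gamma> [lie g (xs ! 0) (xs ! 1)])
      \<oplus>\<^bsub>n\<^esub> lie n (\<gamma> [xs ! 0]) (\<gamma> [xs ! 1]))" (is "_ = ?r")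
proof -
  have S: "S \<in> C1c K g n"
    using assms(1) by (simp add: factor_systems_iff)
  note \<gamma>_closed = cochains_1_closed[OF \<gamma>]
  have "C1_action K g n \<gamma> (S, \<omega>) = (add_inner K g n S \<gamma>, \<lambda>xs\<in>tuples g 2. \<omega> xs
      \<oplus>\<^bsub>n\<^esub> differential K g n S (Suc 0) \<gamma> xs \<oplus>\<^bsub>n\<^esub> lie n (\<gamma> [xs ! 0]) (\<gamma> [xs ! 1]))"
    using assms(1) by (simp add: C1_action_def)
  also have "\<dots> = ?r"
    unfolding prod.inject
  proof (rule conjI[OF add_inner_eq[OF S] restrict_ext])
    show "\<gamma> [x] \<in> carrier n" if "x \<in> carrier g" for x
      using that by (rule \<gamma>_closed)
  next
    fix xs assume "xs \<in> tuples g 2"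
    then obtain x y where "x \<in> carrier g" "y \<in> carrier g" "xs = [x, y]"
      by (rule tuples_2E)
    then show "\<omega> xs \<oplus>\<^bsub>n\<^esub> differential K g n S (Suc 0) \<gamma> xs \<oplus>\<^bsub>n\<^esub> lie n (\<gamma> [xs ! 0]) (\<gamma> [xs ! 1]) =
      \<omega> [xs ! 0, xs ! 1]
      \<oplus>\<^bsub>n\<^esub> (S (xs ! 0) (\<gamma> [xs ! 1]) \<ominus>\<^bsub>n\<^esub> S (xs ! 1) (\<gamma> [xs ! 0]) \<ominus>\<^bsub>n\<^esub> \<gamma> [lie g (xs ! 0) (xs ! 1)])
      \<oplus>\<^bsub>n\<^esub> lie n (\<gamma> [xs ! 0]) (\<gamma> [xs ! 1])"
      by (simp add: differential_1[OF S, of \<gamma>] \<gamma>_closed)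
  qed
  finally show ?thesis .
qed

end

section \<open>Extensions with a section\<close>

text \<open>The failure of \<sigma> to respect brackets. It is killed by the projection, hence lies
  in the image of \<open>incl E\<close>, from where it is pulled back to \<open>n\<close>.\<close>

definition section_cocycle ::
    "('k, 'g) top_lie_alg \<Rightarrow> ('k, 'n) top_lie_alg \<Rightarrow> ('k, 'n, 'g, 'e) lie_ext \<Rightarrow> ('g \<Rightarrow> 'e) \<Rightarrow> 'g list \<Rightarrow> 'n"
  where "section_cocycle g n E \<sigma> = (\<lambda>xs\<in>tuples g 2. inv_into (carrier n) (incl E)
    (lie (total E) (\<sigma> (xs ! 0)) (\<sigma> (xs ! 1)) \<ominus>\<^bsub>total E\<^esub> \<sigma> (lie g (xs ! 0) (xs ! 1))))"

text \<open>An extension stripped of its splitting. Such sequences occur as targets of morphisms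
  before a section of them is known; \<open>split_extension_equiv\<close> then supplies one.\<close>

locale lie_sequence = lie_pair K g n + L: topological_lie_algebra K "total E"
  for K :: "'k top_field" and g :: "('k, 'g) top_lie_alg" and n :: "('k, 'n) top_lie_alg"
    and E :: "('k, 'n, 'g, 'e) lie_ext" +
  assumes incl_hom: "incl E \<in> top_lie_hom K n (total E)"
    and incl_embedding: "embedding_map (topo n) (topo (total E)) (incl E)"
    and proj_hom: "proj E \<in> top_lie_hom K (total E) g"
    and kernel: "{e \<in> carrier (total E). proj E e = \<zero>\<^bsub>g\<^esub>} = incl E ` carrier n"
begin

lemma incl_linear: "incl E \<in> linear_maps K n (total E)"
  using incl_hom by (simp add: top_lie_hom_def)

lemma proj_linear: "proj E \<in> linear_maps K (total E) g"
  using proj_hom by (simp add: top_lie_hom_def)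

lemma incl_continuous: "continuous_map (topo n) (topo (total E)) (incl E)"
  using incl_hom by (simp add: top_lie_hom_def)

lemma proj_continuous: "continuous_map (topo (total E)) (topo g) (proj E)"
  using proj_hom by (simp add: top_lie_hom_def)

lemmas incl_closed = linear_mapsD(1)[OF incl_linear]
lemmas proj_closed = linear_mapsD(1)[OF proj_linear]
lemmas incl_simps =
  linear_mapsD(3,4)[OF incl_linear]
  linear_maps_zero[OF incl_linear N.M.abelian_group_axioms L.M.abelian_group_axioms]
  linear_maps_neg[OF incl_linear N.M.abelian_group_axioms L.M.abelian_group_axioms]
  linear_maps_diff[OF incl_linear N.M.abelian_group_axioms L.M.abelian_group_axioms]

lemmas proj_simps =
  linear_mapsD(3,4)[OF proj_linear]
  linear_maps_zero[OF proj_linear L.M.abelian_group_axioms G.M.abelian_group_axioms]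
  linear_maps_neg[OF proj_linear L.M.abelian_group_axioms G.M.abelian_group_axioms]
  linear_maps_diff[OF proj_linear L.M.abelian_group_axioms G.M.abelian_group_axioms]

lemma incl_lie: "\<lbrakk>v \<in> carrier n; w \<in> carrier n\<rbrakk> \<Longrightarrow> incl E (lie n v w) = lie (total E) (incl E v) (incl E w)"
  using incl_hom by (simp add: top_lie_hom_def)

lemma proj_lie:
  "\<lbrakk>e \<in> carrier (total E); f \<in> carrier (total E)\<rbrakk> \<Longrightarrow> proj E (lie (total E) e f) = lie g (proj E e) (proj E f)"
  using proj_hom by (simp add: top_lie_hom_def)

lemma proj_incl: "v \<in> carrier n \<Longrightarrow> proj E (incl E v) = \<zero>\<^bsub>g\<^esub>"
  using kernel by blast

lemma inj_incl: "inj_on (incl E) (carrier n)"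
  using incl_embedding unfolding embedding_map_def homeomorphic_eq_everything_map N.topspace_vector
  by simp

lemma incl_eqI: "\<lbrakk>incl E v = incl E w; v \<in> carrier n; w \<in> carrier n\<rbrakk> \<Longrightarrow> v = w"
  using inj_incl by (auto simp: inj_on_def)

abbreviation retract :: "'e \<Rightarrow> 'n"
  where "retract \<equiv> inv_into (carrier n) (incl E)"

lemma retract_incl: "v \<in> carrier n \<Longrightarrow> retract (incl E v) = v"
  using inj_incl by simp

lemma
  assumes "e \<in> carrier (total E)" "proj E e = \<zero>\<^bsub>g\<^esub>"
  shows retract_closed: "retract e \<in> carrier n" and incl_retract: "incl E (retract e) = e"
proof -
  have "e \<in> incl E ` carrier n"
    using assms kernel by blast
  then show "retract e \<in> carrier n" "incl E (retract e) = e"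
    by (auto intro: inv_into_into f_inv_into_f)
qed

text \<open>\<open>retract\<close> is only a set-theoretic inverse. On the image of
  \<open>incl E\<close> it agrees with the continuous inverse that comes with the embedding, and the
  values of f lie in that image, which is the kernel.\<close>

lemma continuous_map_retract:
  assumes "continuous_map Z (topo (total E)) f" "\<And>z. z \<in> topspace Z \<Longrightarrow> proj E (f z) = \<zero>\<^bsub>g\<^esub>"
  shows "continuous_map Z (topo n) (\<lambda>z. retract (f z))"
proof -
  let ?I = "subtopology (topo (total E)) (incl E ` carrier n)"
  have hom: "homeomorphic_map (topo n) ?I (incl E)"
    using incl_embedding by (simp add: embedding_map_def N.topspace_vector)
  then obtain r where r: "homeomorphic_maps (topo n) ?I (incl E) r"
    by (auto simp: homeomorphic_map_maps)
  have mem: "f z \<in> incl E ` carrier n" if "z \<in> topspace Z" for z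
    using assms that kernel L.topspace_vector by (auto simp: continuous_map_def)
  have "continuous_map Z ?I f"
    using assms(1) mem by (auto simp: continuous_map_in_subtopology)
  then have "continuous_map Z (topo n) (r \<circ> f)"
    using r by (auto simp: homeomorphic_maps_def intro: continuous_map_compose)
  then show ?thesis
  proof (rule continuous_map_eq)
    fix z assume "z \<in> topspace Z"
    then obtain v where "v \<in> carrier n" "f z = incl E v"
      using mem by blast
    then show "(r \<circ> f) z = retract (f z)"
      using r by (simp add: homeomorphic_maps_def N.topspace_vector retract_incl)
  qed
qed

end

section \<open>The factor system of an extension with a chosen section\<close>

locale split_extension = lie_sequence K g n E
  for K :: "'k top_field" and g :: "('k, 'g) top_lie_alg" and n :: "('k, 'n) top_lie_alg"
    and E :: "('k, 'n, 'g, 'e) lie_ext" +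
  fixes \<sigma> :: "'g \<Rightarrow> 'e"
  assumes section_mem: "\<sigma> \<in> sections K g E"
begin

lemma section_linear: "\<sigma> \<in> linear_maps K g (total E)"
  using section_mem by (simp add: sections_def)

lemma section_continuous: "continuous_map (topo g) (topo (total E)) \<sigma>"
  using section_mem by (simp add: sections_def)

lemmas section_closed = linear_mapsD(1)[OF section_linear]

lemmas section_simps =
  linear_mapsD(3,4)[OF section_linear]
  linear_maps_zero[OF section_linear G.M.abelian_group_axioms L.M.abelian_group_axioms]
  linear_maps_neg[OF section_linear G.M.abelian_group_axioms L.M.abelian_group_axioms]
  linear_maps_diff[OF section_linear G.M.abelian_group_axioms L.M.abelian_group_axioms]

lemma proj_section: "x \<in> carrier g \<Longrightarrow> proj E (\<sigma> x) = x"
  using section_mem by (simp add: sections_def)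

abbreviation act :: "'g \<Rightarrow> 'n \<Rightarrow> 'n" where "act \<equiv> section_action g n E \<sigma>"
abbreviation coc :: "'g list \<Rightarrow> 'n" where "coc \<equiv> section_cocycle g n E \<sigma>"

lemma
  assumes "x \<in> carrier g" "v \<in> carrier n"
  shows act_closed: "act x v \<in> carrier n" and incl_act: "incl E (act x v) = lie (total E) (\<sigma> x) (incl E v)"
proof -
  have "lie (total E) (\<sigma> x) (incl E v) \<in> carrier (total E)"
    "proj E (lie (total E) (\<sigma> x) (incl E v)) = \<zero>\<^bsub>g\<^esub>"
    using assms by (simp_all add: L.lie_closed section_closed incl_closed proj_lie proj_incl proj_section)
  from retract_closed[OF this] incl_retract[OF this]
  show "act x v \<in> carrier n" "incl E (act x v) = lie (total E) (\<sigma> x) (incl E v)"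
    using assms by (simp_all add: section_action_def)
qed

lemma
  assumes "x \<in> carrier g" "y \<in> carrier g"
  shows coc_closed: "coc [x, y] \<in> carrier n"
    and incl_coc: "incl E (coc [x, y]) = lie (total E) (\<sigma> x) (\<sigma> y) \<ominus>\<^bsub>total E\<^esub> \<sigma> (lie g x y)"
proof -
  let ?e = "lie (total E) (\<sigma> x) (\<sigma> y) \<ominus>\<^bsub>total E\<^esub> \<sigma> (lie g x y)"
  have "?e \<in> carrier (total E)" "proj E ?e = \<zero>\<^bsub>g\<^esub>"
    using assms
    by (simp_all add: L.lie_closed G.lie_closed section_closed proj_lie proj_section proj_simps G.M.diff_self)
  from retract_closed[OF this] incl_retract[OF this]
  show "coc [x, y] \<in> carrier n" "incl E (coc [x, y]) = ?e"
    using assms by (simp_all add: section_cocycle_def)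
qed

lemmas closed_simps = incl_closed proj_closed section_closed act_closed coc_closed
  G.lie_closed L.lie_closed N.lie_closed

text \<open>These rules push \<open>incl E\<close> through the operations of \<open>n\<close>, the
  action and the cocycle, and \<sigma> through those of \<open>g\<close>. An equation in
  \<open>n\<close> thereby becomes one between brackets in the total algebra.\<close>

lemmas transfer_simps = incl_simps incl_lie incl_act incl_coc section_simps

lemma act_C1c: "act \<in> C1c K g n"
proof (rule C1cI)
  show "act \<in> extensional (carrier g)"
    by (simp add: section_action_def)
  show "act x \<in> extensional (carrier n)" if "x \<in> carrier g" for x
    using that by (simp add: section_action_def)
next
  let ?P = "prod_topology (topo g) (topo n)"
  have "continuous_map ?P (topo (total E)) (\<lambda>p. \<sigma> (fst p))" "continuous_map ?P (topo (total E)) (\<lambda>p. incl E (snd p))"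
    using continuous_map_compose[OF continuous_map_fst section_continuous]
      continuous_map_compose[OF continuous_map_snd incl_continuous] by (simp_all add: o_def)
  then have "continuous_map ?P (topo (total E)) (\<lambda>p. lie (total E) (\<sigma> (fst p)) (incl E (snd p)))"
    by (rule L.continuous_map_lie)
  then have "continuous_map ?P (topo n) (\<lambda>p. retract (lie (total E) (\<sigma> (fst p)) (incl E (snd p))))"
    by (rule continuous_map_retract)
       (auto simp: G.topspace_vector N.topspace_vector proj_lie proj_section proj_incl closed_simps)
  then show "continuous_map ?P (topo n) (\<lambda>p. act (fst p) (snd p))"
    by (rule continuous_map_eq) (auto simp: section_action_def G.topspace_vector N.topspace_vector)
next
  \<comment> \<open>The derivation law is the Jacobi identity for \<open>\<sigma> x\<close> and the
    images of v and w.\<close>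
  fix x v w assume "x \<in> carrier g" "v \<in> carrier n" "w \<in> carrier n"
  then show "act x (lie n v w) = lie n (act x v) w \<oplus>\<^bsub>n\<^esub> lie n v (act x w)"
    by (intro incl_eqI)
       (simp_all add: closed_simps transfer_simps L.jacobi_left L.M.diff_simps)
qed (auto intro!: incl_eqI simp: closed_simps transfer_simps
    L.lie_add_left L.lie_add_right L.lie_smult_left L.lie_smult_right)

lemma coc_cochain: "coc \<in> cochains K 2 g n"
proof -
  have "(\<lambda>xs\<in>tuples g 2. coc [xs ! 0, xs ! 1]) \<in> cochains K 2 g n"
  proof (rule cochains_2I)
    let ?P = "prod_topology (topo g) (topo g)"
    let ?e = "\<lambda>p. lie (total E) (\<sigma> (fst p)) (\<sigma> (snd p)) \<ominus>\<^bsub>total E\<^esub> \<sigma> (lie g (fst p) (snd p))"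
    have "continuous_map ?P (topo (total E)) (\<lambda>p. \<sigma> (fst p))" "continuous_map ?P (topo (total E)) (\<lambda>p. \<sigma> (snd p))"
      "continuous_map ?P (topo (total E)) (\<lambda>p. \<sigma> (lie g (fst p) (snd p)))"
      using continuous_map_compose[OF continuous_map_fst section_continuous]
        continuous_map_compose[OF continuous_map_snd section_continuous]
        continuous_map_compose[OF G.continuous_map_lie[OF continuous_map_fst continuous_map_snd] section_continuous]
      by (simp_all add: o_def)
    then have "continuous_map ?P (topo (total E)) ?e"
      by (intro L.continuous_map_lie L.continuous_map_vector_diff)
    then have "continuous_map ?P (topo n) (\<lambda>p. retract (?e p))"
      by (rule continuous_map_retract)
         (auto simp: G.topspace_vector proj_lie proj_section proj_simps closed_simps G.M.diff_self)
    then show "continuous_map ?P (topo n) (\<lambda>p. coc [fst p, snd p])"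
      by (rule continuous_map_eq) (auto simp: section_cocycle_def G.topspace_vector)
  qed (auto intro!: incl_eqI simp: closed_simps transfer_simps L.smult_diff
      G.lie_add_left G.lie_add_right G.lie_smult_left G.lie_smult_right G.lie_self
      L.lie_add_left L.lie_add_right L.lie_smult_left L.lie_smult_right L.lie_self
      L.M.diff_simps L.M.a_ac)
  moreover have "coc = (\<lambda>xs\<in>tuples g 2. coc [xs ! 0, xs ! 1])"
    by (rule restrict_tuples_2_eqI) (simp_all add: section_cocycle_def)
  ultimately show ?thesis
    by simp
qed

lemma section_factor_system: "(act, coc) \<in> factor_systems K g n"
  unfolding factor_systems_iff factor_cocycles_iff[OF act_C1c]
proof (intro conjI ballI act_C1c coc_cochain)
  fix x y v assume "x \<in> carrier g" "y \<in> carrier g" "v \<in> carrier n"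
  \<comment> \<open>After applying \<open>incl E\<close>, the Jacobi identity combines the first two
    terms into the bracket of [\<sigma> x, \<sigma> y] with v, and the third term subtracts the
    bracket of \<open>\<sigma> (lie g x y)\<close> with v.\<close>
  then show "act x (act y v) \<ominus>\<^bsub>n\<^esub> act y (act x v) \<ominus>\<^bsub>n\<^esub> act (lie g x y) v = lie n (coc [x, y]) v"
    by (intro incl_eqI)
       (simp_all add: closed_simps transfer_simps L.lie_diff_left L.jacobi_left L.M.diff_simps)
next
  fix x y z assume xyz: "x \<in> carrier g" "y \<in> carrier g" "z \<in> carrier g"
  have [simp]: "\<sigma> x \<in> carrier (total E)" "\<sigma> y \<in> carrier (total E)" "\<sigma> z \<in> carrier (total E)"
    using xyz by (simp_all add: section_closed)
  \<comment> \<open>\<open>eq1\<close> and \<open>eq3\<close> express the double brackets in the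
    total algebra and in \<open>g\<close> by those of the forms [x, [y, z]] and [y, [x, z]];
    \<open>eq2\<close> puts the brackets with a section value of a bracket in one order. The rest
    cancels by commutativity of addition.\<close>
  have eq1: "lie (total E) (\<sigma> z) (lie (total E) (\<sigma> x) (\<sigma> y)) =
      \<ominus>\<^bsub>total E\<^esub> (lie (total E) (\<sigma> x) (lie (total E) (\<sigma> y) (\<sigma> z)) \<ominus>\<^bsub>total E\<^esub> lie (total E) (\<sigma> y) (lie (total E) (\<sigma> x) (\<sigma> z)))"
    by (simp add: L.lie_antisym[of _ "\<sigma> z"] L.jacobi_left[symmetric] closed_simps)
  have eq2: "lie (total E) (\<sigma> (lie g x y)) (\<sigma> z) = \<ominus>\<^bsub>total E\<^esub> lie (total E) (\<sigma> z) (\<sigma> (lie g x y))"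
    "lie (total E) (\<sigma> (lie g x z)) (\<sigma> y) = \<ominus>\<^bsub>total E\<^esub> lie (total E) (\<sigma> y) (\<sigma> (lie g x z))"
    "lie (total E) (\<sigma> (lie g y z)) (\<sigma> x) = \<ominus>\<^bsub>total E\<^esub> lie (total E) (\<sigma> x) (\<sigma> (lie g y z))"
    using xyz by (auto intro!: L.lie_antisym simp: closed_simps)
  have eq3: "lie g (lie g x y) z = lie g x (lie g y z) \<ominus>\<^bsub>g\<^esub> lie g y (lie g x z)"
    "lie g (lie g x z) y = \<ominus>\<^bsub>g\<^esub> lie g y (lie g x z)"
    "lie g (lie g y z) x = \<ominus>\<^bsub>g\<^esub> lie g x (lie g y z)"
    using xyz by (auto intro!: G.lie_antisym G.jacobi_left simp: closed_simps)
  show "d2 act coc x y z = \<zero>\<^bsub>n\<^esub>"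
    using xyz
    by (intro incl_eqI)
       (simp_all add: closed_simps transfer_simps eq1 eq2 eq3 L.lie_diff_right L.M.diff_simps L.M.a_ac)
qed

subsection \<open>Change of section\<close>

definition shift :: "('g list \<Rightarrow> 'n) \<Rightarrow> 'g \<Rightarrow> 'e"
  where "shift \<gamma> = (\<lambda>x\<in>carrier g. \<sigma> x \<oplus>\<^bsub>total E\<^esub> incl E (\<gamma> [x]))"

lemma shift_section:
  assumes \<gamma>: "\<gamma> \<in> cochains K (Suc 0) g n"
  shows "shift \<gamma> \<in> sections K g E"
proof -
  note \<gamma>_simps = cochains_1_closed[OF \<gamma>] cochains_1_add[OF \<gamma>] cochains_1_smult[OF \<gamma>]
  have "shift \<gamma> \<in> linear_maps K g (total E)"
    by (rule linear_mapsI)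
       (auto simp: shift_def closed_simps \<gamma>_simps transfer_simps L.M.a_ac L.smult_r_distr)
  moreover have "continuous_map (topo g) (topo (total E)) (\<lambda>x. \<sigma> x \<oplus>\<^bsub>total E\<^esub> incl E (\<gamma> [x]))"
    using continuous_map_compose[OF cochains_1_continuous[OF \<gamma>] incl_continuous]
    by (intro L.continuous_map_vector_add section_continuous) (simp add: o_def)
  then have "continuous_map (topo g) (topo (total E)) (shift \<gamma>)"
    by (rule continuous_map_eq) (simp add: shift_def G.topspace_vector)
  ultimately show ?thesis
    unfolding sections_def
    by (simp add: shift_def proj_simps closed_simps \<gamma>_simps proj_section proj_incl)
qed

lemma split_extension_shift:
  assumes "\<gamma> \<in> cochains K (Suc 0) g n"
  shows "split_extension K g n E (shift \<gamma>)"
  by unfold_locales (rule shift_section[OF assms])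

lemma section_eq_shift:
  assumes "\<tau> \<in> sections K g E"
  obtains \<gamma> where "\<gamma> \<in> cochains K (Suc 0) g n" "\<tau> = shift \<gamma>"
proof
  interpret T: split_extension K g n E \<tau>
    by unfold_locales fact
  \<comment> \<open>The difference of two sections projects to 0, so it has a preimage under
    \<open>incl E\<close>; this preimage is the cochain.\<close>
  define \<gamma> where "\<gamma> = (\<lambda>xs\<in>tuples g (Suc 0). retract (\<tau> (xs ! 0) \<ominus>\<^bsub>total E\<^esub> \<sigma> (xs ! 0)))"
  have 1: "\<gamma> [x] \<in> carrier n \<and> incl E (\<gamma> [x]) = \<tau> x \<ominus>\<^bsub>total E\<^esub> \<sigma> x" if "x \<in> carrier g" for x
    using that retract_closed[of "\<tau> x \<ominus>\<^bsub>total E\<^esub> \<sigma> x"] incl_retract[of "\<tau> x \<ominus>\<^bsub>total E\<^esub> \<sigma> x"]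
    by (simp add: \<gamma>_def closed_simps T.section_closed proj_simps proj_section T.proj_section G.M.diff_self)
  have "(\<lambda>x\<in>carrier g. \<gamma> [x]) \<in> linear_maps K g n"
    by (rule linear_mapsI)
       (auto intro!: incl_eqI simp: 1 incl_simps section_simps T.section_simps section_closed T.section_closed
          L.smult_diff L.M.diff_simps L.M.a_ac)
  moreover have "continuous_map (topo g) (topo (total E)) (\<lambda>x. \<tau> x \<ominus>\<^bsub>total E\<^esub> \<sigma> x)"
    by (intro L.continuous_map_vector_diff section_continuous T.section_continuous)
  then have "continuous_map (topo g) (topo n) (\<lambda>x. retract (\<tau> x \<ominus>\<^bsub>total E\<^esub> \<sigma> x))"
    by (rule continuous_map_retract)
       (simp add: G.topspace_vector closed_simps T.section_closed proj_simps proj_section T.proj_section G.M.diff_self)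
  then have "continuous_map (topo g) (topo n) (\<lambda>x. \<gamma> [x])"
    by (rule continuous_map_eq) (simp add: \<gamma>_def G.topspace_vector)
  ultimately show "\<gamma> \<in> cochains K (Suc 0) g n"
    by (simp add: cochains_1_iff \<gamma>_def)
  show "\<tau> = shift \<gamma>"
    unfolding shift_def
    by (rule extensionalityI[OF linear_mapsD(2)[OF T.section_linear] restrict_extensional])
       (simp add: 1 section_closed T.section_closed L.M.diff_simps L.M.a_ac)
qed

text \<open>Expanding [\<sigma> x + \<gamma> x, \<sigma> y + \<gamma> y] explains the formula of the
  action: the mixed brackets and the correction -\<gamma>([x, y]) make up the differential of
  \<gamma>, and the quadratic term is the bracket of the two corrections.\<close>

lemma factor_system_shift:
  assumes \<gamma>: "\<gamma> \<in> cochains K (Suc 0) g n"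
  shows "(section_action g n E (shift \<gamma>), section_cocycle g n E (shift \<gamma>)) = C1_action K g n \<gamma> (act, coc)"
proof -
  interpret T: split_extension K g n E "shift \<gamma>"
    by (rule split_extension_shift[OF \<gamma>])
  note \<gamma>_simps = cochains_1_closed[OF \<gamma>]
  have shift: "shift \<gamma> x = \<sigma> x \<oplus>\<^bsub>total E\<^esub> incl E (\<gamma> [x])" if "x \<in> carrier g" for x
    using that by (simp add: shift_def)
  have "T.act = (\<lambda>x\<in>carrier g. \<lambda>v\<in>carrier n. act x v \<oplus>\<^bsub>n\<^esub> lie n (\<gamma> [x]) v)"
  proof (rule extensionalityI[OF C1c_extensional[OF T.act_C1c] restrict_extensional])
    fix x assume x: "x \<in> carrier g"
    show "T.act x = (\<lambda>x\<in>carrier g. \<lambda>v\<in>carrier n. act x v \<oplus>\<^bsub>n\<^esub> lie n (\<gamma> [x]) v) x"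
      using x
      by (auto intro!: extensionalityI[OF C1c_value_extensional[OF T.act_C1c] restrict_extensional] incl_eqI
          simp: closed_simps T.closed_simps transfer_simps T.transfer_simps \<gamma>_simps shift L.lie_add_left)
  qed
  moreover have "T.coc = (\<lambda>xs\<in>tuples g 2. coc [xs ! 0, xs ! 1]
      \<oplus>\<^bsub>n\<^esub> (act (xs ! 0) (\<gamma> [xs ! 1]) \<ominus>\<^bsub>n\<^esub> act (xs ! 1) (\<gamma> [xs ! 0]) \<ominus>\<^bsub>n\<^esub> \<gamma> [lie g (xs ! 0) (xs ! 1)])
      \<oplus>\<^bsub>n\<^esub> lie n (\<gamma> [xs ! 0]) (\<gamma> [xs ! 1]))"
  proof (rule restrict_tuples_2_eqI[OF cochain_extensional[OF T.coc_cochain]])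
    fix x y assume xy: "x \<in> carrier g" "y \<in> carrier g"
    \<comment> \<open>The action brackets with \<sigma> on the left; turning this mixed bracket
      around gives the minus sign of S(y)\<gamma>(x) in the differential.\<close>
    then have eq: "lie (total E) (incl E (\<gamma> [x])) (\<sigma> y) = \<ominus>\<^bsub>total E\<^esub> lie (total E) (\<sigma> y) (incl E (\<gamma> [x]))"
      by (intro L.lie_antisym) (simp_all add: closed_simps \<gamma>_simps)
    from xy show "T.coc [x, y] = coc [[x, y] ! 0, [x, y] ! 1]
      \<oplus>\<^bsub>n\<^esub> (act ([x, y] ! 0) (\<gamma> [[x, y] ! 1]) \<ominus>\<^bsub>n\<^esub> act ([x, y] ! 1) (\<gamma> [[x, y] ! 0])
        \<ominus>\<^bsub>n\<^esub> \<gamma> [lie g ([x, y] ! 0) ([x, y] ! 1)])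
      \<oplus>\<^bsub>n\<^esub> lie n (\<gamma> [[x, y] ! 0]) (\<gamma> [[x, y] ! 1])"
      by (intro incl_eqI)
         (simp_all add: closed_simps T.closed_simps transfer_simps T.incl_coc \<gamma>_simps shift eq
          L.lie_add_left L.lie_add_right L.M.diff_simps L.M.a_ac)
  qed
  ultimately show ?thesis
    by (simp add: C1_action_eq[OF section_factor_system \<gamma>])
qed

subsection \<open>The chart of an extension given by a section\<close>

text \<open>The coordinates of e relative to \<sigma>: its projection in \<open>g\<close>, and the
  remainder after subtracting the section value, which lies in the kernel and so comes from
  \<open>n\<close>.\<close>

lemma chart_inverse:
  assumes "e \<in> carrier (total E)"
  shows "retract (e \<ominus>\<^bsub>total E\<^esub> \<sigma> (proj E e)) \<in> carrier n"
    and "incl E (retract (e \<ominus>\<^bsub>total E\<^esub> \<sigma> (proj E e))) = e \<ominus>\<^bsub>total E\<^esub> \<sigma> (proj E e)"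
    and "incl E (retract (e \<ominus>\<^bsub>total E\<^esub> \<sigma> (proj E e))) \<oplus>\<^bsub>total E\<^esub> \<sigma> (proj E e) = e"
proof -
  have "proj E (e \<ominus>\<^bsub>total E\<^esub> \<sigma> (proj E e)) = \<zero>\<^bsub>g\<^esub>"
    using assms by (simp add: closed_simps proj_simps proj_section G.M.diff_self)
  then show 1: "retract (e \<ominus>\<^bsub>total E\<^esub> \<sigma> (proj E e)) \<in> carrier n"
    "incl E (retract (e \<ominus>\<^bsub>total E\<^esub> \<sigma> (proj E e))) = e \<ominus>\<^bsub>total E\<^esub> \<sigma> (proj E e)"
    using assms by (simp_all add: retract_closed incl_retract closed_simps)
  show "incl E (retract (e \<ominus>\<^bsub>total E\<^esub> \<sigma> (proj E e))) \<oplus>\<^bsub>total E\<^esub> \<sigma> (proj E e) = e"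
    unfolding 1(2) using assms by (simp add: closed_simps L.M.diff_simps)
qed

lemma continuous_map_chart_inverse:
  "continuous_map (topo (total E)) (topo n) (\<lambda>e. retract (e \<ominus>\<^bsub>total E\<^esub> \<sigma> (proj E e)))"
proof (rule continuous_map_retract)
  show "continuous_map (topo (total E)) (topo (total E)) (\<lambda>e. e \<ominus>\<^bsub>total E\<^esub> \<sigma> (proj E e))"
    using continuous_map_compose[OF proj_continuous section_continuous]
    by (intro L.continuous_map_vector_diff) (simp_all add: o_def)
qed (simp add: L.topspace_vector closed_simps proj_simps proj_section G.M.diff_self)

lemma crossed_extension_equiv: "ext_equiv K n (crossed_extension g n act coc) E"
proof -
  let ?C = "crossed_product g n act coc"
  define \<Phi> where "\<Phi> = (\<lambda>p\<in>carrier n \<times> carrier g. incl E (fst p) \<oplus>\<^bsub>total E\<^esub> \<sigma> (snd p))"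
  have "\<Phi> \<in> linear_maps K ?C (total E)"
    by (rule linear_mapsI)
       (auto simp: \<Phi>_def crossed_product_def closed_simps transfer_simps L.M.a_ac L.smult_r_distr)
  moreover have "\<Phi> (lie ?C p q) = lie (total E) (\<Phi> p) (\<Phi> q)" if p: "p \<in> carrier ?C" and q: "q \<in> carrier ?C" for p q
  proof -
    obtain v x where [simp]: "p = (v, x)" "v \<in> carrier n" "x \<in> carrier g"
      using p by (auto simp: crossed_product_def)
    obtain w y where [simp]: "q = (w, y)" "w \<in> carrier n" "y \<in> carrier g"
      using q by (auto simp: crossed_product_def)
    \<comment> \<open>This flip is the origin of the term -S(y)v in the bracket of the crossed
      product.\<close>
    have eq: "lie (total E) (incl E v) (\<sigma> y) = \<ominus>\<^bsub>total E\<^esub> lie (total E) (\<sigma> y) (incl E v)"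
      by (intro L.lie_antisym) (simp_all add: closed_simps)
    show ?thesis
      by (simp add: \<Phi>_def crossed_product_def closed_simps transfer_simps eq L.lie_add_left L.lie_add_right
          L.M.diff_simps L.M.a_ac)
  qed
  moreover have "continuous_map (prod_topology (topo n) (topo g)) (topo (total E))
      (\<lambda>p. incl E (fst p) \<oplus>\<^bsub>total E\<^esub> \<sigma> (snd p))"
    using continuous_map_compose[OF continuous_map_fst incl_continuous]
      continuous_map_compose[OF continuous_map_snd section_continuous]
    by (intro L.continuous_map_vector_add) (simp_all add: o_def)
  then have "continuous_map (topo ?C) (topo (total E)) \<Phi>"
    unfolding crossed_product_def \<Phi>_def
    by (auto simp: N.topspace_vector G.topspace_vector elim!: continuous_map_eq)
  ultimately have "\<Phi> \<in> top_lie_hom K ?C (total E)"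
    by (simp add: top_lie_hom_def)
  then show ?thesis
    unfolding ext_equiv_def crossed_extension_def
    by (intro bexI[of _ \<Phi>])
       (auto simp: \<Phi>_def crossed_product_def closed_simps transfer_simps proj_simps proj_incl proj_section)
qed

end

subsection \<open>Equivalence of extensions\<close>

lemma split_extension_equiv:
  assumes "split_extension K g n E \<sigma>" "lie_sequence K g n F"
    and \<phi>: "\<phi> \<in> top_lie_hom K (total E) (total F)"
    and \<phi>_incl: "\<And>v. v \<in> carrier n \<Longrightarrow> \<phi> (incl E v) = incl F v"
    and \<phi>_proj: "\<And>e. e \<in> carrier (total E) \<Longrightarrow> proj F (\<phi> e) = proj E e"
  shows "split_extension K g n F (\<lambda>x\<in>carrier g. \<phi> (\<sigma> x))"
    and "section_action g n F (\<lambda>x\<in>carrier g. \<phi> (\<sigma> x)) = section_action g n E \<sigma>"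
    and "section_cocycle g n F (\<lambda>x\<in>carrier g. \<phi> (\<sigma> x)) = section_cocycle g n E \<sigma>"
proof -
  interpret E: split_extension K g n E \<sigma> by fact
  interpret F: lie_sequence K g n F by fact
  have lin: "\<phi> \<in> linear_maps K (total E) (total F)"
    using \<phi> by (simp add: top_lie_hom_def)
  note \<phi>_simps = linear_mapsD[OF lin] linear_maps_diff[OF lin E.L.M.abelian_group_axioms F.L.M.abelian_group_axioms]
  have "continuous_map (topo g) (topo (total F)) (\<phi> \<circ> \<sigma>)"
    using \<phi> E.section_continuous by (auto simp: top_lie_hom_def intro: continuous_map_compose)
  then have "continuous_map (topo g) (topo (total F)) (\<lambda>x\<in>carrier g. \<phi> (\<sigma> x))"
    by (rule continuous_map_eq) (simp add: E.G.topspace_vector)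
  moreover have "(\<lambda>x\<in>carrier g. \<phi> (\<sigma> x)) \<in> linear_maps K g (total F)"
    by (rule linear_mapsI) (auto simp: \<phi>_simps E.section_simps E.section_closed)
  ultimately have "(\<lambda>x\<in>carrier g. \<phi> (\<sigma> x)) \<in> sections K g F"
    by (simp add: sections_def \<phi>_proj E.section_closed E.proj_section)
  then show *: "split_extension K g n F (\<lambda>x\<in>carrier g. \<phi> (\<sigma> x))"
    by unfold_locales
  interpret F: split_extension K g n F "\<lambda>x\<in>carrier g. \<phi> (\<sigma> x)" by fact
  have lie: "\<phi> (lie (total E) e f) = lie (total F) (\<phi> e) (\<phi> f)"
    if "e \<in> carrier (total E)" "f \<in> carrier (total E)" for e f
    using \<phi> that by (simp add: top_lie_hom_def)
  have "F.act x v = E.act x v" if "x \<in> carrier g" "v \<in> carrier n" for x v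
  proof (rule F.incl_eqI)
    \<comment> \<open>\<open>incl F\<close> is \<phi> after \<open>incl E\<close>, so the defining
      bracket in E can be carried to F by \<phi> and compared there.\<close>
    have "incl F (E.act x v) = \<phi> (incl E (E.act x v))"
      using that by (simp add: \<phi>_incl E.act_closed)
    then show "incl F (F.act x v) = incl F (E.act x v)"
      using that by (simp add: F.incl_act E.incl_act lie \<phi>_incl E.closed_simps)
  qed (use that F.act_closed E.act_closed in auto)
  then show "F.act = E.act"
    unfolding section_action_def by (auto intro!: restrict_ext)
  have coc: "F.coc [x, y] = E.coc [x, y]" if "x \<in> carrier g" "y \<in> carrier g" for x y
  proof (rule F.incl_eqI)
    have "incl F (E.coc [x, y]) = \<phi> (incl E (E.coc [x, y]))"
      using that by (simp add: \<phi>_incl E.coc_closed)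
    then show "incl F (F.coc [x, y]) = incl F (E.coc [x, y])"
      using that by (simp add: F.incl_coc E.incl_coc lie \<phi>_simps E.closed_simps)
  qed (use that F.coc_closed E.coc_closed in auto)
  have "F.coc = (\<lambda>xs\<in>tuples g 2. E.coc xs)"
    using coc by (rule restrict_tuples_2_eqI[OF E.cochain_extensional[OF F.coc_cochain]])
  also have "\<dots> = E.coc"
    using E.cochain_extensional[OF E.coc_cochain] by (rule extensional_restrict)
  finally show "F.coc = E.coc" .
qed

lemma (in lie_sequence) ext_equiv_refl: "ext_equiv K n E E"
proof -
  have "(\<lambda>e\<in>carrier (total E). e) \<in> linear_maps K (total E) (total E)"
    by (rule linear_mapsI) auto
  moreover have "continuous_map (topo (total E)) (topo (total E)) (\<lambda>e\<in>carrier (total E). e)"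
    by (rule continuous_map_eq[OF continuous_map_id]) (simp add: L.topspace_vector)
  ultimately have "(\<lambda>e\<in>carrier (total E). e) \<in> top_lie_hom K (total E) (total E)"
    by (simp add: top_lie_hom_def L.lie_closed)
  then show ?thesis
    unfolding ext_equiv_def by (rule bexI[rotated]) (simp add: incl_closed)
qed

lemma (in lie_sequence) ext_equiv_trans:
  assumes "ext_equiv K n E F" "ext_equiv K n F H"
  shows "ext_equiv K n E H"
proof -
  obtain \<phi> where \<phi>: "\<phi> \<in> top_lie_hom K (total E) (total F)"
    and \<phi>_ext: "\<And>v. v \<in> carrier n \<Longrightarrow> \<phi> (incl E v) = incl F v"
      "\<And>e. e \<in> carrier (total E) \<Longrightarrow> proj F (\<phi> e) = proj E e"
    using assms(1) unfolding ext_equiv_def by blast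
  obtain \<psi> where \<psi>: "\<psi> \<in> top_lie_hom K (total F) (total H)"
    and \<psi>_ext: "\<And>v. v \<in> carrier n \<Longrightarrow> \<psi> (incl F v) = incl H v"
      "\<And>e. e \<in> carrier (total F) \<Longrightarrow> proj H (\<psi> e) = proj F e"
    using assms(2) unfolding ext_equiv_def by blast
  have lin: "\<phi> \<in> linear_maps K (total E) (total F)" "\<psi> \<in> linear_maps K (total F) (total H)"
    using \<phi> \<psi> by (simp_all add: top_lie_hom_def)
  note simps = linear_mapsD(1,3,4)[OF lin(1)] linear_mapsD(1,3,4)[OF lin(2)]
  let ?h = "\<lambda>e\<in>carrier (total E). \<psi> (\<phi> e)"
  have "continuous_map (topo (total E)) (topo (total H)) (\<psi> \<circ> \<phi>)"
    using \<phi> \<psi> by (auto simp: top_lie_hom_def intro: continuous_map_compose)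
  then have "continuous_map (topo (total E)) (topo (total H)) ?h"
    by (rule continuous_map_eq) (simp add: L.topspace_vector)
  moreover have "?h \<in> linear_maps K (total E) (total H)"
    by (rule linear_mapsI) (auto simp: simps)
  ultimately have "?h \<in> top_lie_hom K (total E) (total H)"
    using \<phi> \<psi> by (simp add: top_lie_hom_def L.lie_closed simps)
  then show ?thesis
    unfolding ext_equiv_def by (rule bexI[rotated]) (simp add: incl_closed \<phi>_ext \<psi>_ext simps)
qed

text \<open>Algebraically this is the five lemma; continuity of the inverse comes from the section.
  In the coordinates that \<sigma> gives on E and its image under \<phi> gives on F, the morphism
  \<phi> is the identity of \<open>n\<close> \<times> \<open>g\<close>.\<close>

lemma ext_equiv_sym:
  assumes "split_extension K g n E \<sigma>" "lie_sequence K g n F" "ext_equiv K n E F"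
  shows "ext_equiv K n F E"
proof -
  interpret E: split_extension K g n E \<sigma> by fact
  interpret F: lie_sequence K g n F by fact
  obtain \<phi> where \<phi>: "\<phi> \<in> top_lie_hom K (total E) (total F)"
    and \<phi>_incl: "\<And>v. v \<in> carrier n \<Longrightarrow> \<phi> (incl E v) = incl F v"
    and \<phi>_proj: "\<And>e. e \<in> carrier (total E) \<Longrightarrow> proj F (\<phi> e) = proj E e"
    using assms(3) unfolding ext_equiv_def by blast
  interpret F: split_extension K g n F "\<lambda>x\<in>carrier g. \<phi> (\<sigma> x)"
    using assms(1,2) \<phi> \<phi>_incl \<phi>_proj by (rule split_extension_equiv(1))
  have lin: "\<phi> \<in> linear_maps K (total E) (total F)"
    using \<phi> by (simp add: top_lie_hom_def)
  note \<phi>_simps = linear_mapsD[OF lin] linear_maps_diff[OF lin E.L.M.abelian_group_axioms F.L.M.abelian_group_axioms]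
  have \<phi>_lie: "\<phi> (lie (total E) e f) = lie (total F) (\<phi> e) (\<phi> f)"
    if "e \<in> carrier (total E)" "f \<in> carrier (total E)" for e f
    using \<phi> that by (simp add: top_lie_hom_def)
  \<comment> \<open>The inverse reads off the coordinates of f relative to the section \<phi>
    \<sigma> of F and reassembles them in E with \<sigma>.\<close>
  define \<psi> where "\<psi> = (\<lambda>f\<in>carrier (total F).
    incl E (F.retract (f \<ominus>\<^bsub>total F\<^esub> \<phi> (\<sigma> (proj F f)))) \<oplus>\<^bsub>total E\<^esub> \<sigma> (proj F f))"
  have inv: "F.retract (f \<ominus>\<^bsub>total F\<^esub> \<phi> (\<sigma> (proj F f))) \<in> carrier n"
    "incl F (F.retract (f \<ominus>\<^bsub>total F\<^esub> \<phi> (\<sigma> (proj F f)))) \<oplus>\<^bsub>total F\<^esub> \<phi> (\<sigma> (proj F f)) = f"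
    if "f \<in> carrier (total F)" for f
    using F.chart_inverse(1,3)[OF that] that by (simp_all add: F.proj_closed)
  have \<psi>_closed: "\<psi> f \<in> carrier (total E)" and \<phi>_\<psi>: "\<phi> (\<psi> f) = f" if "f \<in> carrier (total F)" for f
    using inv[OF that] that
    by (simp_all add: \<psi>_def \<phi>_simps \<phi>_incl E.closed_simps F.proj_closed)
  \<comment> \<open>Injectivity of \<phi> reduces linearity of \<psi>, its compatibility with
    brackets and its values on \<open>incl F\<close> to properties of \<phi>: apply \<phi> to both
    sides and use that \<phi> undoes \<psi>.\<close>
  have inj: "e = e'" if "\<phi> e = \<phi> e'" "e \<in> carrier (total E)" "e' \<in> carrier (total E)" for e e'
  proof -
    have p: "proj E e = proj E e'"
      using \<phi>_proj that by metis
    have "\<phi> (e \<ominus>\<^bsub>total E\<^esub> \<sigma> (proj E e)) = \<phi> (e' \<ominus>\<^bsub>total E\<^esub> \<sigma> (proj E e'))"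
      using that p by (simp add: \<phi>_simps E.closed_simps)
    then have "incl F (E.retract (e \<ominus>\<^bsub>total E\<^esub> \<sigma> (proj E e))) = incl F (E.retract (e' \<ominus>\<^bsub>total E\<^esub> \<sigma> (proj E e')))"
      using that by (simp flip: \<phi>_incl add: E.chart_inverse)
    then have eq: "E.retract (e \<ominus>\<^bsub>total E\<^esub> \<sigma> (proj E e)) = E.retract (e' \<ominus>\<^bsub>total E\<^esub> \<sigma> (proj E e'))"
      using that by (intro F.incl_eqI) (auto simp: E.chart_inverse)
    have "e = incl E (E.retract (e \<ominus>\<^bsub>total E\<^esub> \<sigma> (proj E e))) \<oplus>\<^bsub>total E\<^esub> \<sigma> (proj E e)"
      by (rule E.chart_inverse(3)[OF that(2), symmetric])
    also have "\<dots> = incl E (E.retract (e' \<ominus>\<^bsub>total E\<^esub> \<sigma> (proj E e'))) \<oplus>\<^bsub>total E\<^esub> \<sigma> (proj E e')"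
      by (subst eq) (simp only: p)
    also have "\<dots> = e'"
      by (rule E.chart_inverse(3)[OF that(3)])
    finally show ?thesis .
  qed
  have "continuous_map (topo (total F)) (topo n) (\<lambda>f. F.retract (f \<ominus>\<^bsub>total F\<^esub> \<phi> (\<sigma> (proj F f))))"
    by (rule continuous_map_eq[OF F.continuous_map_chart_inverse]) (simp add: F.L.topspace_vector F.proj_closed)
  from continuous_map_compose[OF this E.incl_continuous] continuous_map_compose[OF F.proj_continuous E.section_continuous]
  have "continuous_map (topo (total F)) (topo (total E))
      (\<lambda>f. incl E (F.retract (f \<ominus>\<^bsub>total F\<^esub> \<phi> (\<sigma> (proj F f)))) \<oplus>\<^bsub>total E\<^esub> \<sigma> (proj F f))"
    by (intro E.L.continuous_map_vector_add) (simp_all add: o_def)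
  then have "continuous_map (topo (total F)) (topo (total E)) \<psi>"
    by (rule continuous_map_eq) (simp add: \<psi>_def F.L.topspace_vector)
  moreover have "\<psi> \<in> linear_maps K (total F) (total E)"
  proof (rule linear_mapsI)
    show "\<psi> \<in> extensional (carrier (total F))"
      by (simp add: \<psi>_def)
  qed (auto intro!: inj simp: \<psi>_closed \<phi>_\<psi> \<phi>_simps)
  moreover have "\<psi> (lie (total F) e f) = lie (total E) (\<psi> e) (\<psi> f)"
    if "e \<in> carrier (total F)" "f \<in> carrier (total F)" for e f
    using that by (intro inj) (auto simp: \<psi>_closed \<phi>_\<psi> \<phi>_lie E.closed_simps F.closed_simps)
  ultimately have "\<psi> \<in> top_lie_hom K (total F) (total E)"
    by (simp add: top_lie_hom_def)
  moreover have "\<psi> (incl F v) = incl E v" if "v \<in> carrier n" for v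
    using that by (intro inj) (auto simp: \<psi>_closed \<phi>_\<psi> \<phi>_incl E.closed_simps F.closed_simps)
  moreover have "proj E (\<psi> f) = proj F f" if "f \<in> carrier (total F)" for f
    using that \<phi>_proj[of "\<psi> f"] by (simp add: \<psi>_closed \<phi>_\<psi>)
  ultimately show ?thesis
    unfolding ext_equiv_def by blast
qed

subsection \<open>Topologically split extensions are those with a continuous linear section\<close>

text \<open>The predicate given to \<open>topology\<close> satisfies the axioms because taking
  preimages under the coset map commutes with intersections and unions.\<close>

lemma openin_quotient_topology:
  "openin (quotient_topology V T W) U \<longleftrightarrow>
    U \<subseteq> a_rcosets\<^bsub>V\<^esub> W \<and> openin T {x \<in> carrier V. W +>\<^bsub>V\<^esub> x \<in> U}"
proof -
  have "openin T {x \<in> carrier V. W +>\<^bsub>V\<^esub> x \<in> U \<inter> U'}"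
    if "openin T {x \<in> carrier V. W +>\<^bsub>V\<^esub> x \<in> U}" "openin T {x \<in> carrier V. W +>\<^bsub>V\<^esub> x \<in> U'}" for U U'
  proof -
    have "{x \<in> carrier V. W +>\<^bsub>V\<^esub> x \<in> U \<inter> U'}
        = {x \<in> carrier V. W +>\<^bsub>V\<^esub> x \<in> U} \<inter> {x \<in> carrier V. W +>\<^bsub>V\<^esub> x \<in> U'}"
      by auto
    then show ?thesis
      using openin_Int[OF that] by (simp only:)
  qed
  moreover have "openin T {x \<in> carrier V. W +>\<^bsub>V\<^esub> x \<in> \<Union>\<U>}"
    if "\<forall>U\<in>\<U>. openin T {x \<in> carrier V. W +>\<^bsub>V\<^esub> x \<in> U}" for \<U>
  proof -
    have "{x \<in> carrier V. W +>\<^bsub>V\<^esub> x \<in> \<Union>\<U>} = (\<Union>U\<in>\<U>. {x \<in> carrier V. W +>\<^bsub>V\<^esub> x \<in> U})"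
      by auto
    then show ?thesis
      using that by auto
  qed
  ultimately have "istopology (\<lambda>U. U \<subseteq> a_rcosets\<^bsub>V\<^esub> W \<and> openin T {x \<in> carrier V. W +>\<^bsub>V\<^esub> x \<in> U})"
    unfolding istopology_def by (auto 4 3)
  then show ?thesis
    unfolding quotient_topology_def by (simp add: topology_inverse')
qed

lemma a_rcosets_eq: "a_rcosets\<^bsub>V\<^esub> W = (\<lambda>x. W +>\<^bsub>V\<^esub> x) ` carrier V"
  by (auto simp: A_RCOSETS_def')

lemma topspace_quotient_topology:
  assumes "topspace T = carrier V"
  shows "topspace (quotient_topology V T W) = a_rcosets\<^bsub>V\<^esub> W"
proof (rule antisym)
  show "topspace (quotient_topology V T W) \<subseteq> a_rcosets\<^bsub>V\<^esub> W"
    using openin_quotient_topology by (metis openin_topspace)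
  have "{x \<in> carrier V. W +>\<^bsub>V\<^esub> x \<in> a_rcosets\<^bsub>V\<^esub> W} = topspace T"
    using assms by (auto simp: a_rcosets_eq)
  then have "openin T {x \<in> carrier V. W +>\<^bsub>V\<^esub> x \<in> a_rcosets\<^bsub>V\<^esub> W}"
    by simp
  then have "openin (quotient_topology V T W) (a_rcosets\<^bsub>V\<^esub> W)"
    by (simp add: openin_quotient_topology)
  then show "a_rcosets\<^bsub>V\<^esub> W \<subseteq> topspace (quotient_topology V T W)"
    by (rule openin_subset)
qed

lemma quotient_map_quotient_topology:
  assumes "topspace T = carrier V"
  shows "quotient_map T (quotient_topology V T W) (\<lambda>x. W +>\<^bsub>V\<^esub> x)"
  unfolding quotient_map_def topspace_quotient_topology[OF assms] openin_quotient_topology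
  by (auto simp: assms a_rcosets_eq)

context lie_sequence
begin

abbreviation fibre :: "'g \<Rightarrow> 'e set" where "fibre x \<equiv> {e \<in> carrier (total E). proj E e = x}"

text \<open>This replaces cosets, on which the quotient space and its topology are built, by fibres
  of the projection, so that quotient operations are computed in \<open>g\<close>.\<close>

lemma coset_eq_fibre:
  assumes e: "e \<in> carrier (total E)"
  shows "incl E ` carrier n +>\<^bsub>total E\<^esub> e = fibre (proj E e)"
proof
  show "incl E ` carrier n +>\<^bsub>total E\<^esub> e \<subseteq> fibre (proj E e)"
    using e by (auto simp: a_r_coset_def' incl_closed proj_simps proj_incl proj_closed)
  show "fibre (proj E e) \<subseteq> incl E ` carrier n +>\<^bsub>total E\<^esub> e"
  proof
    fix f assume f: "f \<in> fibre (proj E e)"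
    then have "f \<ominus>\<^bsub>total E\<^esub> e \<in> fibre \<zero>\<^bsub>g\<^esub>"
      using e by (auto simp: proj_simps proj_closed G.M.diff_self)
    then have "f \<ominus>\<^bsub>total E\<^esub> e \<in> incl E ` carrier n"
      using kernel by blast
    moreover have "f = (f \<ominus>\<^bsub>total E\<^esub> e) \<oplus>\<^bsub>total E\<^esub> e"
      using e f by (simp add: L.M.diff_simps)
    ultimately show "f \<in> incl E ` carrier n +>\<^bsub>total E\<^esub> e"
      unfolding a_r_coset_def' by blast
  qed
qed

lemma coset_add:
  assumes ef: "e \<in> carrier (total E)" "f \<in> carrier (total E)"
  defines "W \<equiv> incl E ` carrier n"
  shows "(W +>\<^bsub>total E\<^esub> e) \<oplus>\<^bsub>quotient_space (total E) W\<^esub> (W +>\<^bsub>total E\<^esub> f) = W +>\<^bsub>total E\<^esub> (e \<oplus>\<^bsub>total E\<^esub> f)"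
proof -
  have "h \<in> fibre (proj E e) <+>\<^bsub>total E\<^esub> fibre (proj E f)" if h: "h \<in> fibre (proj E e \<oplus>\<^bsub>g\<^esub> proj E f)" for h
  proof -
    \<comment> \<open>Splitting off the representative e shows that the sum of two fibres exhausts
      the fibre over the sum.\<close>
    have "h \<ominus>\<^bsub>total E\<^esub> e \<in> fibre (proj E f)" "h = e \<oplus>\<^bsub>total E\<^esub> (h \<ominus>\<^bsub>total E\<^esub> e)"
      using h ef by (auto simp: proj_closed proj_simps G.M.diff_simps L.M.diff_simps G.M.a_ac L.M.a_ac)
    with ef show ?thesis
      unfolding set_add_def' by blast
  qed
  moreover have "fibre (proj E e) <+>\<^bsub>total E\<^esub> fibre (proj E f) \<subseteq> fibre (proj E e \<oplus>\<^bsub>g\<^esub> proj E f)"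
    by (auto simp: set_add_def' proj_simps)
  ultimately have "fibre (proj E e) <+>\<^bsub>total E\<^esub> fibre (proj E f) = fibre (proj E e \<oplus>\<^bsub>g\<^esub> proj E f)"
    by blast
  then show ?thesis
    using ef by (simp add: W_def quotient_space_def coset_eq_fibre proj_simps)
qed

lemma coset_smult:
  assumes "a \<in> carrier K" "e \<in> carrier (total E)"
  defines "W \<equiv> incl E ` carrier n"
  shows "a \<odot>\<^bsub>quotient_space (total E) W\<^esub> (W +>\<^bsub>total E\<^esub> e) = W +>\<^bsub>total E\<^esub> (a \<odot>\<^bsub>total E\<^esub> e)"
proof -
  \<comment> \<open>The scalar multiplication of the quotient is a union over all representatives.
    They all give the same coset, so the family is constant; its index set contains e and is
    nonempty.\<close>
  have "(\<Union>f\<in>fibre (proj E e). W +>\<^bsub>total E\<^esub> (a \<odot>\<^bsub>total E\<^esub> f)) = (\<Union>f\<in>fibre (proj E e). fibre (a \<odot>\<^bsub>g\<^esub> proj E e))"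
    using assms by (intro SUP_cong refl) (auto simp: coset_eq_fibre proj_simps)
  also have "\<dots> = fibre (a \<odot>\<^bsub>g\<^esub> proj E e)"
    using assms by blast
  finally show ?thesis
    using assms by (simp add: quotient_space_def coset_eq_fibre proj_simps)
qed

lemma submodule_image_incl: "submodule (incl E ` carrier n) K (total E)"
  by (rule L.submoduleI)
     (auto simp: incl_closed simp flip: incl_simps intro: imageI image_eqI[of "\<zero>\<^bsub>total E\<^esub>" _ "\<zero>\<^bsub>n\<^esub>"])

lemma lie_ideal_image_incl: "lie_ideal K (total E) (incl E ` carrier n)"
proof -
  have "lie (total E) e (incl E v) \<in> fibre \<zero>\<^bsub>g\<^esub>" if "e \<in> carrier (total E)" "v \<in> carrier n" for e v
    using that by (simp add: L.lie_closed incl_closed proj_lie proj_incl proj_closed)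
  then show ?thesis
    unfolding lie_ideal_def using kernel submodule_image_incl by auto
qed

text \<open>The image is the kernel, that is, the preimage of the point 0, which is closed because
  \<open>g\<close> is Hausdorff.\<close>

lemma closedin_image_incl: "closedin (topo (total E)) (incl E ` carrier n)"
proof -
  have "closedin (topo g) {\<zero>\<^bsub>g\<^esub>}"
    using G.Hausdorff by (simp add: closedin_Hausdorff_singleton G.topspace_vector)
  from closedin_continuous_map_preimage[OF proj_continuous this] show ?thesis
    by (simp add: L.topspace_vector kernel)
qed

text \<open>The splitting provides a section of the map onto the quotient space by the ideal.
  Identifying a point of \<open>g\<close> with its fibre, which is a coset by surjectivity of the
  projection, makes it a section of the projection.\<close>

lemma sections_nonempty:
  assumes split: "topologically_split K (total E) (incl E ` carrier n)"
    and quot: "quotient_map (topo (total E)) (topo g) (proj E)"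
  obtains \<sigma> where "\<sigma> \<in> sections K g E"
proof -
  let ?W = "incl E ` carrier n"
  let ?Q = "quotient_space (total E) ?W"
  obtain s where s: "s \<in> linear_maps K ?Q (total E)"
    and s_cont: "continuous_map (quotient_topology (total E) (topo (total E)) ?W) (topo (total E)) s"
    and s_sec: "\<And>C. C \<in> a_rcosets\<^bsub>total E\<^esub> ?W \<Longrightarrow> ?W +>\<^bsub>total E\<^esub> s C = C"
    using split unfolding topologically_split_def by blast
  have surj: "\<exists>e\<in>carrier (total E). proj E e = x" if "x \<in> carrier g" for x
    using quotient_imp_surjective_map[OF quot] that unfolding L.topspace_vector G.topspace_vector by (metis imageE)
  have fibre_mem: "fibre x \<in> a_rcosets\<^bsub>total E\<^esub> ?W" if x: "x \<in> carrier g" for x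
    using surj[OF x] coset_eq_fibre by (auto simp: a_rcosets_eq)
  then have fibre_carrier: "fibre x \<in> carrier ?Q" if "x \<in> carrier g" for x
    using that by (simp add: quotient_space_def)
  have add: "fibre (x \<oplus>\<^bsub>g\<^esub> y) = fibre x \<oplus>\<^bsub>?Q\<^esub> fibre y" if "x \<in> carrier g" "y \<in> carrier g" for x y
  proof -
    obtain e f where "e \<in> carrier (total E)" "proj E e = x" "f \<in> carrier (total E)" "proj E f = y"
      using surj \<open>x \<in> carrier g\<close> \<open>y \<in> carrier g\<close> by blast
    then show ?thesis
      using coset_add[of e f] by (simp add: coset_eq_fibre proj_simps)
  qed
  have smult: "fibre (a \<odot>\<^bsub>g\<^esub> x) = a \<odot>\<^bsub>?Q\<^esub> fibre x" if "a \<in> carrier K" "x \<in> carrier g" for a x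
  proof -
    obtain e where "e \<in> carrier (total E)" "proj E e = x"
      using surj \<open>x \<in> carrier g\<close> by blast
    then show ?thesis
      using coset_smult[of a e] \<open>a \<in> carrier K\<close> by (simp add: coset_eq_fibre proj_simps)
  qed
  let ?\<sigma> = "\<lambda>x\<in>carrier g. s (fibre x)"
  have "?\<sigma> \<in> linear_maps K g (total E)"
    by (rule linear_mapsI)
       (simp_all add: linear_mapsD(1,3,4)[OF s] fibre_carrier add smult)
  \<comment> \<open>Since the projection is a quotient map, continuity on \<open>g\<close> may be
    tested on the total algebra, where the composite is s after the coset map.\<close>
  moreover have "continuous_map (topo (total E)) (topo (total E)) (?\<sigma> \<circ> proj E)"
  proof (rule continuous_map_eq)
    show "continuous_map (topo (total E)) (topo (total E)) (s \<circ> (\<lambda>e. ?W +>\<^bsub>total E\<^esub> e))"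
      using s_cont quotient_map_quotient_topology[OF L.topspace_vector]
      by (intro continuous_map_compose[OF _ s_cont] quotient_imp_continuous_map)
  qed (simp add: L.topspace_vector coset_eq_fibre proj_closed)
  then have "continuous_map (topo g) (topo (total E)) ?\<sigma>"
    by (rule continuous_compose_quotient_map[OF quot])
  moreover have "proj E (s (fibre x)) = x" if x: "x \<in> carrier g" for x
  proof -
    have "s (fibre x) \<in> carrier (total E)"
      using linear_mapsD(1)[OF s fibre_carrier[OF x]] .
    moreover from this have "fibre (proj E (s (fibre x))) = fibre x"
      using s_sec[OF fibre_mem[OF x]] by (simp add: coset_eq_fibre)
    ultimately show ?thesis
      by auto
  qed
  ultimately have "?\<sigma> \<in> sections K g E"
    by (simp add: sections_def)
  then show ?thesis
    by (rule that)
qed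

end

section \<open>From a continuous linear section back to a topological splitting\<close>

lemma (in split_extension) quotient_map_proj: "quotient_map (topo (total E)) (topo g) (proj E)"
  using proj_continuous section_continuous proj_section
  by (intro retraction_imp_quotient_map) (auto simp: retraction_map_def retraction_maps_def G.topspace_vector)

lemma (in split_extension) topologically_split_image_incl:
  "topologically_split K (total E) (incl E ` carrier n)"
proof -
  let ?W = "incl E ` carrier n"
  let ?Q = "quotient_space (total E) ?W"
  let ?T = "quotient_topology (total E) (topo (total E)) ?W"
  have topspace_T: "topspace ?T = a_rcosets\<^bsub>total E\<^esub> ?W"
    by (rule topspace_quotient_topology[OF L.topspace_vector])
  have quot: "quotient_map (topo (total E)) ?T (\<lambda>e. ?W +>\<^bsub>total E\<^esub> e)"
    by (rule quotient_map_quotient_topology[OF L.topspace_vector])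
  \<comment> \<open>All elements of a coset have the same projection, so the choice of
    representative does not affect the value.\<close>
  define s where "s = (\<lambda>C\<in>a_rcosets\<^bsub>total E\<^esub> ?W. \<sigma> (proj E (SOME e. e \<in> C)))"
  have s: "s (?W +>\<^bsub>total E\<^esub> e) = \<sigma> (proj E e)" if e: "e \<in> carrier (total E)" for e
  proof -
    let ?C = "?W +>\<^bsub>total E\<^esub> e"
    have "e \<in> ?C"
      using e by (simp add: coset_eq_fibre)
    then have "(SOME f. f \<in> ?C) \<in> ?C"
      unfolding some_in_eq by blast
    then have "proj E (SOME f. f \<in> ?C) = proj E e"
      unfolding coset_eq_fibre[OF e] by blast
    moreover have "?C \<in> a_rcosets\<^bsub>total E\<^esub> ?W"
      using e by (simp add: a_rcosets_eq)
    ultimately show ?thesis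
      by (simp add: s_def)
  qed
  have s_fibre: "s (fibre (proj E e)) = \<sigma> (proj E e)" if "e \<in> carrier (total E)" for e
    using s[OF that] by (simp add: coset_eq_fibre that)
  have carrier_Q: "carrier ?Q = (\<lambda>e. ?W +>\<^bsub>total E\<^esub> e) ` carrier (total E)"
    by (simp add: quotient_space_def a_rcosets_eq)
  have "s \<in> linear_maps K ?Q (total E)"
  proof (rule linear_mapsI)
    show "s \<in> extensional (carrier ?Q)"
      by (simp add: s_def quotient_space_def)
  qed (auto simp: carrier_Q coset_add coset_smult s closed_simps transfer_simps proj_simps)
  moreover have s_cont: "continuous_map ?T (topo (total E)) s"
  proof (rule continuous_compose_quotient_map[OF quot])
    show "continuous_map (topo (total E)) (topo (total E)) (s \<circ> (\<lambda>e. ?W +>\<^bsub>total E\<^esub> e))"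
      by (rule continuous_map_eq[OF continuous_map_compose[OF proj_continuous section_continuous]])
         (simp add: s L.topspace_vector)
  qed
  moreover have "?W +>\<^bsub>total E\<^esub> s C = C" if "C \<in> a_rcosets\<^bsub>total E\<^esub> ?W" for C
    using that by (auto simp: a_rcosets_eq s_fibre coset_eq_fibre closed_simps proj_section)
  moreover have "homeomorphic_map (prod_topology (subtopology (topo (total E)) ?W) ?T) (topo (total E))
      (\<lambda>(w, C). w \<oplus>\<^bsub>total E\<^esub> s C)"
  proof -
    let ?P = "prod_topology (subtopology (topo (total E)) ?W) ?T"
    \<comment> \<open>The inverse chart: e is split into its part in the ideal, relative to
      \<sigma>, and its coset.\<close>
    let ?r = "\<lambda>e. (e \<ominus>\<^bsub>total E\<^esub> \<sigma> (proj E e), ?W +>\<^bsub>total E\<^esub> e)"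
    have "continuous_map ?P (topo (total E)) fst"
      using continuous_map_fst[of "subtopology (topo (total E)) ?W" ?T]
      by (auto simp: continuous_map_in_subtopology)
    moreover have "continuous_map ?P (topo (total E)) (\<lambda>p. s (snd p))"
      using continuous_map_compose[OF continuous_map_snd s_cont] by (simp add: o_def)
    ultimately have 1: "continuous_map ?P (topo (total E)) (\<lambda>(w, C). w \<oplus>\<^bsub>total E\<^esub> s C)"
      using L.continuous_map_vector_add[of ?P fst "\<lambda>p. s (snd p)"] by (simp add: case_prod_beta')
    have mem: "e \<ominus>\<^bsub>total E\<^esub> \<sigma> (proj E e) \<in> ?W" if "e \<in> carrier (total E)" for e
      using chart_inverse(1,2)[OF that] by (metis imageI)
    have "continuous_map (topo (total E)) (topo (total E)) (\<lambda>e. e \<ominus>\<^bsub>total E\<^esub> \<sigma> (proj E e))"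
      using continuous_map_compose[OF proj_continuous section_continuous]
      by (intro L.continuous_map_vector_diff) (simp_all add: o_def)
    then have 2: "continuous_map (topo (total E)) ?P ?r"
      using mem quotient_imp_continuous_map[OF quot]
      by (auto simp: continuous_map_paired continuous_map_in_subtopology L.topspace_vector)
    have 3: "?r (w \<oplus>\<^bsub>total E\<^esub> s C) = (w, C)" if "w \<in> ?W" "C \<in> a_rcosets\<^bsub>total E\<^esub> ?W" for w C
      using that
      by (auto simp: a_rcosets_eq s_fibre coset_eq_fibre closed_simps proj_section proj_simps proj_incl L.M.diff_simps)
    have 4: "(\<lambda>(w, C). w \<oplus>\<^bsub>total E\<^esub> s C) (?r e) = e" if "e \<in> carrier (total E)" for e
      using that s by (simp add: closed_simps L.M.diff_simps)
    have "homeomorphic_maps ?P (topo (total E)) (\<lambda>(w, C). w \<oplus>\<^bsub>total E\<^esub> s C) ?r"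
      unfolding homeomorphic_maps_def using 1 2 3 4
      by (auto simp: topspace_T L.topspace_vector)
    then show ?thesis
      by (auto simp: homeomorphic_map_maps)
  qed
  ultimately show ?thesis
    unfolding topologically_split_def using submodule_image_incl closedin_image_incl by blast
qed

text \<open>Given a section, the ideal property and closedness follow from the kernel condition,
  while the quotient map and the splitting come from the section itself.\<close>

lemma (in lie_pair) extensions_iff: "E \<in> extensions K g n \<longleftrightarrow> (\<exists>\<sigma>. split_extension K g n E \<sigma>)"
proof
  assume E: "E \<in> extensions K g n"
  then interpret lie_sequence K g n E
    unfolding extensions_def by (intro lie_sequence.intro lie_sequence_axioms.intro lie_pair_axioms) auto
  obtain \<sigma> where "\<sigma> \<in> sections K g E"
    using E sections_nonempty unfolding extensions_def by blast
  then have "split_extension K g n E \<sigma>"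
    by unfold_locales
  then show "\<exists>\<sigma>. split_extension K g n E \<sigma>"
    by blast
next
  assume "\<exists>\<sigma>. split_extension K g n E \<sigma>"
  then obtain \<sigma> where "split_extension K g n E \<sigma>" ..
  then interpret split_extension K g n E \<sigma> .
  show "E \<in> extensions K g n"
    unfolding extensions_def
    using L.topological_lie_algebra_axioms incl_hom incl_embedding lie_ideal_image_incl
      topologically_split_image_incl proj_hom quotient_map_proj kernel by simp
qed

section \<open>Crossed products\<close>

text \<open>The Jacobi expression is additive in each argument and invariant under rotation, so it
  may be tested on generators. Of the eight patterns of arguments from U and W, four remain up to
  rotation, and these are the hypotheses \<open>J\<close>.\<close>

lemma jacobi_generated:
  fixes b :: "'a \<Rightarrow> 'a \<Rightarrow> 'a" and L :: "('a, 'm) ring_scheme"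
  defines "J \<equiv> \<lambda>p q r. b p (b q r) \<oplus>\<^bsub>L\<^esub> b q (b r p) \<oplus>\<^bsub>L\<^esub> b r (b p q)"
  assumes L: "abelian_group L"
    and closed: "\<And>p q. \<lbrakk>p \<in> carrier L; q \<in> carrier L\<rbrakk> \<Longrightarrow> b p q \<in> carrier L"
    and add_left: "\<And>p q r. \<lbrakk>p \<in> carrier L; q \<in> carrier L; r \<in> carrier L\<rbrakk>
      \<Longrightarrow> b (p \<oplus>\<^bsub>L\<^esub> q) r = b p r \<oplus>\<^bsub>L\<^esub> b q r"
    and add_right: "\<And>p q r. \<lbrakk>p \<in> carrier L; q \<in> carrier L; r \<in> carrier L\<rbrakk>
      \<Longrightarrow> b p (q \<oplus>\<^bsub>L\<^esub> r) = b p q \<oplus>\<^bsub>L\<^esub> b p r"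
    and sub: "U \<subseteq> carrier L" "W \<subseteq> carrier L"
    and gen: "\<And>p. p \<in> carrier L \<Longrightarrow> \<exists>u\<in>U. \<exists>w\<in>W. p = u \<oplus>\<^bsub>L\<^esub> w"
    and J: "\<And>u u' u''. \<lbrakk>u \<in> U; u' \<in> U; u'' \<in> U\<rbrakk> \<Longrightarrow> J u u' u'' = \<zero>\<^bsub>L\<^esub>"
      "\<And>u u' w. \<lbrakk>u \<in> U; u' \<in> U; w \<in> W\<rbrakk> \<Longrightarrow> J u u' w = \<zero>\<^bsub>L\<^esub>"
      "\<And>u w w'. \<lbrakk>u \<in> U; w \<in> W; w' \<in> W\<rbrakk> \<Longrightarrow> J u w w' = \<zero>\<^bsub>L\<^esub>"
      "\<And>w w' w''. \<lbrakk>w \<in> W; w' \<in> W; w'' \<in> W\<rbrakk> \<Longrightarrow> J w w' w'' = \<zero>\<^bsub>L\<^esub>"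
    and pqr: "p \<in> carrier L" "q \<in> carrier L" "r \<in> carrier L"
  shows "b p (b q r) \<oplus>\<^bsub>L\<^esub> b q (b r p) \<oplus>\<^bsub>L\<^esub> b r (b p q) = \<zero>\<^bsub>L\<^esub>"
proof -
  interpret abelian_group L by fact
  have add1: "J (p \<oplus>\<^bsub>L\<^esub> p') q r = J p q r \<oplus>\<^bsub>L\<^esub> J p' q r"
    if "p \<in> carrier L" "p' \<in> carrier L" "q \<in> carrier L" "r \<in> carrier L" for p p' q r
    using that by (simp add: J_def closed add_left add_right a_ac)
  have cyc: "J p q r = J q r p"
    if "p \<in> carrier L" "q \<in> carrier L" "r \<in> carrier L" for p q r
    using that by (simp add: J_def closed a_ac)
  have split: "J p q r = \<zero>\<^bsub>L\<^esub>"
    if "\<And>u. u \<in> U \<Longrightarrow> J u q r = \<zero>\<^bsub>L\<^esub>" "\<And>w. w \<in> W \<Longrightarrow> J w q r = \<zero>\<^bsub>L\<^esub>"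
      "p \<in> carrier L" "q \<in> carrier L" "r \<in> carrier L" for p q r
  proof -
    obtain u w where "u \<in> U" "w \<in> W" "p = u \<oplus>\<^bsub>L\<^esub> w"
      using gen \<open>p \<in> carrier L\<close> by blast
    then show ?thesis
      using that add1[of u w q r] sub by auto
  qed
  \<comment> \<open>The arguments are freed from the generators one at a time: \<open>split\<close>
    treats the first position, and rotation brings the next argument there.\<close>
  have 1: "J p y z = \<zero>\<^bsub>L\<^esub>" if "p \<in> carrier L" "y \<in> U \<union> W" "z \<in> U \<union> W" for p y z
  proof (rule split)
    have yz: "y \<in> carrier L" "z \<in> carrier L"
      using that sub by auto
    show "J u y z = \<zero>\<^bsub>L\<^esub>" if u: "u \<in> U" for u
      using \<open>y \<in> U \<union> W\<close> \<open>z \<in> U \<union> W\<close> u sub J cyc[of u y z] cyc[of y z u] yz by auto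
    show "J w y z = \<zero>\<^bsub>L\<^esub>" if w: "w \<in> W" for w
      using \<open>y \<in> U \<union> W\<close> \<open>z \<in> U \<union> W\<close> w sub J cyc[of w y z] cyc[of y z w] yz by auto
  qed (use that sub in auto)
  have 2: "J p q z = \<zero>\<^bsub>L\<^esub>" if "p \<in> carrier L" "q \<in> carrier L" "z \<in> U \<union> W" for p q z
  proof -
    have z: "z \<in> carrier L"
      using that sub by auto
    have "J y z p = \<zero>\<^bsub>L\<^esub>" if y: "y \<in> U \<union> W" for y
    proof -
      have "y \<in> carrier L"
        using y sub by auto
      with y show ?thesis
        using 1[of p y z] cyc[of p y z] \<open>p \<in> carrier L\<close> \<open>z \<in> U \<union> W\<close> z by simp
    qed
    then have "J q z p = \<zero>\<^bsub>L\<^esub>"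
      using that z by - (rule split, simp_all)
    then show ?thesis
      using cyc[of p q z] that z by simp
  qed
  have "J z p q = \<zero>\<^bsub>L\<^esub>" if z: "z \<in> U \<union> W" for z
  proof -
    have "z \<in> carrier L"
      using z sub by auto
    with z show ?thesis
      using 2[of p q z] cyc[of z p q] pqr by simp
  qed
  then have "J r p q = \<zero>\<^bsub>L\<^esub>"
    using pqr by - (rule split, simp_all)
  then show ?thesis
    using cyc[OF pqr(3,1,2)] by (simp add: J_def)
qed

lemma crossed_product_simps:
  "carrier (crossed_product g n S \<omega>) = carrier n \<times> carrier g"
  "\<zero>\<^bsub>crossed_product g n S \<omega>\<^esub> = (\<zero>\<^bsub>n\<^esub>, \<zero>\<^bsub>g\<^esub>)"
  "(v, x) \<oplus>\<^bsub>crossed_product g n S \<omega>\<^esub> (w, y) = (v \<oplus>\<^bsub>n\<^esub> w, x \<oplus>\<^bsub>g\<^esub> y)"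
  "a \<odot>\<^bsub>crossed_product g n S \<omega>\<^esub> (v, x) = (a \<odot>\<^bsub>n\<^esub> v, a \<odot>\<^bsub>g\<^esub> x)"
  "lie (crossed_product g n S \<omega>) (v, x) (w, y) =
    (((lie n v w \<oplus>\<^bsub>n\<^esub> S x w) \<ominus>\<^bsub>n\<^esub> S y v) \<oplus>\<^bsub>n\<^esub> \<omega> [x, y], lie g x y)"
  "topo (crossed_product g n S \<omega>) = prod_topology (topo n) (topo g)"
  by (simp_all add: crossed_product_def)

section \<open>The crossed product of a factor system is a topological Lie algebra and a split
  extension\<close>

context lie_pair
begin

lemma abelian_group_crossed_product: "abelian_group (crossed_product g n S \<omega>)"
proof (rule abelian_groupI)
  fix p assume "p \<in> carrier (crossed_product g n S \<omega>)"
  then show "\<exists>q\<in>carrier (crossed_product g n S \<omega>). q \<oplus>\<^bsub>crossed_product g n S \<omega>\<^esub> p = \<zero>\<^bsub>crossed_product g n S \<omega>\<^esub>"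
    by (intro bexI[of _ "(\<ominus>\<^bsub>n\<^esub> fst p, \<ominus>\<^bsub>g\<^esub> snd p)"])
       (auto simp: crossed_product_simps N.M.l_neg G.M.l_neg)
qed (auto simp: crossed_product_simps N.M.a_ac G.M.a_ac)

lemma topological_vector_space_crossed_product:
  "topological_vector_space K (crossed_product g n S \<omega>) (topo (crossed_product g n S \<omega>))"
proof -
  let ?C = "crossed_product g n S \<omega>" and ?P = "prod_topology (topo n) (topo g)"
  have "module K ?C"
    by (rule moduleI[OF G.is_cring abelian_group_crossed_product])
       (auto simp: crossed_product_simps N.smult_l_distr G.smult_l_distr N.smult_r_distr G.smult_r_distr
         N.smult_assoc1 G.smult_assoc1)
  moreover have "continuous_map (prod_topology ?P ?P) ?P (\<lambda>(p, q). p \<oplus>\<^bsub>?C\<^esub> q)"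
  proof -
    have "continuous_map (prod_topology ?P ?P) ?P
        (\<lambda>r. (fst (fst r) \<oplus>\<^bsub>n\<^esub> fst (snd r), snd (fst r) \<oplus>\<^bsub>g\<^esub> snd (snd r)))"
      unfolding continuous_map_paired
      by (intro conjI N.continuous_map_vector_add G.continuous_map_vector_add)
         (auto intro!: continuous_map_fst_of continuous_map_snd_of continuous_map_fst continuous_map_snd
           simp: continuous_map_compose[OF continuous_map_fst continuous_map_fst, unfolded o_def]
             continuous_map_compose[OF continuous_map_fst continuous_map_snd, unfolded o_def]
             continuous_map_compose[OF continuous_map_snd continuous_map_fst, unfolded o_def]
             continuous_map_compose[OF continuous_map_snd continuous_map_snd, unfolded o_def])
    then show ?thesis
      by (simp add: crossed_product_def case_prod_beta')
  qed
  moreover have "continuous_map (prod_topology (ftopo K) ?P) ?P (\<lambda>(a, p). a \<odot>\<^bsub>?C\<^esub> p)"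
  proof -
    have "continuous_map (prod_topology (ftopo K) ?P) ?P
        (\<lambda>r. (fst r \<odot>\<^bsub>n\<^esub> fst (snd r), fst r \<odot>\<^bsub>g\<^esub> snd (snd r)))"
      unfolding continuous_map_paired
      by (intro conjI N.continuous_map_vector_smult G.continuous_map_vector_smult continuous_map_fst
          continuous_map_compose[OF continuous_map_snd continuous_map_fst, unfolded o_def]
          continuous_map_compose[OF continuous_map_snd continuous_map_snd, unfolded o_def])
    then show ?thesis
      by (simp add: crossed_product_def case_prod_beta')
  qed
  ultimately show ?thesis
    unfolding topological_vector_space_def topological_vector_space_axioms_def crossed_product_simps
    by (simp add: G.topological_field_char_0_axioms N.topspace_vector G.topspace_vector
        Hausdorff_space_prod_topology N.Hausdorff G.Hausdorff)
qed

context
  fixes S \<omega> assumes fs: "(S, \<omega>) \<in> factor_systems K g n"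
begin

lemma topological_lie_algebra_crossed_product: "topological_lie_algebra K (crossed_product g n S \<omega>)"
proof -
  let ?C = "crossed_product g n S \<omega>" and ?P = "prod_topology (topo n) (topo g)"
  interpret C: topological_vector_space K ?C "topo ?C"
    by (rule topological_vector_space_crossed_product)
  have S: "S \<in> C1c K g n" and \<omega>: "\<omega> \<in> cochains K 2 g n"
    and curv: "\<And>x y v. \<lbrakk>x \<in> carrier g; y \<in> carrier g; v \<in> carrier n\<rbrakk> \<Longrightarrow>
      S x (S y v) \<ominus>\<^bsub>n\<^esub> S y (S x v) \<ominus>\<^bsub>n\<^esub> S (lie g x y) v = lie n (\<omega> [x, y]) v"
    and cocycle: "\<And>x y z. \<lbrakk>x \<in> carrier g; y \<in> carrier g; z \<in> carrier g\<rbrakk> \<Longrightarrow>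
      d2 S \<omega> x y z = \<zero>\<^bsub>n\<^esub>"
    using fs by (auto simp: factor_systems_iff factor_cocycles_iff)
  note closed = C1c_closed[OF S] cochains_2_closed[OF \<omega>] N.lie_closed G.lie_closed
  note S_simps = C1c_add_left[OF S] C1c_add_right[OF S] C1c_smult_left[OF S] C1c_smult_right[OF S]
  note \<omega>_simps = cochains_2_add_left[OF \<omega>] cochains_2_add_right[OF \<omega>] cochains_2_smult_left[OF \<omega>]
    cochains_2_smult_right[OF \<omega>] cochains_2_self[OF \<omega>]
  note zero_simps = C1c_zero_left[OF S] C1c_zero_right[OF S] cochains_2_zero[OF \<omega>] N.M.diff_zero
  have C_closed: "lie ?C p q \<in> carrier ?C" if "p \<in> carrier ?C" "q \<in> carrier ?C" for p q
    using that by (auto simp: crossed_product_simps closed)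
  have C_add_left: "lie ?C (p \<oplus>\<^bsub>?C\<^esub> q) r = lie ?C p r \<oplus>\<^bsub>?C\<^esub> lie ?C q r"
    if "p \<in> carrier ?C" "q \<in> carrier ?C" "r \<in> carrier ?C" for p q r
    using that by (auto simp: crossed_product_simps closed S_simps \<omega>_simps N.lie_add_left G.lie_add_left
        N.M.diff_simps N.M.a_ac)
  have C_add_right: "lie ?C p (q \<oplus>\<^bsub>?C\<^esub> r) = lie ?C p q \<oplus>\<^bsub>?C\<^esub> lie ?C p r"
    if "p \<in> carrier ?C" "q \<in> carrier ?C" "r \<in> carrier ?C" for p q r
    using that by (auto simp: crossed_product_simps closed S_simps \<omega>_simps N.lie_add_right G.lie_add_right
        N.M.diff_simps N.M.a_ac)
  have jacobi: "lie ?C p (lie ?C q r) \<oplus>\<^bsub>?C\<^esub> lie ?C q (lie ?C r p) \<oplus>\<^bsub>?C\<^esub> lie ?C r (lie ?C p q) = \<zero>\<^bsub>?C\<^esub>"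
    if "p \<in> carrier ?C" "q \<in> carrier ?C" "r \<in> carrier ?C" for p q r
  \<comment> \<open>Each case uses one axiom: three arguments from \<open>n\<close>, its Jacobi
    identity; two, the derivation property of S; one, the curvature equation; none, the cocycle
    identity of \<omega> together with the Jacobi identity of \<open>g\<close>.\<close>
  proof (rule jacobi_generated[where b = "lie ?C" and L = ?C and U = "carrier n \<times> {\<zero>\<^bsub>g\<^esub>}" and W = "{\<zero>\<^bsub>n\<^esub>} \<times> carrier g"])
    show "\<exists>u\<in>carrier n \<times> {\<zero>\<^bsub>g\<^esub>}. \<exists>w\<in>{\<zero>\<^bsub>n\<^esub>} \<times> carrier g. p = u \<oplus>\<^bsub>?C\<^esub> w" if "p \<in> carrier ?C" for p
      using that by (intro bexI[of _ "(fst p, \<zero>\<^bsub>g\<^esub>)"] bexI[of _ "(\<zero>\<^bsub>n\<^esub>, snd p)"]) (auto simp: crossed_product_simps)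
  next
    fix u u' u'' assume "u \<in> carrier n \<times> {\<zero>\<^bsub>g\<^esub>}" "u' \<in> carrier n \<times> {\<zero>\<^bsub>g\<^esub>}" "u'' \<in> carrier n \<times> {\<zero>\<^bsub>g\<^esub>}"
    then show "lie ?C u (lie ?C u' u'') \<oplus>\<^bsub>?C\<^esub> lie ?C u' (lie ?C u'' u) \<oplus>\<^bsub>?C\<^esub> lie ?C u'' (lie ?C u u') = \<zero>\<^bsub>?C\<^esub>"
      by (auto simp: crossed_product_simps closed zero_simps N.jacobi)
  next
    fix u u' w assume "u \<in> carrier n \<times> {\<zero>\<^bsub>g\<^esub>}" "u' \<in> carrier n \<times> {\<zero>\<^bsub>g\<^esub>}" "w \<in> {\<zero>\<^bsub>n\<^esub>} \<times> carrier g"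
    then obtain a b z where [simp]: "u = (a, \<zero>\<^bsub>g\<^esub>)" "u' = (b, \<zero>\<^bsub>g\<^esub>)" "w = (\<zero>\<^bsub>n\<^esub>, z)"
      and abz: "a \<in> carrier n" "b \<in> carrier n" "z \<in> carrier g"
      by auto
    have "lie n b (S z a) = \<ominus>\<^bsub>n\<^esub> lie n (S z a) b"
      using abz by (intro N.lie_antisym closed)
    then show "lie ?C u (lie ?C u' w) \<oplus>\<^bsub>?C\<^esub> lie ?C u' (lie ?C w u) \<oplus>\<^bsub>?C\<^esub> lie ?C w (lie ?C u u') = \<zero>\<^bsub>?C\<^esub>"
      using abz by (simp add: crossed_product_simps closed zero_simps C1c_derivation[OF S] N.lie_diff_right
          N.M.diff_simps N.M.a_ac)
  next
    fix u w w' assume "u \<in> carrier n \<times> {\<zero>\<^bsub>g\<^esub>}" "w \<in> {\<zero>\<^bsub>n\<^esub>} \<times> carrier g" "w' \<in> {\<zero>\<^bsub>n\<^esub>} \<times> carrier g"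
    then obtain a y z where [simp]: "u = (a, \<zero>\<^bsub>g\<^esub>)" "w = (\<zero>\<^bsub>n\<^esub>, y)" "w' = (\<zero>\<^bsub>n\<^esub>, z)"
      and ayz: "a \<in> carrier n" "y \<in> carrier g" "z \<in> carrier g"
      by auto
    have "lie n a (\<omega> [y, z]) = \<ominus>\<^bsub>n\<^esub> lie n (\<omega> [y, z]) a"
      using ayz by (intro N.lie_antisym closed)
    then have eq: "lie n a (\<omega> [y, z]) = \<ominus>\<^bsub>n\<^esub> (S y (S z a) \<ominus>\<^bsub>n\<^esub> S z (S y a) \<ominus>\<^bsub>n\<^esub> S (lie g y z) a)"
      using ayz by (simp add: curv)
    have neg: "S z (\<zero>\<^bsub>n\<^esub> \<ominus>\<^bsub>n\<^esub> S y a) = \<zero>\<^bsub>n\<^esub> \<ominus>\<^bsub>n\<^esub> S z (S y a)"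
      using ayz by (simp add: N.M.minus_eq C1c_neg_right[OF S] closed)
    show "lie ?C u (lie ?C w w') \<oplus>\<^bsub>?C\<^esub> lie ?C w (lie ?C w' u) \<oplus>\<^bsub>?C\<^esub> lie ?C w' (lie ?C u w) = \<zero>\<^bsub>?C\<^esub>"
      using ayz by (simp add: crossed_product_simps closed zero_simps eq neg N.M.diff_simps N.M.a_ac)
  next
    fix w w' w'' assume "w \<in> {\<zero>\<^bsub>n\<^esub>} \<times> carrier g" "w' \<in> {\<zero>\<^bsub>n\<^esub>} \<times> carrier g" "w'' \<in> {\<zero>\<^bsub>n\<^esub>} \<times> carrier g"
    then obtain x y z where [simp]: "w = (\<zero>\<^bsub>n\<^esub>, x)" "w' = (\<zero>\<^bsub>n\<^esub>, y)" "w'' = (\<zero>\<^bsub>n\<^esub>, z)"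
      and xyz: "x \<in> carrier g" "y \<in> carrier g" "z \<in> carrier g"
      by auto
    \<comment> \<open>Antisymmetry brings the cyclic terms to the order of arguments that occurs in
      \<open>d2\<close>.\<close>
    have "\<omega> [x, lie g y z] = \<ominus>\<^bsub>n\<^esub> \<omega> [lie g y z, x]" "\<omega> [z, lie g x y] = \<ominus>\<^bsub>n\<^esub> \<omega> [lie g x y, z]"
      using xyz by (auto intro!: cochains_2_antisym[OF \<omega>] closed)
    moreover have "\<omega> [z, x] = \<ominus>\<^bsub>n\<^esub> \<omega> [x, z]" "S y (\<ominus>\<^bsub>n\<^esub> \<omega> [x, z]) = \<ominus>\<^bsub>n\<^esub> S y (\<omega> [x, z])"
      using xyz by (auto intro!: cochains_2_antisym[OF \<omega>] C1c_neg_right[OF S] closed)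
    moreover have "\<omega> [y, lie g z x] = \<omega> [lie g x z, y]"
      using xyz by (simp add: G.lie_antisym[of x z] cochains_2_antisym[OF \<omega>, of "lie g x z" y]
          cochains_2_neg_right[OF \<omega>] closed)
    ultimately have eqs: "\<omega> [x, lie g y z] = \<ominus>\<^bsub>n\<^esub> \<omega> [lie g y z, x]" "\<omega> [z, lie g x y] = \<ominus>\<^bsub>n\<^esub> \<omega> [lie g x y, z]"
      "S y (\<omega> [z, x]) = \<ominus>\<^bsub>n\<^esub> S y (\<omega> [x, z])" "\<omega> [y, lie g z x] = \<omega> [lie g x z, y]"
      by simp_all
    show "lie ?C w (lie ?C w' w'') \<oplus>\<^bsub>?C\<^esub> lie ?C w' (lie ?C w'' w) \<oplus>\<^bsub>?C\<^esub> lie ?C w'' (lie ?C w w') = \<zero>\<^bsub>?C\<^esub>"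
      using xyz cocycle[OF xyz]
      by (simp add: crossed_product_simps closed zero_simps eqs G.jacobi N.M.diff_simps N.M.a_ac)
  qed (use that C.M.abelian_group_axioms C_closed C_add_left C_add_right in \<open>auto simp: crossed_product_simps(1)\<close>)
  have "continuous_map (prod_topology ?P ?P) ?P (\<lambda>(p, q). lie ?C p q)"
  proof -
    note c = continuous_map_compose[OF continuous_map_fst continuous_map_fst, unfolded o_def]
      continuous_map_compose[OF continuous_map_fst continuous_map_snd, unfolded o_def]
      continuous_map_compose[OF continuous_map_snd continuous_map_fst, unfolded o_def]
      continuous_map_compose[OF continuous_map_snd continuous_map_snd, unfolded o_def]
    have "continuous_map (prod_topology ?P ?P) ?P
        (\<lambda>r. (lie n (fst (fst r)) (fst (snd r)) \<oplus>\<^bsub>n\<^esub> S (snd (fst r)) (fst (snd r))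
            \<ominus>\<^bsub>n\<^esub> S (snd (snd r)) (fst (fst r)) \<oplus>\<^bsub>n\<^esub> \<omega> [snd (fst r), snd (snd r)],
          lie g (snd (fst r)) (snd (snd r))))"
      unfolding continuous_map_paired
      by (intro conjI N.continuous_map_vector_add N.continuous_map_vector_diff N.continuous_map_lie
          G.continuous_map_lie C1c_continuous[OF S] cochains_2_continuous[OF \<omega>] c)
    then show ?thesis
      by (simp add: crossed_product_def case_prod_beta')
  qed
  moreover have "lie ?C p p = \<zero>\<^bsub>?C\<^esub>" if "p \<in> carrier ?C" for p
    using that
    by (auto simp: crossed_product_simps closed \<omega>_simps N.lie_self G.lie_self N.M.diff_simps N.M.diff_self)
  moreover have "lie ?C (a \<odot>\<^bsub>?C\<^esub> p) q = a \<odot>\<^bsub>?C\<^esub> lie ?C p q" "lie ?C p (a \<odot>\<^bsub>?C\<^esub> q) = a \<odot>\<^bsub>?C\<^esub> lie ?C p q"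
    if "a \<in> carrier K" "p \<in> carrier ?C" "q \<in> carrier ?C" for a p q
    using that
    by (auto simp: crossed_product_simps closed S_simps \<omega>_simps N.lie_smult_left G.lie_smult_left
        N.lie_smult_right G.lie_smult_right N.smult_r_distr N.smult_diff)
  ultimately show ?thesis
    using C_closed C_add_left C_add_right jacobi
    by (unfold_locales) (auto simp: crossed_product_simps(6))
qed

end

context
  fixes S \<omega> assumes fs: "(S, \<omega>) \<in> factor_systems K g n"
begin

lemma split_extension_crossed:
  defines "\<sigma> \<equiv> \<lambda>x\<in>carrier g. (\<zero>\<^bsub>n\<^esub>, x)"
  shows "split_extension K g n (crossed_extension g n S \<omega>) \<sigma>"
    and "section_action g n (crossed_extension g n S \<omega>) \<sigma> = S"
    and "section_cocycle g n (crossed_extension g n S \<omega>) \<sigma> = \<omega>"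
proof -
  let ?E = "crossed_extension g n S \<omega>" and ?C = "crossed_product g n S \<omega>"
  have S: "S \<in> C1c K g n" and \<omega>: "\<omega> \<in> cochains K 2 g n"
    using fs by (auto simp: factor_systems_iff factor_cocycles_iff)
  note closed = C1c_closed[OF S] cochains_2_closed[OF \<omega>] N.lie_closed G.lie_closed
  note zero_simps = C1c_zero_left[OF S] C1c_zero_right[OF S] cochains_2_zero[OF \<omega>]
    cochains_2_self[OF \<omega>] N.M.diff_zero
  have E [simp]: "total ?E = ?C" "incl ?E = (\<lambda>v\<in>carrier n. (v, \<zero>\<^bsub>g\<^esub>))" "proj ?E = (\<lambda>e\<in>carrier n \<times> carrier g. snd e)"
    by (simp_all add: crossed_extension_def)
  have incl_cont: "continuous_map (topo n) (topo ?C) (incl ?E)"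
  proof -
    have "continuous_map (topo n) (topo ?C) (\<lambda>v. (v, \<zero>\<^bsub>g\<^esub>))"
      by (simp add: crossed_product_simps continuous_map_paired G.topspace_vector)
    then show ?thesis
      by (rule continuous_map_eq) (simp add: N.topspace_vector)
  qed
  \<comment> \<open>The first projection is a continuous left inverse of the inclusion, which is
    therefore an embedding.\<close>
  have "continuous_map (topo ?C) (topo n) fst"
    by (simp add: crossed_product_simps continuous_map_fst)
  then have emb: "embedding_map (topo n) (topo ?C) (incl ?E)"
    using incl_cont
    by (intro section_imp_embedding_map) (auto simp: section_map_def retraction_maps_def N.topspace_vector)
  have proj_cont: "continuous_map (topo ?C) (topo g) (proj ?E)"
    unfolding E
    by (rule continuous_map_eq[of _ _ snd])
       (auto simp: crossed_product_simps continuous_map_snd N.topspace_vector G.topspace_vector)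
  have incl: "incl ?E \<in> top_lie_hom K n ?C"
    using incl_cont unfolding top_lie_hom_def
    by (auto intro!: linear_mapsI simp: crossed_product_simps zero_simps closed)
  have proj: "proj ?E \<in> top_lie_hom K ?C g"
    using proj_cont unfolding top_lie_hom_def
    by (auto intro!: linear_mapsI simp: crossed_product_simps closed)
  have "continuous_map (topo g) (topo ?C) (\<lambda>x. (\<zero>\<^bsub>n\<^esub>, x))"
    by (simp add: crossed_product_simps continuous_map_paired N.topspace_vector)
  then have "continuous_map (topo g) (topo ?C) \<sigma>"
    unfolding \<sigma>_def by (rule continuous_map_eq) (simp add: G.topspace_vector)
  then have "\<sigma> \<in> sections K g ?E"
    by (auto intro!: linear_mapsI simp: sections_def \<sigma>_def crossed_product_simps)
  then show *: "split_extension K g n ?E \<sigma>"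
    using incl proj emb
    by (intro split_extension.intro lie_sequence.intro split_extension_axioms.intro lie_sequence_axioms.intro
        lie_pair_axioms)
       (auto simp: topological_lie_algebra_crossed_product[OF fs] crossed_product_simps)
  interpret E: split_extension K g n ?E \<sigma> by fact
  have act: "E.act x v = S x v" if "x \<in> carrier g" "v \<in> carrier n" for x v
  proof (rule E.incl_eqI)
    show "incl ?E (E.act x v) = incl ?E (S x v)"
      unfolding E.incl_act[OF that] using that by (simp add: \<sigma>_def crossed_product_simps closed zero_simps)
  qed (use that E.act_closed closed in auto)
  show "E.act = S"
  proof (rule extensionalityI[OF C1c_extensional[OF E.act_C1c] C1c_extensional[OF S]])
    fix x assume "x \<in> carrier g"
    then show "E.act x = S x"
      by (intro extensionalityI[OF C1c_value_extensional[OF E.act_C1c] C1c_value_extensional[OF S]] act)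
  qed
  have "E.coc [x, y] = \<omega> [x, y]" if "x \<in> carrier g" "y \<in> carrier g" for x y
  proof (rule E.incl_eqI)
    interpret C: topological_lie_algebra K ?C
      by (rule topological_lie_algebra_crossed_product[OF fs])
    have "lie ?C (\<sigma> x) (\<sigma> y) = (\<omega> [x, y], \<zero>\<^bsub>g\<^esub>) \<oplus>\<^bsub>?C\<^esub> \<sigma> (lie g x y)"
      using that by (simp add: \<sigma>_def crossed_product_simps closed zero_simps)
    then have "lie ?C (\<sigma> x) (\<sigma> y) \<ominus>\<^bsub>?C\<^esub> \<sigma> (lie g x y) = (\<omega> [x, y], \<zero>\<^bsub>g\<^esub>)"
      using that by (subst C.M.diff_eq_iff) (simp_all add: \<sigma>_def crossed_product_simps closed zero_simps)
    then show "incl ?E (E.coc [x, y]) = incl ?E (\<omega> [x, y])"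
      unfolding E.incl_coc[OF that] using that by (simp add: closed)
  qed (use that E.coc_closed closed in auto)
  then have "E.coc = (\<lambda>xs\<in>tuples g 2. \<omega> xs)"
    by (rule restrict_tuples_2_eqI[OF cochain_extensional[OF E.coc_cochain]])
  also have "\<dots> = \<omega>"
    using cochain_extensional[OF \<omega>] by (rule extensional_restrict)
  finally show "E.coc = \<omega>" .
qed

end

end

section \<open>Transport of an extension along an injection\<close>

text \<open>Transport of structure: operations on the image pull their arguments back by the inverse
  of c and push the result forward. The topology is the one for which c is a homeomorphism onto its
  image.\<close>

definition transport_ext ::
    "('k, 'n) top_lie_alg \<Rightarrow> ('e \<Rightarrow> 'f) \<Rightarrow> ('k, 'n, 'g, 'e) lie_ext \<Rightarrow> ('k, 'n, 'g, 'f) lie_ext"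
  where "transport_ext n c E = (let L = total E; C = c ` carrier L; d = inv_into (carrier L) c in \<lparr>
    total = \<lparr>
      carrier = C,
      monoid.mult = undefined,
      one = undefined,
      ring.zero = c \<zero>\<^bsub>L\<^esub>,
      ring.add = (\<lambda>e f. c (d e \<oplus>\<^bsub>L\<^esub> d f)),
      smult = (\<lambda>a e. c (a \<odot>\<^bsub>L\<^esub> d e)),
      lie = (\<lambda>e f. c (lie L (d e) (d f))),
      topo = pullback_topology C d (topo L)\<rparr>,
    incl = (\<lambda>v\<in>carrier n. c (incl E v)),
    proj = (\<lambda>e\<in>C. proj E (d e))\<rparr>)"

lemma (in split_extension) transport_ext:
  fixes c :: "'e \<Rightarrow> 'f"
  assumes inj: "inj_on c (carrier (total E))"
  shows "split_extension K g n (transport_ext n c E) (\<lambda>x\<in>carrier g. c (\<sigma> x))"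
    and "ext_equiv K n E (transport_ext n c E)"
proof -
  let ?F = "transport_ext n c E"
  let ?L = "total E" and ?M = "total ?F"
  let ?d = "inv_into (carrier ?L) c"
  have d [simp]: "?d (c e) = e" if "e \<in> carrier ?L" for e
    using inj that by simp
  have F: "carrier ?M = c ` carrier ?L" "\<zero>\<^bsub>?M\<^esub> = c \<zero>\<^bsub>?L\<^esub>"
    "e \<oplus>\<^bsub>?M\<^esub> f = c (?d e \<oplus>\<^bsub>?L\<^esub> ?d f)" "a \<odot>\<^bsub>?M\<^esub> e = c (a \<odot>\<^bsub>?L\<^esub> ?d e)"
    "lie ?M e f = c (lie ?L (?d e) (?d f))" "topo ?M = pullback_topology (c ` carrier ?L) ?d (topo ?L)"
    "incl ?F = (\<lambda>v\<in>carrier n. c (incl E v))" "proj ?F = (\<lambda>e\<in>c ` carrier ?L. proj E (?d e))" for e f a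
    by (simp_all add: transport_ext_def Let_def)
  have proj_c: "proj ?F (c e) = proj E e" if "e \<in> carrier ?L" for e
    using that by (simp add: F(8))
  have topspace_M: "topspace (topo ?M) = c ` carrier ?L"
    by (auto simp: F topspace_pullback_topology L.topspace_vector)
  have c_cont: "continuous_map (topo ?L) (topo ?M) c"
    unfolding F
  proof (rule continuous_map_pullback')
    show "continuous_map (topo ?L) (topo ?L) (?d \<circ> c)"
      by (rule continuous_map_eq[OF continuous_map_id]) (simp add: L.topspace_vector)
  qed (auto simp: L.topspace_vector)
  have d_cont: "continuous_map (topo ?M) (topo ?L) ?d"
    unfolding F using continuous_map_pullback[OF continuous_map_id, of "c ` carrier ?L" ?d "topo ?L"]
    by simp
  have homeo: "homeomorphic_maps (topo ?L) (topo ?M) c ?d"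
    using c_cont d_cont by (auto simp: homeomorphic_maps_def topspace_M L.topspace_vector)
  have "abelian_group ?M"
  proof (rule abelian_groupI)
    fix e assume "e \<in> carrier ?M"
    then show "\<exists>f\<in>carrier ?M. f \<oplus>\<^bsub>?M\<^esub> e = \<zero>\<^bsub>?M\<^esub>"
      by (intro bexI[of _ "c (\<ominus>\<^bsub>?L\<^esub> ?d e)"]) (auto simp: F L.M.l_neg)
  qed (auto simp: F L.M.a_ac)
  then have "module K ?M"
    by (intro moduleI[OF G.is_cring]) (auto simp: F L.smult_l_distr L.smult_r_distr L.smult_assoc1)
  moreover have "continuous_map (prod_topology (topo ?M) (topo ?M)) (topo ?M) (\<lambda>(e, f). e \<oplus>\<^bsub>?M\<^esub> f)"
    using continuous_map_compose[OF L.continuous_map_vector_add[OF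
        continuous_map_compose[OF continuous_map_fst d_cont] continuous_map_compose[OF continuous_map_snd d_cont]] c_cont]
    by (simp add: F(3) case_prod_beta' o_def)
  moreover have "continuous_map (prod_topology (ftopo K) (topo ?M)) (topo ?M) (\<lambda>(a, e). a \<odot>\<^bsub>?M\<^esub> e)"
    using continuous_map_compose[OF L.continuous_map_vector_smult[OF
        continuous_map_fst continuous_map_compose[OF continuous_map_snd d_cont]] c_cont]
    by (simp add: F(4) case_prod_beta' o_def)
  moreover have "Hausdorff_space (topo ?M)"
    using L.Hausdorff homeomorphic_Hausdorff_space homeo unfolding homeomorphic_space_def by blast
  ultimately have "topological_vector_space K ?M (topo ?M)"
    unfolding topological_vector_space_def topological_vector_space_axioms_def
    by (simp add: G.topological_field_char_0_axioms topspace_M F(1))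
  moreover have "continuous_map (prod_topology (topo ?M) (topo ?M)) (topo ?M) (\<lambda>(e, f). lie ?M e f)"
    using continuous_map_compose[OF L.continuous_map_lie[OF
        continuous_map_compose[OF continuous_map_fst d_cont] continuous_map_compose[OF continuous_map_snd d_cont]] c_cont]
    by (simp add: F(5) case_prod_beta' o_def)
  moreover have "lie_algebra_axioms K ?M"
    by (rule lie_algebra_axioms.intro)
       (auto simp: F L.lie_closed L.lie_add_left L.lie_add_right L.lie_smult_left L.lie_smult_right L.lie_self L.jacobi)
  ultimately have M: "topological_lie_algebra K ?M"
    by (intro topological_lie_algebra.intro lie_algebra.intro topological_lie_algebra_axioms.intro)
       (simp_all add: topological_vector_space_def)
  have "continuous_map (topo n) (topo ?M) (incl ?F)"
    by (rule continuous_map_eq[OF continuous_map_compose[OF incl_continuous c_cont]])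
       (simp add: F(7) N.topspace_vector)
  then have "incl ?F \<in> top_lie_hom K n ?M"
    by (auto intro!: linear_mapsI simp: top_lie_hom_def F(1-5,7) closed_simps transfer_simps)
  moreover have "embedding_map (topo n) (topo ?M) (incl ?F)"
  proof -
    have "embedding_map (topo ?L) (topo ?M) c"
      using homeo by (intro section_imp_embedding_map) (auto simp: section_map_def retraction_maps_def homeomorphic_maps_def)
    then have "embedding_map (topo n) (topo ?M) (c \<circ> incl E)"
      by (rule embedding_map_compose[OF incl_embedding])
    then show ?thesis
      by (rule embedding_map_eq) (simp add: F(7) N.topspace_vector)
  qed
  moreover have "continuous_map (topo ?M) (topo g) (proj ?F)"
    by (rule continuous_map_eq[OF continuous_map_compose[OF d_cont proj_continuous]])
       (auto simp: F(8) topspace_M)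
  then have "proj ?F \<in> top_lie_hom K ?M g"
    unfolding top_lie_hom_def
    by (auto intro!: linear_mapsI simp: F(1-5) proj_c closed_simps proj_simps proj_lie) (simp add: F(8))
  moreover have "{e \<in> carrier ?M. proj ?F e = \<zero>\<^bsub>g\<^esub>} = incl ?F ` carrier n"
  proof -
    have "{e \<in> carrier ?M. proj ?F e = \<zero>\<^bsub>g\<^esub>} = c ` {e \<in> carrier ?L. proj E e = \<zero>\<^bsub>g\<^esub>}"
      by (auto simp: F(1) proj_c)
    also have "\<dots> = incl ?F ` carrier n"
      unfolding kernel by (auto simp: F(7))
    finally show ?thesis .
  qed
  ultimately have F_seq: "lie_sequence K g n ?F"
    using M by (intro lie_sequence.intro lie_sequence_axioms.intro lie_pair_axioms)
  \<comment> \<open>A morphism has to be undefined off the carrier, so c is restricted before it can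
    serve as the equivalence.\<close>
  have "(\<lambda>e\<in>carrier ?L. c e) \<in> linear_maps K ?L ?M"
    by (rule linear_mapsI) (auto simp: F(1-4))
  moreover have "continuous_map (topo ?L) (topo ?M) (\<lambda>e\<in>carrier ?L. c e)"
    by (rule continuous_map_eq[OF c_cont]) (simp add: L.topspace_vector)
  ultimately have c_hom: "(\<lambda>e\<in>carrier ?L. c e) \<in> top_lie_hom K ?L ?M"
    by (simp add: top_lie_hom_def F(5) closed_simps)
  have c_ext: "(\<lambda>e\<in>carrier ?L. c e) (incl E v) = incl ?F v" if "v \<in> carrier n" for v
    using that by (simp add: F(7) closed_simps)
  have c_proj: "proj ?F ((\<lambda>e\<in>carrier ?L. c e) e) = proj E e" if "e \<in> carrier ?L" for e
    using that by (simp add: proj_c)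
  show "ext_equiv K n E ?F"
    unfolding ext_equiv_def using c_hom c_ext c_proj by blast
  have "split_extension K g n ?F (\<lambda>x\<in>carrier g. (\<lambda>e\<in>carrier ?L. c e) (\<sigma> x))"
    using split_extension_axioms F_seq c_hom c_ext c_proj by (rule split_extension_equiv(1))
  moreover have "(\<lambda>x\<in>carrier g. (\<lambda>e\<in>carrier ?L. c e) (\<sigma> x)) = (\<lambda>x\<in>carrier g. c (\<sigma> x))"
    by (intro restrict_ext) (simp add: section_closed)
  ultimately show "split_extension K g n ?F (\<lambda>x\<in>carrier g. c (\<sigma> x))"
    by simp
qed

section \<open>Affine spaces over a quotient group\<close>

text \<open>A \<open>group_action\<close> is a homomorphism into the group of extensional
  bijections. Bijectivity of each translation follows from the action laws, since the inverse group
  element undoes it.\<close>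

lemma affine_space_overI:
  assumes "comm_group A" "E \<noteq> {}"
    and closed: "\<And>a x. \<lbrakk>a \<in> carrier A; x \<in> E\<rbrakk> \<Longrightarrow> \<phi> a x \<in> E"
    and ext: "\<And>a. a \<in> carrier A \<Longrightarrow> \<phi> a \<in> extensional E"
    and one: "\<And>x. x \<in> E \<Longrightarrow> \<phi> \<one>\<^bsub>A\<^esub> x = x"
    and mult: "\<And>a b x. \<lbrakk>a \<in> carrier A; b \<in> carrier A; x \<in> E\<rbrakk> \<Longrightarrow> \<phi> (a \<otimes>\<^bsub>A\<^esub> b) x = \<phi> a (\<phi> b x)"
    and trans: "\<And>x y. \<lbrakk>x \<in> E; y \<in> E\<rbrakk> \<Longrightarrow> \<exists>a\<in>carrier A. \<phi> a x = y"
    and free: "\<And>a b x. \<lbrakk>a \<in> carrier A; b \<in> carrier A; x \<in> E; \<phi> a x = \<phi> b x\<rbrakk> \<Longrightarrow> a = b"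
  shows "affine_space_over A E \<phi>"
proof -
  interpret comm_group A by fact
  have bij: "\<phi> a \<in> Bij E" if "a \<in> carrier A" for a
  proof -
    have "\<phi> (inv\<^bsub>A\<^esub> a) (\<phi> a x) = x" "\<phi> a (\<phi> (inv\<^bsub>A\<^esub> a) x) = x" if "x \<in> E" for x
      using mult[of "inv\<^bsub>A\<^esub> a" a x] mult[of a "inv\<^bsub>A\<^esub> a" x] \<open>a \<in> carrier A\<close> that one by simp_all
    then have "bij_betw (\<phi> a) E E"
      using closed that by (intro bij_betw_byWitness[where f' = "\<phi> (inv\<^bsub>A\<^esub> a)"]) auto
    then show ?thesis
      using ext that by (simp add: Bij_def)
  qed
  have "\<phi> \<in> hom A (BijGroup E)"
  proof (rule homI)
    fix a b assume ab: "a \<in> carrier A" "b \<in> carrier A"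
    have "\<phi> (a \<otimes>\<^bsub>A\<^esub> b) = compose E (\<phi> a) (\<phi> b)"
      using ab by (intro extensionalityI[OF ext compose_extensional]) (auto simp: mult compose_eq)
    then show "\<phi> (a \<otimes>\<^bsub>A\<^esub> b) = \<phi> a \<otimes>\<^bsub>BijGroup E\<^esub> \<phi> b"
      using ab bij by (simp add: BijGroup_def)
  qed (use bij in \<open>auto simp: BijGroup_def\<close>)
  then have "group_action A E \<phi>"
    by (intro group_action.intro group_hom.intro group_hom_axioms.intro group_BijGroup) (rule is_group)
  then show ?thesis
    unfolding affine_space_over_def using assms(1,2) trans free by blast
qed

text \<open>By freeness, B is the set of translations that keep a given point in its fibre
  (\<open>mem_B\<close>), which makes it a subgroup. Commutativity lets a translation pass a change
  of the point within its fibre, so the action descends to the image of \<Gamma>.\<close>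

lemma affine_space_quotient:
  assumes affine: "affine_space_over A P \<phi>" and B: "B \<subseteq> carrier A"
    and fibre: "\<And>x. x \<in> P \<Longrightarrow> {x' \<in> P. \<Gamma> x' = \<Gamma> x} = {\<phi> b x | b. b \<in> B}"
  shows "\<exists>\<psi>. affine_space_over (A Mod B) (\<Gamma> ` P) \<psi> \<and>
    (\<forall>a\<in>carrier A. \<forall>x\<in>P. \<psi> (B #>\<^bsub>A\<^esub> a) (\<Gamma> x) = \<Gamma> (\<phi> a x))"
proof -
  interpret comm_group A
    using affine by (simp add: affine_space_over_def)
  interpret group_action A P \<phi>
    using affine by (simp add: affine_space_over_def)
  obtain x0 where x0: "x0 \<in> P"
    using affine by (auto simp: affine_space_over_def)
  have free: "a = b" if "a \<in> carrier A" "b \<in> carrier A" "x \<in> P" "\<phi> a x = \<phi> b x" for a b x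
    using affine that element_image[of b x] unfolding affine_space_over_def by blast
  have closed: "\<phi> a x \<in> P" if "a \<in> carrier A" "x \<in> P" for a x
    using element_image[OF that] by simp
  have mult: "\<phi> (a \<otimes>\<^bsub>A\<^esub> b) x = \<phi> a (\<phi> b x)" if "a \<in> carrier A" "b \<in> carrier A" "x \<in> P" for a b x
    using composition_rule that by simp
  have \<Gamma>_B: "\<Gamma> (\<phi> b x) = \<Gamma> x" if "b \<in> B" "x \<in> P" for b x
    using fibre[OF that(2)] that(1) by blast
  have mem_B: "b \<in> B" if "b \<in> carrier A" "x \<in> P" "\<Gamma> (\<phi> b x) = \<Gamma> x" for b x
  proof -
    have "\<phi> b x \<in> {\<phi> b x | b. b \<in> B}"
      using that closed fibre[OF that(2)] by blast
    then show ?thesis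
      using free[OF that(1) _ that(2)] B by blast
  qed
  have sub: "subgroup B A"
  proof (rule subgroupI)
    show "B \<noteq> {}"
      using fibre[OF x0] x0 by blast
    fix b assume b: "b \<in> B"
    then have bA: "b \<in> carrier A" using B by blast
    have "\<phi> b (\<phi> (inv\<^bsub>A\<^esub> b) x0) = x0"
      using mult[of b "inv\<^bsub>A\<^esub> b" x0] bA x0 id_eq_one by (metis Units_eq Units_r_inv inv_closed restrict_apply')
    then have "\<Gamma> (\<phi> (inv\<^bsub>A\<^esub> b) x0) = \<Gamma> x0"
      using \<Gamma>_B[OF b closed[of "inv\<^bsub>A\<^esub> b" x0]] bA x0 by simp
    then show "inv\<^bsub>A\<^esub> b \<in> B"
      using mem_B bA x0 by blast
    fix b' assume b': "b' \<in> B"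
    then have "\<Gamma> (\<phi> (b \<otimes>\<^bsub>A\<^esub> b') x0) = \<Gamma> x0"
      using b B x0 \<Gamma>_B closed mult by (metis subsetD)
    then show "b \<otimes>\<^bsub>A\<^esub> b' \<in> B"
      using mem_B[of "b \<otimes>\<^bsub>A\<^esub> b'" x0] b' bA B x0 by blast
  qed (rule B)
  interpret B: normal B A
    using sub normal_iff_subgroup by blast
  \<comment> \<open>A translation in the coset C and a point over y are chosen; the next fact shows
    that the result does not depend on either choice.\<close>
  define \<psi> where "\<psi> = (\<lambda>C. \<lambda>y\<in>\<Gamma> ` P.
    \<Gamma> (\<phi> (SOME a. a \<in> carrier A \<and> B #>\<^bsub>A\<^esub> a = C) (SOME x. x \<in> P \<and> \<Gamma> x = y)))"
  have \<psi>: "\<psi> (B #>\<^bsub>A\<^esub> a) (\<Gamma> x) = \<Gamma> (\<phi> a x)" if a: "a \<in> carrier A" and x: "x \<in> P" for a x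
  proof -
    define a' where "a' = (SOME a'. a' \<in> carrier A \<and> B #>\<^bsub>A\<^esub> a' = B #>\<^bsub>A\<^esub> a)"
    define x' where "x' = (SOME x'. x' \<in> P \<and> \<Gamma> x' = \<Gamma> x)"
    have a': "a' \<in> carrier A \<and> B #>\<^bsub>A\<^esub> a' = B #>\<^bsub>A\<^esub> a"
      unfolding a'_def by (rule someI[where x = a]) (simp add: a)
    have x': "x' \<in> P \<and> \<Gamma> x' = \<Gamma> x"
      unfolding x'_def by (rule someI[where x = x]) (simp add: x)
    have "a' \<in> B #>\<^bsub>A\<^esub> a"
      using a' rcos_self[OF _ sub, of a'] by simp
    then obtain b where b: "b \<in> B" "a' = b \<otimes>\<^bsub>A\<^esub> a"
      by (auto simp: r_coset_def)
    obtain b' where b': "b' \<in> B" "x' = \<phi> b' x"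
      using fibre[OF x] x' by blast
    have carr: "b \<in> carrier A" "b' \<in> carrier A"
      using b b' B by auto
    have "\<phi> a' x' = \<phi> (b \<otimes>\<^bsub>A\<^esub> a \<otimes>\<^bsub>A\<^esub> b') x"
      using b b' carr a x by (simp add: mult)
    also have "b \<otimes>\<^bsub>A\<^esub> a \<otimes>\<^bsub>A\<^esub> b' = b \<otimes>\<^bsub>A\<^esub> (b' \<otimes>\<^bsub>A\<^esub> a)"
      using carr a by (simp add: m_ac)
    finally have "\<phi> a' x' = \<phi> b (\<phi> b' (\<phi> a x))"
      using carr a x by (simp add: mult closed)
    then have "\<Gamma> (\<phi> a' x') = \<Gamma> (\<phi> a x)"
      using b b' carr a x by (simp add: \<Gamma>_B closed)
    then show ?thesis
      using x by (simp add: \<psi>_def a'_def x'_def)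
  qed
  have carrier_Mod: "carrier (A Mod B) = (\<lambda>a. B #>\<^bsub>A\<^esub> a) ` carrier A"
    by (rule carrier_FactGroup)
  have "affine_space_over (A Mod B) (\<Gamma> ` P) \<psi>"
  proof (rule affine_space_overI)
    show "comm_group (A Mod B)"
      by (rule abelian_FactGroup[OF sub])
    show "\<Gamma> ` P \<noteq> {}"
      using x0 by blast
    show "\<psi> C \<in> extensional (\<Gamma> ` P)" for C
      by (simp add: \<psi>_def)
    show "\<psi> C y \<in> \<Gamma> ` P" if "C \<in> carrier (A Mod B)" "y \<in> \<Gamma> ` P" for C y
      using that by (auto simp: carrier_Mod \<psi> closed)
    show "\<psi> \<one>\<^bsub>A Mod B\<^esub> y = y" if "y \<in> \<Gamma> ` P" for y
    proof -
      have "B = B #>\<^bsub>A\<^esub> \<one>\<^bsub>A\<^esub>"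
        using B by (simp add: coset_mult_one)
      moreover have "\<phi> \<one>\<^bsub>A\<^esub> x = x" if "x \<in> P" for x
        using that id_eq_one by (metis restrict_apply')
      ultimately show ?thesis
        using that \<psi>[of "\<one>\<^bsub>A\<^esub>"] by auto
    qed
    show "\<psi> (C \<otimes>\<^bsub>A Mod B\<^esub> D) y = \<psi> C (\<psi> D y)"
      if "C \<in> carrier (A Mod B)" "D \<in> carrier (A Mod B)" "y \<in> \<Gamma> ` P" for C D y
      using that by (auto simp: carrier_Mod \<psi> closed B.rcos_sum mult)
    show "\<exists>C\<in>carrier (A Mod B). \<psi> C y = y'" if yy': "y \<in> \<Gamma> ` P" "y' \<in> \<Gamma> ` P" for y y'
    proof -
      obtain x x' where x: "x \<in> P" "x' \<in> P" "y = \<Gamma> x" "y' = \<Gamma> x'"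
        using yy' by blast
      then obtain a where "a \<in> carrier A" "\<phi> a x = x'"
        using affine unfolding affine_space_over_def by blast
      then show ?thesis
        using x \<psi>[of a x] by (auto simp: carrier_Mod)
    qed
    show "C = D" if CD: "C \<in> carrier (A Mod B)" "D \<in> carrier (A Mod B)" "y \<in> \<Gamma> ` P" "\<psi> C y = \<psi> D y" for C D y
    proof -
      obtain a a' x where a: "a \<in> carrier A" "a' \<in> carrier A" "x \<in> P"
        and CD_eq: "C = B #>\<^bsub>A\<^esub> a" "D = B #>\<^bsub>A\<^esub> a'" "y = \<Gamma> x"
        using CD by (auto simp: carrier_Mod)
      have "\<Gamma> (\<phi> a x) = \<Gamma> (\<phi> a' x)"
        using CD(4) a by (simp add: CD_eq \<psi>)
      then obtain b where b: "b \<in> B" "\<phi> a x = \<phi> b (\<phi> a' x)"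
        using fibre[OF closed[OF a(2,3)]] closed[OF a(1,3)] by blast
      then have "a = b \<otimes>\<^bsub>A\<^esub> a'"
        using a B by (intro free[OF _ _ a(3)]) (auto simp: mult)
      then have "a \<in> B #>\<^bsub>A\<^esub> a'"
        using b(1) by (auto simp: r_coset_def)
      then show ?thesis
        unfolding CD_eq using repr_independence[OF _ a(2) sub] by simp
    qed
  qed
  with \<psi> show ?thesis
    by blast
qed

section \<open>Classes of extensions\<close>

context lie_pair
begin

text \<open>E and F may live on different types, also different from that of the members of the
  class. This permits comparing a crossed product with its transported copy.\<close>

lemma ext_class_eqI:
  assumes "split_extension K g n E \<sigma>" "split_extension K g n F \<tau>" "ext_equiv K n E F"
  shows "ext_class K g n E = ext_class K g n F"
proof -
  interpret E: split_extension K g n E \<sigma> by fact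
  interpret F: split_extension K g n F \<tau> by fact
  have "ext_equiv K n F E"
    using ext_equiv_sym[OF assms(1) F.lie_sequence_axioms assms(3)] .
  then show ?thesis
    unfolding ext_class_def using E.ext_equiv_trans F.ext_equiv_trans assms(3) by blast
qed

lemma Ext_eq:
  "(Ext K g n :: ('k, 'n, 'g, 'e) lie_ext set set) =
    ext_class K g n ` (extensions K g n :: ('k, 'n, 'g, 'e) lie_ext set)"
  unfolding Ext_def quotient_def ext_class_def by auto

lemma factor_system_splits:
  assumes "f \<in> factor_systems K g n"
  obtains \<sigma> where "split_extension K g n (crossed_extension g n (fst f) (snd f)) \<sigma>"
    and "section_action g n (crossed_extension g n (fst f) (snd f)) \<sigma> = fst f"
    and "section_cocycle g n (crossed_extension g n (fst f) (snd f)) \<sigma> = snd f"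
  using split_extension_crossed[of "fst f" "snd f"] assms by auto

text \<open>The translate by \<gamma> is the factor system of the crossed product with respect to
  the shifted section, so its curvature and cocycle equations are instances of
  \<open>section_factor_system\<close>.\<close>

lemma C1_action_closed:
  assumes f: "f \<in> factor_systems K g n" and \<gamma>: "\<gamma> \<in> cochains K (Suc 0) g n"
  shows "C1_action K g n \<gamma> f \<in> factor_systems K g n"
proof -
  obtain \<sigma> where E: "split_extension K g n (crossed_extension g n (fst f) (snd f)) \<sigma>"
    "section_action g n (crossed_extension g n (fst f) (snd f)) \<sigma> = fst f"
    "section_cocycle g n (crossed_extension g n (fst f) (snd f)) \<sigma> = snd f"
    using factor_system_splits[OF f] .
  interpret E: split_extension K g n "crossed_extension g n (fst f) (snd f)" \<sigma> by fact
  show ?thesis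
    using E.factor_system_shift[OF \<gamma>]
      split_extension.section_factor_system[OF E.split_extension_shift[OF \<gamma>]] E(2,3) by simp
qed

lemma crossed_extension_equiv_iff:
  assumes f: "f \<in> factor_systems K g n" and f': "f' \<in> factor_systems K g n"
  shows "ext_equiv K n (crossed_extension g n (fst f') (snd f')) (crossed_extension g n (fst f) (snd f))
    \<longleftrightarrow> (\<exists>\<gamma>\<in>cochains K (Suc 0) g n. f' = C1_action K g n \<gamma> f)"
proof -
  let ?E = "crossed_extension g n (fst f) (snd f)" and ?E' = "crossed_extension g n (fst f') (snd f')"
  obtain \<sigma> where E: "split_extension K g n ?E \<sigma>" "section_action g n ?E \<sigma> = fst f" "section_cocycle g n ?E \<sigma> = snd f"
    using factor_system_splits[OF f] .
  obtain \<sigma>' where E': "split_extension K g n ?E' \<sigma>'" "section_action g n ?E' \<sigma>' = fst f'" "section_cocycle g n ?E' \<sigma>' = snd f'"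
    using factor_system_splits[OF f'] .
  interpret E: split_extension K g n ?E \<sigma> by fact
  interpret E': split_extension K g n ?E' \<sigma>' by fact
  show ?thesis
  proof
    assume "ext_equiv K n ?E' ?E"
    then obtain \<phi> where \<phi>: "\<phi> \<in> top_lie_hom K (total ?E') (total ?E)"
      and "\<And>v. v \<in> carrier n \<Longrightarrow> \<phi> (incl ?E' v) = incl ?E v"
      and "\<And>e. e \<in> carrier (total ?E') \<Longrightarrow> proj ?E (\<phi> e) = proj ?E' e"
      unfolding ext_equiv_def by blast
    note * = split_extension_equiv[OF E'(1) E.lie_sequence_axioms this]
    \<comment> \<open>The equivalence carries the canonical section of one crossed product to a
      section of the other, which differs from the canonical one there by some \<gamma>.\<close>
    obtain \<gamma> where \<gamma>: "\<gamma> \<in> cochains K (Suc 0) g n" "(\<lambda>x\<in>carrier g. \<phi> (\<sigma>' x)) = E.shift \<gamma>"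
      using E.section_eq_shift[OF split_extension.section_mem[OF *(1)]] .
    have "f' = C1_action K g n \<gamma> f"
      using E.factor_system_shift[OF \<gamma>(1)] *(2,3) E(2,3) E'(2,3) by (simp add: \<gamma>(2))
    with \<gamma>(1) show "\<exists>\<gamma>\<in>cochains K (Suc 0) g n. f' = C1_action K g n \<gamma> f"
      by blast
  next
    assume "\<exists>\<gamma>\<in>cochains K (Suc 0) g n. f' = C1_action K g n \<gamma> f"
    then obtain \<gamma> where \<gamma>: "\<gamma> \<in> cochains K (Suc 0) g n" "f' = C1_action K g n \<gamma> f"
      by blast
    interpret T: split_extension K g n ?E "E.shift \<gamma>"
      by (rule E.split_extension_shift[OF \<gamma>(1)])
    have "f' = (T.act, T.coc)"
      using E.factor_system_shift[OF \<gamma>(1)] E(2,3) \<gamma>(2) by simp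
    then show "ext_equiv K n ?E' ?E"
      using T.crossed_extension_equiv by simp
  qed
qed

text \<open>\<open>copy\<close> supplies a member of every class by transporting the crossed
  product. Without a member, two classes could coincide merely by being empty.\<close>

lemma
  fixes copy :: "'n \<times> 'g \<Rightarrow> 'e"
  assumes copy: "inj_on copy (carrier n \<times> carrier g)"
  defines "\<Gamma> \<equiv> (ext_of_factor_system K g n :: _ \<Rightarrow> ('k, 'n, 'g, 'e) lie_ext set)"
  shows ext_of_factor_system_in_Ext: "f \<in> factor_systems K g n \<Longrightarrow> \<Gamma> f \<in> Ext K g n"
    and ext_of_factor_system_member: "f \<in> factor_systems K g n \<Longrightarrow> \<exists>F\<in>\<Gamma> f. \<exists>\<sigma>\<in>sections K g F.
      section_action g n F \<sigma> = fst f"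
    and ext_of_factor_system_eq_iff: "\<lbrakk>f \<in> factor_systems K g n; f' \<in> factor_systems K g n\<rbrakk> \<Longrightarrow>
      \<Gamma> f' = \<Gamma> f \<longleftrightarrow> (\<exists>\<gamma>\<in>cochains K (Suc 0) g n. f' = C1_action K g n \<gamma> f)"
proof -
  have \<Gamma>: "\<Gamma> f = ext_class K g n (crossed_extension g n (fst f) (snd f))" for f
    by (simp add: \<Gamma>_def ext_of_factor_system_def case_prod_beta')
  have copy_ext: "\<exists>F \<tau>. split_extension K g n F \<tau> \<and> ext_equiv K n (crossed_extension g n (fst f) (snd f)) F \<and>
      section_action g n F \<tau> = fst f \<and> \<Gamma> f = ext_class K g n F \<and> F \<in> \<Gamma> f"
    if f: "f \<in> factor_systems K g n" for f
  proof -
    let ?E = "crossed_extension g n (fst f) (snd f)"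
    obtain \<sigma> where E: "split_extension K g n ?E \<sigma>" "section_action g n ?E \<sigma> = fst f"
      using factor_system_splits[OF f] .
    interpret E: split_extension K g n ?E \<sigma> by fact
    have "inj_on copy (carrier (total ?E))"
      using copy by (simp add: crossed_extension_def crossed_product_def)
    note F = E.transport_ext[OF this]
    let ?F = "transport_ext n copy ?E"
    interpret F: split_extension K g n ?F "\<lambda>x\<in>carrier g. copy (\<sigma> x)" by (rule F(1))
    obtain \<phi> where "\<phi> \<in> top_lie_hom K (total ?E) (total ?F)"
      and "\<And>v. v \<in> carrier n \<Longrightarrow> \<phi> (incl ?E v) = incl ?F v"
      and "\<And>e. e \<in> carrier (total ?E) \<Longrightarrow> proj ?F (\<phi> e) = proj ?E e"
      using F(2) unfolding ext_equiv_def by blast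
    \<comment> \<open>Transport is an equivalence, so the image of the section still has the action
      \<open>fst f\<close>; this later places the class in the right
      \<open>Ext_outer\<close>.\<close>
    note * = split_extension_equiv[OF E(1) F.lie_sequence_axioms this]
    have "\<Gamma> f = ext_class K g n ?F"
      unfolding \<Gamma> using E(1) F by (rule ext_class_eqI)
    moreover have "?F \<in> ext_class K g n ?F"
      using F(1) F.ext_equiv_refl extensions_iff by (auto simp: ext_class_def)
    ultimately show ?thesis
      using * F(2) E(2) by metis
  qed
  show "\<Gamma> f \<in> Ext K g n" if "f \<in> factor_systems K g n"
    using copy_ext[OF that] unfolding Ext_eq extensions_iff image_iff Bex_def by blast
  show "\<exists>F\<in>\<Gamma> f. \<exists>\<sigma>\<in>sections K g F. section_action g n F \<sigma> = fst f" if "f \<in> factor_systems K g n"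
    using copy_ext[OF that] split_extension.section_mem by blast
  show "\<Gamma> f' = \<Gamma> f \<longleftrightarrow> (\<exists>\<gamma>\<in>cochains K (Suc 0) g n. f' = C1_action K g n \<gamma> f)"
    if f: "f \<in> factor_systems K g n" and f': "f' \<in> factor_systems K g n"
  proof -
    let ?E = "crossed_extension g n (fst f) (snd f)" and ?E' = "crossed_extension g n (fst f') (snd f')"
    obtain \<sigma> where E: "split_extension K g n ?E \<sigma>"
      using factor_system_splits[OF f] .
    obtain \<sigma>' where E': "split_extension K g n ?E' \<sigma>'"
      using factor_system_splits[OF f'] .
    interpret E: split_extension K g n ?E \<sigma> by fact
    interpret E': split_extension K g n ?E' \<sigma>' by fact
    obtain F \<tau> where F: "split_extension K g n F \<tau>" "ext_equiv K n ?E F" "F \<in> \<Gamma> f"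
      using copy_ext[OF f] by blast
    interpret F: split_extension K g n F \<tau> by fact
    have "\<Gamma> f' = \<Gamma> f \<longleftrightarrow> ext_equiv K n ?E' ?E"
    proof
      assume "\<Gamma> f' = \<Gamma> f"
      then have "ext_equiv K n ?E' F"
        using F(3) by (auto simp: \<Gamma> ext_class_def)
      moreover have "ext_equiv K n F ?E"
        using ext_equiv_sym[OF E F.lie_sequence_axioms F(2)] .
      ultimately show "ext_equiv K n ?E' ?E"
        by (rule E'.ext_equiv_trans)
    next
      assume "ext_equiv K n ?E' ?E"
      then show "\<Gamma> f' = \<Gamma> f"
        unfolding \<Gamma> by (rule ext_class_eqI[OF E' E])
    qed
    then show ?thesis
      using crossed_extension_equiv_iff[OF f f'] by simp
  qed
qed

text \<open>The source of both surjectivity claims: onto \<open>Ext\<close> with any section, and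
  onto \<open>Ext_outer\<close> with a section whose action is the prescribed S.\<close>

lemma (in split_extension) ext_of_section_factor_system:
  "ext_of_factor_system K g n (act, coc) = ext_class K g n E"
proof -
  obtain \<tau> where "split_extension K g n (crossed_extension g n act coc) \<tau>"
    using factor_system_splits[OF section_factor_system] by auto
  then show ?thesis
    unfolding ext_of_factor_system_def prod.case
    using split_extension_axioms crossed_extension_equiv by (rule ext_class_eqI)
qed

lemma orbit_C1_action:
  "orbit (cochain_group K (Suc 0) g n) (C1_action K g n) f = (\<lambda>\<gamma>. C1_action K g n \<gamma> f) ` cochains K (Suc 0) g n"
  by (auto simp: orbit_def cochain_group_def)

lemma ext_bijection:
  fixes copy :: "'n \<times> 'g \<Rightarrow> 'e"
  assumes copy: "inj_on copy (carrier n \<times> carrier g)"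
  defines "\<Gamma> \<equiv> (ext_of_factor_system K g n :: _ \<Rightarrow> ('k, 'n, 'g, 'e) lie_ext set)"
  shows "\<exists>\<Gamma>_bar. bij_betw \<Gamma>_bar
      (orbits (cochain_group K (Suc 0) g n) (factor_systems K g n) (C1_action K g n)) (Ext K g n) \<and>
    (\<forall>f\<in>factor_systems K g n.
      \<Gamma>_bar (orbit (cochain_group K (Suc 0) g n) (C1_action K g n) f) = \<Gamma> f)"
proof -
  let ?FS = "factor_systems K g n"
  let ?orbit = "orbit (cochain_group K (Suc 0) g n) (C1_action K g n)"
  \<comment> \<open>Since an orbit is a full fibre of \<Gamma>, the induced map is well defined on
    orbits and injective at once.\<close>
  have orbit: "?orbit f = {f' \<in> ?FS. \<Gamma> f' = \<Gamma> f}" if f: "f \<in> ?FS" for f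
    using f C1_action_closed[OF f] ext_of_factor_system_eq_iff[OF copy f]
    unfolding \<Gamma>_def orbit_C1_action by blast
  define \<Gamma>_bar where "\<Gamma>_bar = (\<lambda>Q. the_elem (\<Gamma> ` Q))"
  have bar: "\<Gamma>_bar (?orbit f) = \<Gamma> f" if f: "f \<in> ?FS" for f
  proof -
    have "\<Gamma> ` ?orbit f = {\<Gamma> f}"
      using f orbit[OF f] by auto
    then show ?thesis
      by (simp add: \<Gamma>_bar_def)
  qed
  have orbits: "orbits (cochain_group K (Suc 0) g n) ?FS (C1_action K g n) = ?orbit ` ?FS"
    by (auto simp: orbits_def)
  have "\<Gamma> ` ?FS = Ext K g n"
  proof
    show "\<Gamma> ` ?FS \<subseteq> Ext K g n"
      using ext_of_factor_system_in_Ext[OF copy] by (auto simp: \<Gamma>_def)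
    show "Ext K g n \<subseteq> \<Gamma> ` ?FS"
    proof
      fix c :: "('k, 'n, 'g, 'e) lie_ext set" assume "c \<in> Ext K g n"
      then obtain E :: "('k, 'n, 'g, 'e) lie_ext" and \<sigma>
        where E: "split_extension K g n E \<sigma>" "c = ext_class K g n E"
        unfolding Ext_eq by (auto simp: extensions_iff)
      then show "c \<in> \<Gamma> ` ?FS"
        unfolding \<Gamma>_def using split_extension.ext_of_section_factor_system[OF E(1)]
          split_extension.section_factor_system[OF E(1)] by (metis imageI)
    qed
  qed
  moreover have "inj_on \<Gamma>_bar (?orbit ` ?FS)"
    using bar orbit by (auto simp: inj_on_def)
  ultimately have "bij_betw \<Gamma>_bar (?orbit ` ?FS) (Ext K g n)"
    using bar by (simp add: bij_betw_def image_image)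
  then show ?thesis
    using bar orbits by auto
qed

section \<open>Extensions with a given outer action\<close>

text \<open>Cancelling S(x)v leaves [\<gamma>(x), v] = 0 for all v, which is centrality of the
  values.\<close>

lemma add_inner_eq_self_iff:
  assumes S: "S \<in> C1c K g n" and \<gamma>: "\<gamma> \<in> cochains K (Suc 0) g n"
  shows "add_inner K g n S \<gamma> = S \<longleftrightarrow> \<gamma> \<in> cochains K (Suc 0) g (center n)"
proof -
  note \<gamma>_closed = cochains_1_closed[OF \<gamma>]
  have eq: "add_inner K g n S \<gamma> = (\<lambda>x\<in>carrier g. \<lambda>v\<in>carrier n. S x v \<oplus>\<^bsub>n\<^esub> lie n (\<gamma> [x]) v)"
    by (rule add_inner_eq[OF S]) (rule \<gamma>_closed)
  have "add_inner K g n S \<gamma> = S \<longleftrightarrow> (\<forall>x\<in>carrier g. \<forall>v\<in>carrier n. S x v \<oplus>\<^bsub>n\<^esub> lie n (\<gamma> [x]) v = S x v)"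
  proof
    assume l: "add_inner K g n S \<gamma> = S"
    show "\<forall>x\<in>carrier g. \<forall>v\<in>carrier n. S x v \<oplus>\<^bsub>n\<^esub> lie n (\<gamma> [x]) v = S x v"
    proof (intro ballI)
      fix x v assume "x \<in> carrier g" "v \<in> carrier n"
      then have "add_inner K g n S \<gamma> x v = S x v \<oplus>\<^bsub>n\<^esub> lie n (\<gamma> [x]) v"
        by (simp add: eq)
      with l show "S x v \<oplus>\<^bsub>n\<^esub> lie n (\<gamma> [x]) v = S x v"
        by simp
    qed
  next
    assume r: "\<forall>x\<in>carrier g. \<forall>v\<in>carrier n. S x v \<oplus>\<^bsub>n\<^esub> lie n (\<gamma> [x]) v = S x v"
    show "add_inner K g n S \<gamma> = S"
      unfolding eq
    proof (rule extensionalityI[OF restrict_extensional C1c_extensional[OF S]])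
      fix x assume x: "x \<in> carrier g"
      then show "(\<lambda>x\<in>carrier g. \<lambda>v\<in>carrier n. S x v \<oplus>\<^bsub>n\<^esub> lie n (\<gamma> [x]) v) x = S x"
        using r by (auto intro!: extensionalityI[OF _ C1c_value_extensional[OF S x]])
    qed
  qed
  also have "\<dots> \<longleftrightarrow> (\<forall>x\<in>carrier g. \<forall>v\<in>carrier n. lie n (\<gamma> [x]) v = \<zero>\<^bsub>n\<^esub>)"
    using \<gamma>_closed by (auto simp: C1c_closed[OF S] N.lie_closed)
  also have "\<dots> \<longleftrightarrow> (\<forall>xs\<in>tuples g (Suc 0). \<gamma> xs \<in> carrier (center n))"
    using \<gamma>_closed by (auto simp: carrier_center elim!: tuples_1E)
  finally show ?thesis
    using \<gamma> by (simp add: cochains_center_iff)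
qed

lemma add_inner_zero:
  assumes "S \<in> C1c K g n"
  shows "add_inner K g n S (\<lambda>xs\<in>tuples g (Suc 0). \<zero>\<^bsub>n\<^esub>) = S"
proof -
  have "(\<lambda>xs\<in>tuples g (Suc 0). \<zero>\<^bsub>n\<^esub>) \<in> cochains K (Suc 0) g (center n)"
    unfolding cochains_center_iff using cochains_zeroI by (auto simp: carrier_center)
  then show ?thesis
    using add_inner_eq_self_iff[OF assms cochains_zeroI] by simp
qed

lemma Ext_outer_eq:
  fixes copy :: "'n \<times> 'g \<Rightarrow> 'e"
  assumes copy: "inj_on copy (carrier n \<times> carrier g)" and S: "S \<in> outer_actions K g n"
  shows "(Ext_outer K g n S :: ('k, 'n, 'g, 'e) lie_ext set set) =
    (\<lambda>\<omega>. ext_of_factor_system K g n (S, \<omega>)) ` factor_cocycles K g n S"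
proof -
  let ?\<Gamma> = "ext_of_factor_system K g n :: _ \<Rightarrow> ('k, 'n, 'g, 'e) lie_ext set"
  have SC: "S \<in> C1c K g n"
    using S by (simp add: outer_actions_def)
  \<comment> \<open>Because S belongs to its own class, equality of the classes of S and of the
    action of a section yields an actual relation between the two.\<close>
  have refl: "(S, S) \<in> outer_equiv K g n"
    unfolding outer_equiv_def using S add_inner_zero[OF SC] cochains_zeroI
    by (auto intro!: bexI[of _ "\<lambda>xs\<in>tuples g (Suc 0). \<zero>\<^bsub>n\<^esub>"])
  have "\<exists>\<omega>\<in>factor_cocycles K g n S. c = ?\<Gamma> (S, \<omega>)" if c: "c \<in> Ext_outer K g n S" for c
  proof -
    obtain E0 :: "('k, 'n, 'g, 'e) lie_ext" where E0: "E0 \<in> extensions K g n" "c = ext_class K g n E0"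
      using c by (auto simp: Ext_outer_def Ext_eq)
    obtain E \<sigma> where E: "E \<in> c" "\<sigma> \<in> sections K g E"
      and eq: "outer_equiv K g n `` {section_action g n E \<sigma>} = outer_equiv K g n `` {S}"
      using c by (auto simp: Ext_outer_def)
    have "E \<in> extensions K g n"
      using E(1) E0(2) by (simp add: ext_class_def)
    then obtain \<tau> where "split_extension K g n E \<tau>"
      by (auto simp: extensions_iff)
    then interpret T0: split_extension K g n E \<tau> .
    interpret E: split_extension K g n E \<sigma>
      by unfold_locales (rule E(2))
    have "(E.act, S) \<in> outer_equiv K g n"
      using refl eq by blast
    then obtain \<gamma> where \<gamma>: "\<gamma> \<in> cochains K (Suc 0) g n" "E.act = add_inner K g n S \<gamma>"
      by (auto simp: outer_equiv_def)
    \<comment> \<open>The action of the given section is S plus the inner part of \<gamma>. Shifting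
      the section by -\<gamma> makes the action equal to S itself, not just equivalent to
      it.\<close>
    let ?\<gamma> = "\<lambda>xs\<in>tuples g (Suc 0). \<ominus>\<^bsub>n\<^esub> \<gamma> xs"
    have neg: "?\<gamma> \<in> cochains K (Suc 0) g n"
      by (rule cochains_negI[OF \<gamma>(1)])
    interpret T: split_extension K g n E "E.shift ?\<gamma>"
      by (rule E.split_extension_shift[OF neg])
    have act: "E.act x v = S x v \<oplus>\<^bsub>n\<^esub> lie n (\<gamma> [x]) v" if "x \<in> carrier g" "v \<in> carrier n" for x v
      using that by (simp add: \<gamma>(2) add_inner_eq[OF SC] cochains_1_closed[OF \<gamma>(1)])
    have "T.act = S"
    proof (rule extensionalityI[OF C1c_extensional[OF T.act_C1c] C1c_extensional[OF SC]])
      fix x assume x: "x \<in> carrier g"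
      have "T.act x v = S x v" if v: "v \<in> carrier n" for v
      proof -
        have "T.act x v = E.act x v \<oplus>\<^bsub>n\<^esub> lie n (\<ominus>\<^bsub>n\<^esub> \<gamma> [x]) v"
          using E.factor_system_shift[OF neg] C1_action_eq[OF E.section_factor_system neg] x v by simp
        also have "lie n (\<ominus>\<^bsub>n\<^esub> \<gamma> [x]) v = \<ominus>\<^bsub>n\<^esub> lie n (\<gamma> [x]) v"
          using cochains_1_closed[OF \<gamma>(1) x] v
          by (rule N.lie_neg_left)
        also have "E.act x v \<oplus>\<^bsub>n\<^esub> \<ominus>\<^bsub>n\<^esub> lie n (\<gamma> [x]) v = S x v"
          using x v cochains_1_closed[OF \<gamma>(1) x]
          by (simp add: act N.lie_closed C1c_closed[OF SC] N.M.diff_simps)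
        finally show ?thesis .
      qed
      then show "T.act x = S x"
        by (intro extensionalityI[OF C1c_value_extensional[OF T.act_C1c x] C1c_value_extensional[OF SC x]])
    qed
    then have "T.coc \<in> factor_cocycles K g n S"
      using T.section_factor_system by (simp add: factor_systems_iff)
    moreover have "?\<Gamma> (S, T.coc) = ext_class K g n E"
      using T.ext_of_section_factor_system \<open>T.act = S\<close> by simp
    moreover have "ext_class K g n E0 = ext_class K g n E"
    proof -
      obtain \<sigma>0 where "split_extension K g n E0 \<sigma>0"
        using E0(1) by (auto simp: extensions_iff)
      then show ?thesis
        using E.split_extension_axioms by (rule ext_class_eqI) (use E(1) E0(2) in \<open>simp add: ext_class_def\<close>)
    qed
    ultimately show ?thesis
      using E0(2) by blast
  qed
  moreover have "?\<Gamma> (S, \<omega>) \<in> Ext_outer K g n S" if \<omega>: "\<omega> \<in> factor_cocycles K g n S" for \<omega>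
  proof -
    have "(S, \<omega>) \<in> factor_systems K g n"
      using SC \<omega> by (simp add: factor_systems_iff)
    then show ?thesis
      using ext_of_factor_system_in_Ext[OF copy] ext_of_factor_system_member[OF copy, of "(S, \<omega>)"]
      unfolding Ext_outer_def by auto
  qed
  ultimately show ?thesis
    by blast
qed

end

section \<open>The affine structure\<close>

context lie_pair
begin

lemma cochain_group_mult:
  "\<alpha> \<otimes>\<^bsub>cochain_group K p g V\<^esub> \<beta> = (\<lambda>xs\<in>tuples g p. \<alpha> xs \<oplus>\<^bsub>V\<^esub> \<beta> xs)"
  by (simp add: cochain_group_def)

lemma center_cocycle_group_simps:
  "carrier (center_cocycle_group K g n S p) = center_cocycles K g n S p"
  "\<alpha> \<otimes>\<^bsub>center_cocycle_group K g n S p\<^esub> \<beta> = (\<lambda>xs\<in>tuples g p. \<alpha> xs \<oplus>\<^bsub>n\<^esub> \<beta> xs)"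
  "\<one>\<^bsub>center_cocycle_group K g n S p\<^esub> = (\<lambda>xs\<in>tuples g p. \<zero>\<^bsub>n\<^esub>)"
  by (simp_all add: center_cocycle_group_def cochain_group_def)

lemma center_cocycles_2_iff:
  assumes S: "S \<in> C1c K g n"
  shows "\<eta> \<in> center_cocycles K g n S 2 \<longleftrightarrow> \<eta> \<in> cochains K 2 g n \<and>
    (\<forall>x\<in>carrier g. \<forall>y\<in>carrier g. \<forall>v\<in>carrier n. lie n (\<eta> [x, y]) v = \<zero>\<^bsub>n\<^esub>) \<and>
    (\<forall>x\<in>carrier g. \<forall>y\<in>carrier g. \<forall>z\<in>carrier g.
      d2 S \<eta> x y z = \<zero>\<^bsub>n\<^esub>)"
proof (cases "\<eta> \<in> cochains K 2 g n")
  case True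
  have "(\<forall>xs\<in>tuples g 2. \<eta> xs \<in> carrier (center n)) \<longleftrightarrow>
      (\<forall>x\<in>carrier g. \<forall>y\<in>carrier g. \<forall>v\<in>carrier n. lie n (\<eta> [x, y]) v = \<zero>\<^bsub>n\<^esub>)"
    using cochains_2_closed[OF True] by (auto simp: carrier_center elim!: tuples_2E)
  \<comment> \<open>\<open>center_cocycles\<close> speaks of tuples of length \<open>Suc p\<close>,
    whereas the criterion for a vanishing differential is stated for length 3.\<close>
  moreover have "Suc 2 = 3"
    by simp
  ultimately show ?thesis
    unfolding center_cocycles_def mem_Collect_eq cochains_center_iff
    using True differential_2_eq_zero_iff[OF S, of \<eta>] cochains_2_closed[OF True] by simp
qed (simp add: center_cocycles_def cochains_center_iff)

context
  fixes S assumes S: "S \<in> C1c K g n"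
begin

lemma d2_add:
  assumes "\<alpha> \<in> cochains K 2 g n" "\<beta> \<in> cochains K 2 g n"
    and "x \<in> carrier g" "y \<in> carrier g" "z \<in> carrier g"
  shows "d2 S (\<lambda>xs\<in>tuples g 2. \<alpha> xs \<oplus>\<^bsub>n\<^esub> \<beta> xs) x y z = d2 S \<alpha> x y z \<oplus>\<^bsub>n\<^esub> d2 S \<beta> x y z"
  using assms(3-5)
  by (simp add: cochains_2_closed[OF assms(1)] cochains_2_closed[OF assms(2)] C1c_closed[OF S]
      C1c_add_right[OF S] G.lie_closed N.M.diff_simps N.M.a_ac)

lemma d2_neg:
  assumes "\<alpha> \<in> cochains K 2 g n" and "x \<in> carrier g" "y \<in> carrier g" "z \<in> carrier g"
  shows "d2 S (\<lambda>xs\<in>tuples g 2. \<ominus>\<^bsub>n\<^esub> \<alpha> xs) x y z = \<ominus>\<^bsub>n\<^esub> d2 S \<alpha> x y z"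
  using assms(2-4)
  by (simp add: cochains_2_closed[OF assms(1)] C1c_closed[OF S] C1c_neg_right[OF S] G.lie_closed
      N.M.diff_simps N.M.a_ac)

text \<open>A central summand does not change the inner derivations given by \<omega>, and
  \<open>d2 S\<close> is additive.\<close>

lemma factor_cocycles_add_center_cocycle:
  assumes "\<omega> \<in> factor_cocycles K g n S" "\<eta> \<in> center_cocycles K g n S 2"
  shows "(\<lambda>xs\<in>tuples g 2. \<omega> xs \<oplus>\<^bsub>n\<^esub> \<eta> xs) \<in> factor_cocycles K g n S"
proof -
  note \<omega> = assms(1)[unfolded factor_cocycles_iff[OF S]] and \<eta> = assms(2)[unfolded center_cocycles_2_iff[OF S]]
  note cochains = conjunct1[OF \<omega>] conjunct1[OF \<eta>]
  note closed = cochains_2_closed[OF cochains(1)] cochains_2_closed[OF cochains(2)]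
  show ?thesis
    unfolding factor_cocycles_iff[OF S]
  proof (intro conjI ballI)
    show "(\<lambda>xs\<in>tuples g 2. \<omega> xs \<oplus>\<^bsub>n\<^esub> \<eta> xs) \<in> cochains K 2 g n"
      by (rule cochains_addI[OF cochains])
  next
    fix x y v assume "x \<in> carrier g" "y \<in> carrier g" "v \<in> carrier n"
    then show "S x (S y v) \<ominus>\<^bsub>n\<^esub> S y (S x v) \<ominus>\<^bsub>n\<^esub> S (lie g x y) v =
        lie n ((\<lambda>xs\<in>tuples g 2. \<omega> xs \<oplus>\<^bsub>n\<^esub> \<eta> xs) [x, y]) v"
      using \<omega> \<eta> by (simp add: closed N.lie_closed N.lie_add_left)
  next
    fix x y z assume xyz: "x \<in> carrier g" "y \<in> carrier g" "z \<in> carrier g"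
    have "d2 S (\<lambda>xs\<in>tuples g 2. \<omega> xs \<oplus>\<^bsub>n\<^esub> \<eta> xs) x y z = d2 S \<omega> x y z \<oplus>\<^bsub>n\<^esub> d2 S \<eta> x y z"
      by (rule d2_add[OF cochains xyz])
    also have "\<dots> = \<zero>\<^bsub>n\<^esub>"
      using \<omega> \<eta> xyz by simp
    finally show "d2 S (\<lambda>xs\<in>tuples g 2. \<omega> xs \<oplus>\<^bsub>n\<^esub> \<eta> xs) x y z = \<zero>\<^bsub>n\<^esub>" .
  qed
qed

text \<open>Both cocycles induce the same inner derivations, namely the curvature of S, so their
  difference is central. It is written as a sum with a negated cochain so that the closure rules and
  \<open>d2_add\<close>, \<open>d2_neg\<close> apply.\<close>

lemma factor_cocycles_diff:
  assumes "\<omega> \<in> factor_cocycles K g n S" "\<omega>' \<in> factor_cocycles K g n S"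
  shows "(\<lambda>xs\<in>tuples g 2. \<omega>' xs \<oplus>\<^bsub>n\<^esub> (\<lambda>xs\<in>tuples g 2. \<ominus>\<^bsub>n\<^esub> \<omega> xs) xs) \<in> center_cocycles K g n S 2"
    (is "?\<eta> \<in> _")
proof -
  note \<omega> = assms(1)[unfolded factor_cocycles_iff[OF S]] and \<omega>' = assms(2)[unfolded factor_cocycles_iff[OF S]]
  note cochains = conjunct1[OF \<omega>'] cochains_negI[OF conjunct1[OF \<omega>]]
  note closed = cochains_2_closed[OF conjunct1[OF \<omega>]] cochains_2_closed[OF conjunct1[OF \<omega>']]
  show ?thesis
    unfolding center_cocycles_2_iff[OF S]
  proof (intro conjI ballI)
    show "?\<eta> \<in> cochains K 2 g n"
      by (rule cochains_addI[OF cochains])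
  next
    fix x y v assume xy: "x \<in> carrier g" "y \<in> carrier g" "v \<in> carrier n"
    then have "lie n (\<omega> [x, y]) v = lie n (\<omega>' [x, y]) v"
      using \<omega> \<omega>' by metis
    with xy show "lie n (?\<eta> [x, y]) v = \<zero>\<^bsub>n\<^esub>"
      by (simp add: closed N.lie_closed N.lie_add_left N.lie_neg_left N.M.r_neg)
  next
    fix x y z assume xyz: "x \<in> carrier g" "y \<in> carrier g" "z \<in> carrier g"
    have "d2 S ?\<eta> x y z = d2 S \<omega>' x y z \<oplus>\<^bsub>n\<^esub> d2 S (\<lambda>xs\<in>tuples g 2. \<ominus>\<^bsub>n\<^esub> \<omega> xs) x y z"
      by (rule d2_add[OF cochains xyz])
    also have "d2 S (\<lambda>xs\<in>tuples g 2. \<ominus>\<^bsub>n\<^esub> \<omega> xs) x y z = \<ominus>\<^bsub>n\<^esub> d2 S \<omega> x y z"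
      by (rule d2_neg[OF conjunct1[OF \<omega>] xyz])
    also have "d2 S \<omega>' x y z \<oplus>\<^bsub>n\<^esub> \<ominus>\<^bsub>n\<^esub> d2 S \<omega> x y z = \<zero>\<^bsub>n\<^esub>"
      using \<omega> \<omega>' xyz by simp
    finally show "d2 S ?\<eta> x y z = \<zero>\<^bsub>n\<^esub>" .
  qed
qed

lemma comm_group_center_cocycle_group: "comm_group (center_cocycle_group K g n S 2)"
proof -
  let ?Z = "center_cocycles K g n S 2"
  have cochain: "\<eta> \<in> cochains K 2 g n" if "\<eta> \<in> ?Z" for \<eta>
    using that by (simp add: center_cocycles_2_iff[OF S])
  have Z_closed: "\<eta> xs \<in> carrier n" if "\<eta> \<in> ?Z" "xs \<in> tuples g 2" for \<eta> xs
    using cochain_closed[OF cochain that(2)] that(1) by simp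
  have neg: "(\<lambda>xs\<in>tuples g 2. \<ominus>\<^bsub>n\<^esub> \<eta> xs) \<in> ?Z" if "\<eta> \<in> ?Z" for \<eta>
  proof -
    note \<eta> = that[unfolded center_cocycles_2_iff[OF S]]
    note closed = cochains_2_closed[OF conjunct1[OF \<eta>]]
    show ?thesis
      unfolding center_cocycles_2_iff[OF S]
    proof (intro conjI ballI)
      show "(\<lambda>xs\<in>tuples g 2. \<ominus>\<^bsub>n\<^esub> \<eta> xs) \<in> cochains K 2 g n"
        using \<eta> by (intro cochains_negI) auto
    next
      fix x y z assume xyz: "x \<in> carrier g" "y \<in> carrier g" "z \<in> carrier g"
      have "d2 S (\<lambda>xs\<in>tuples g 2. \<ominus>\<^bsub>n\<^esub> \<eta> xs) x y z = \<ominus>\<^bsub>n\<^esub> d2 S \<eta> x y z"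
        by (rule d2_neg[OF conjunct1[OF \<eta>] xyz])
      also have "\<dots> = \<zero>\<^bsub>n\<^esub>"
        using \<eta> xyz by simp
      finally show "d2 S (\<lambda>xs\<in>tuples g 2. \<ominus>\<^bsub>n\<^esub> \<eta> xs) x y z = \<zero>\<^bsub>n\<^esub>" .
    qed (use \<eta> in \<open>simp add: closed N.lie_neg_left\<close>)
  qed
  have add: "(\<lambda>xs\<in>tuples g 2. \<eta> xs \<oplus>\<^bsub>n\<^esub> \<zeta> xs) \<in> ?Z" if "\<eta> \<in> ?Z" "\<zeta> \<in> ?Z" for \<eta> \<zeta>
  proof -
    note \<eta> = that(1)[unfolded center_cocycles_2_iff[OF S]] and \<zeta> = that(2)[unfolded center_cocycles_2_iff[OF S]]
    note cochains = conjunct1[OF \<eta>] conjunct1[OF \<zeta>]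
    note closed = cochains_2_closed[OF cochains(1)] cochains_2_closed[OF cochains(2)]
    show ?thesis
      unfolding center_cocycles_2_iff[OF S]
    proof (intro conjI ballI)
      show "(\<lambda>xs\<in>tuples g 2. \<eta> xs \<oplus>\<^bsub>n\<^esub> \<zeta> xs) \<in> cochains K 2 g n"
        by (rule cochains_addI[OF cochains])
    next
      fix x y z assume xyz: "x \<in> carrier g" "y \<in> carrier g" "z \<in> carrier g"
      have "d2 S (\<lambda>xs\<in>tuples g 2. \<eta> xs \<oplus>\<^bsub>n\<^esub> \<zeta> xs) x y z = d2 S \<eta> x y z \<oplus>\<^bsub>n\<^esub> d2 S \<zeta> x y z"
        by (rule d2_add[OF cochains xyz])
      also have "\<dots> = \<zero>\<^bsub>n\<^esub>"
        using \<eta> \<zeta> xyz by simp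
      finally show "d2 S (\<lambda>xs\<in>tuples g 2. \<eta> xs \<oplus>\<^bsub>n\<^esub> \<zeta> xs) x y z = \<zero>\<^bsub>n\<^esub>" .
    qed (use \<eta> \<zeta> in \<open>simp add: closed N.lie_add_left\<close>)
  qed
  have zero: "(\<lambda>xs\<in>tuples g 2. \<zero>\<^bsub>n\<^esub>) \<in> ?Z"
    unfolding center_cocycles_2_iff[OF S]
    by (intro conjI ballI cochains_zeroI) (simp_all add: C1c_zero_right[OF S] G.lie_closed N.M.diff_zero)
  show ?thesis
  proof (rule comm_groupI, unfold center_cocycle_group_simps)
    fix \<eta> assume \<eta>: "\<eta> \<in> ?Z"
    show "(\<lambda>xs\<in>tuples g 2. (\<lambda>xs\<in>tuples g 2. \<zero>\<^bsub>n\<^esub>) xs \<oplus>\<^bsub>n\<^esub> \<eta> xs) = \<eta>"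
      using \<eta> Z_closed
      by (intro extensionalityI[OF restrict_extensional cochain_extensional[OF cochain]]) auto
    show "\<exists>\<zeta>\<in>?Z. (\<lambda>xs\<in>tuples g 2. \<zeta> xs \<oplus>\<^bsub>n\<^esub> \<eta> xs) = (\<lambda>xs\<in>tuples g 2. \<zero>\<^bsub>n\<^esub>)"
      using \<eta> Z_closed by (intro bexI[OF _ neg[OF \<eta>]] restrict_ext) (simp add: N.M.l_neg)
  qed (auto intro!: restrict_ext simp: add zero Z_closed N.M.a_ac)
qed

section \<open>The affine space of factor cocycles and the fibres over classes of extensions\<close>

lemma affine_factor_cocycles:
  assumes "factor_cocycles K g n S \<noteq> {}"
  shows "affine_space_over (center_cocycle_group K g n S 2) (factor_cocycles K g n S)
    (\<lambda>\<eta>. \<lambda>\<omega>\<in>factor_cocycles K g n S. \<omega> \<otimes>\<^bsub>cochain_group K 2 g n\<^esub> \<eta>)"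
proof (rule affine_space_overI[OF comm_group_center_cocycle_group assms],
    unfold center_cocycle_group_simps cochain_group_mult)
  let ?F = "factor_cocycles K g n S" and ?Z = "center_cocycles K g n S 2"
  have F_cochain: "\<omega> \<in> cochains K 2 g n" if "\<omega> \<in> ?F" for \<omega>
    using that by (simp add: factor_cocycles_iff[OF S])
  have Z_cochain: "\<eta> \<in> cochains K 2 g n" if "\<eta> \<in> ?Z" for \<eta>
    using that by (simp add: center_cocycles_2_iff[OF S])
  note closed = cochain_closed[OF F_cochain] cochain_closed[OF Z_cochain]
  {
    fix \<eta> \<omega> assume "\<eta> \<in> ?Z" "\<omega> \<in> ?F"
    then show "(\<lambda>\<omega>\<in>?F. \<lambda>xs\<in>tuples g 2. \<omega> xs \<oplus>\<^bsub>n\<^esub> \<eta> xs) \<omega> \<in> ?F"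
      using factor_cocycles_add_center_cocycle by simp
  next
    fix \<omega> assume \<omega>: "\<omega> \<in> ?F"
    have "(\<lambda>xs\<in>tuples g 2. \<omega> xs \<oplus>\<^bsub>n\<^esub> (\<lambda>xs\<in>tuples g 2. \<zero>\<^bsub>n\<^esub>) xs) = \<omega>"
      using \<omega> closed
      by (intro extensionalityI[OF restrict_extensional cochain_extensional[OF F_cochain]]) auto
    with \<omega> show "(\<lambda>\<omega>\<in>?F. \<lambda>xs\<in>tuples g 2. \<omega> xs \<oplus>\<^bsub>n\<^esub> (\<lambda>xs\<in>tuples g 2. \<zero>\<^bsub>n\<^esub>) xs) \<omega> = \<omega>"
      by simp
  next
    fix \<eta> \<zeta> \<omega> assume "\<eta> \<in> ?Z" "\<zeta> \<in> ?Z" "\<omega> \<in> ?F"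
    then show "(\<lambda>\<omega>\<in>?F. \<lambda>xs\<in>tuples g 2. \<omega> xs \<oplus>\<^bsub>n\<^esub> (\<lambda>xs\<in>tuples g 2. \<eta> xs \<oplus>\<^bsub>n\<^esub> \<zeta> xs) xs) \<omega> =
      (\<lambda>\<omega>\<in>?F. \<lambda>xs\<in>tuples g 2. \<omega> xs \<oplus>\<^bsub>n\<^esub> \<eta> xs) ((\<lambda>\<omega>\<in>?F. \<lambda>xs\<in>tuples g 2. \<omega> xs \<oplus>\<^bsub>n\<^esub> \<zeta> xs) \<omega>)"
      using factor_cocycles_add_center_cocycle
      by (auto intro!: restrict_ext simp: closed N.M.a_ac)
  next
    fix \<omega> \<omega>' assume \<omega>: "\<omega> \<in> ?F" "\<omega>' \<in> ?F"
    let ?\<eta> = "\<lambda>xs\<in>tuples g 2. \<omega>' xs \<oplus>\<^bsub>n\<^esub> (\<lambda>xs\<in>tuples g 2. \<ominus>\<^bsub>n\<^esub> \<omega> xs) xs"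
    have "(\<lambda>xs\<in>tuples g 2. \<omega> xs \<oplus>\<^bsub>n\<^esub> ?\<eta> xs) = \<omega>'"
      using \<omega> closed
      by (intro extensionalityI[OF restrict_extensional cochain_extensional[OF F_cochain]])
         (auto simp: N.M.diff_simps N.M.a_ac)
    with \<omega> show "\<exists>\<eta>\<in>?Z. (\<lambda>\<omega>\<in>?F. \<lambda>xs\<in>tuples g 2. \<omega> xs \<oplus>\<^bsub>n\<^esub> \<eta> xs) \<omega> = \<omega>'"
      using factor_cocycles_diff[OF \<omega>] by (intro bexI[of _ ?\<eta>]) simp_all
  next
    fix \<eta> \<zeta> \<omega> assume *: "\<eta> \<in> ?Z" "\<zeta> \<in> ?Z" "\<omega> \<in> ?F"
      and eq: "(\<lambda>\<omega>\<in>?F. \<lambda>xs\<in>tuples g 2. \<omega> xs \<oplus>\<^bsub>n\<^esub> \<eta> xs) \<omega> = (\<lambda>\<omega>\<in>?F. \<lambda>xs\<in>tuples g 2. \<omega> xs \<oplus>\<^bsub>n\<^esub> \<zeta> xs) \<omega>"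
    show "\<eta> = \<zeta>"
    proof (rule extensionalityI[OF cochain_extensional[OF Z_cochain] cochain_extensional[OF Z_cochain]])
      fix xs assume xs: "xs \<in> tuples g 2"
      then have "\<omega> xs \<oplus>\<^bsub>n\<^esub> \<eta> xs = \<omega> xs \<oplus>\<^bsub>n\<^esub> \<zeta> xs"
        using fun_cong[OF eq, of xs] * by simp
      then show "\<eta> xs = \<zeta> xs"
        using * xs closed by simp
    qed (use * in auto)
  }
qed simp

lemma center_coboundaries_2:
  "center_coboundaries K g n S 2 = differential K g n S (Suc 0) ` cochains K (Suc 0) g (center n)"
  by (simp add: center_coboundaries_def numeral_2_eq_2)

text \<open>For central \<gamma> both the inner correction of S and the quadratic term
  [\<gamma>(x), \<gamma>(y)] vanish.\<close>

lemma C1_action_center: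
  assumes \<omega>: "\<omega> \<in> factor_cocycles K g n S" and \<gamma>: "\<gamma> \<in> cochains K (Suc 0) g (center n)"
  shows "C1_action K g n \<gamma> (S, \<omega>) = (S, \<omega> \<otimes>\<^bsub>cochain_group K 2 g n\<^esub> differential K g n S (Suc 0) \<gamma>)"
proof -
  have \<gamma>': "\<gamma> \<in> cochains K (Suc 0) g n"
    using \<gamma> by (simp add: cochains_center_iff)
  have \<omega>c: "\<omega> \<in> cochains K 2 g n"
    using \<omega> by (simp add: factor_cocycles_iff[OF S])
  have "\<omega> xs \<oplus>\<^bsub>n\<^esub> differential K g n S (Suc 0) \<gamma> xs \<oplus>\<^bsub>n\<^esub> lie n (\<gamma> [xs ! 0]) (\<gamma> [xs ! 1]) =
      \<omega> xs \<oplus>\<^bsub>n\<^esub> differential K g n S (Suc 0) \<gamma> xs" if "xs \<in> tuples g 2" for xs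
  proof -
    obtain x y where xy: "x \<in> carrier g" "y \<in> carrier g" "xs = [x, y]"
      using \<open>xs \<in> tuples g 2\<close> by (rule tuples_2E)
    have "\<gamma> [x] \<in> carrier (center n)"
      using cochain_closed[OF \<gamma>, of "[x]"] xy by simp
    with xy show ?thesis
      using cochains_1_closed[OF \<gamma>'] cochains_2_closed[OF \<omega>c]
      by (simp add: carrier_center differential_1[OF S] C1c_closed[OF S] G.lie_closed)
  qed
  then show ?thesis
    using \<omega> S \<gamma> \<gamma>' unfolding C1_action_def cochain_group_mult
    by (auto simp: factor_systems_iff add_inner_eq_self_iff intro!: restrict_ext)
qed

lemma fibre_factor_cocycles:
  fixes copy :: "'n \<times> 'g \<Rightarrow> 'e"
  assumes copy: "inj_on copy (carrier n \<times> carrier g)" and \<omega>: "\<omega> \<in> factor_cocycles K g n S"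
  defines "\<Gamma> \<equiv> (ext_of_factor_system K g n :: _ \<Rightarrow> ('k, 'n, 'g, 'e) lie_ext set)"
  shows "{\<omega>' \<in> factor_cocycles K g n S. \<Gamma> (S, \<omega>') = \<Gamma> (S, \<omega>)} =
    {\<omega> \<otimes>\<^bsub>cochain_group K 2 g n\<^esub> \<beta> | \<beta>. \<beta> \<in> center_coboundaries K g n S 2}"
proof -
  have FS: "(S, \<omega>) \<in> factor_systems K g n"
    using \<omega> S by (simp add: factor_systems_iff)
  have "\<omega>' \<in> factor_cocycles K g n S \<and> \<Gamma> (S, \<omega>') = \<Gamma> (S, \<omega>) \<longleftrightarrow>
      (\<exists>\<gamma>\<in>cochains K (Suc 0) g (center n). \<omega>' = \<omega> \<otimes>\<^bsub>cochain_group K 2 g n\<^esub> differential K g n S (Suc 0) \<gamma>)" for \<omega>'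
  proof
    assume *: "\<omega>' \<in> factor_cocycles K g n S \<and> \<Gamma> (S, \<omega>') = \<Gamma> (S, \<omega>)"
    then have "(S, \<omega>') \<in> factor_systems K g n"
      using S by (simp add: factor_systems_iff)
    then obtain \<gamma> where \<gamma>: "\<gamma> \<in> cochains K (Suc 0) g n" "(S, \<omega>') = C1_action K g n \<gamma> (S, \<omega>)"
      using * ext_of_factor_system_eq_iff[OF copy FS] unfolding \<Gamma>_def by blast
    \<comment> \<open>Comparing first components: both systems have the same S, so \<gamma> has to
      fix it.\<close>
    then have "add_inner K g n S \<gamma> = S"
      using FS by (simp add: C1_action_def)
    then have "\<gamma> \<in> cochains K (Suc 0) g (center n)"
      using add_inner_eq_self_iff[OF S \<gamma>(1)] by simp
    with \<gamma>(2) show "\<exists>\<gamma>\<in>cochains K (Suc 0) g (center n). \<omega>' = \<omega> \<otimes>\<^bsub>cochain_group K 2 g n\<^esub> differential K g n S (Suc 0) \<gamma>"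
      using C1_action_center[OF \<omega>] by auto
  next
    assume "\<exists>\<gamma>\<in>cochains K (Suc 0) g (center n). \<omega>' = \<omega> \<otimes>\<^bsub>cochain_group K 2 g n\<^esub> differential K g n S (Suc 0) \<gamma>"
    then obtain \<gamma> where \<gamma>: "\<gamma> \<in> cochains K (Suc 0) g (center n)" "(S, \<omega>') = C1_action K g n \<gamma> (S, \<omega>)"
      using C1_action_center[OF \<omega>] by auto
    from \<gamma>(1) have \<gamma>': "\<gamma> \<in> cochains K (Suc 0) g n"
      by (simp add: cochains_center_iff)
    then have FS': "(S, \<omega>') \<in> factor_systems K g n"
      unfolding \<gamma>(2) by (rule C1_action_closed[OF FS])
    moreover have "\<Gamma> (S, \<omega>') = \<Gamma> (S, \<omega>)"
      unfolding \<Gamma>_def ext_of_factor_system_eq_iff[OF copy FS FS'] using \<gamma>' \<gamma>(2) by blast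
    ultimately show "\<omega>' \<in> factor_cocycles K g n S \<and> \<Gamma> (S, \<omega>') = \<Gamma> (S, \<omega>)"
      by (simp add: factor_systems_iff)
  qed
  then show ?thesis
    unfolding center_coboundaries_2 by blast
qed

text \<open>In place of a computation with two successive differentials: \<omega> + \<beta> lies in
  the fibre through \<omega> and is therefore a factor cocycle, and the difference of two factor
  cocycles is a central cocycle.\<close>

lemma center_coboundaries_subset:
  fixes copy :: "'n \<times> 'g \<Rightarrow> 'e"
  assumes copy: "inj_on copy (carrier n \<times> carrier g)" and \<omega>: "\<omega> \<in> factor_cocycles K g n S"
  shows "center_coboundaries K g n S 2 \<subseteq> center_cocycles K g n S 2"
proof
  fix \<beta> assume \<beta>: "\<beta> \<in> center_coboundaries K g n S 2"
  then obtain \<gamma> where \<gamma>: "\<gamma> \<in> cochains K (Suc 0) g (center n)" "\<beta> = differential K g n S (Suc 0) \<gamma>"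
    by (auto simp: center_coboundaries_2)
  have \<omega>c: "\<omega> \<in> cochains K 2 g n"
    using \<omega> by (simp add: factor_cocycles_iff[OF S])
  let ?\<omega>' = "\<lambda>xs\<in>tuples g 2. \<omega> xs \<oplus>\<^bsub>n\<^esub> \<beta> xs"
  have \<omega>': "?\<omega>' \<in> factor_cocycles K g n S"
    using fibre_factor_cocycles[OF copy \<omega>] \<beta> by (auto simp: cochain_group_mult)
  have "\<beta> xs \<in> carrier n" if xs: "xs \<in> tuples g 2" for xs
  proof -
    obtain x y where "x \<in> carrier g" "y \<in> carrier g" "xs = [x, y]"
      using xs by (rule tuples_2E)
    moreover have "\<gamma> [x] \<in> carrier n" if "x \<in> carrier g" for x
      using \<gamma>(1) that by (intro cochains_1_closed) (simp_all add: cochains_center_iff)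
    ultimately show ?thesis
      by (simp add: \<gamma>(2) differential_1[OF S] C1c_closed[OF S] G.lie_closed)
  qed
  moreover have "\<beta> \<in> extensional (tuples g 2)"
    by (simp add: \<gamma>(2) differential_def numeral_2_eq_2)
  ultimately have "(\<lambda>xs\<in>tuples g 2. ?\<omega>' xs \<oplus>\<^bsub>n\<^esub> (\<lambda>xs\<in>tuples g 2. \<ominus>\<^bsub>n\<^esub> \<omega> xs) xs) = \<beta>"
    using cochain_closed[OF \<omega>c]
    by (intro extensionalityI[OF restrict_extensional]) (auto simp: N.M.diff_simps N.M.a_ac)
  then show "\<beta> \<in> center_cocycles K g n S 2"
    using factor_cocycles_diff[OF \<omega> \<omega>'] by simp
qed

end

lemma Ext_outer_affine:
  fixes copy :: "'n \<times> 'g \<Rightarrow> 'e"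
  assumes copy: "inj_on copy (carrier n \<times> carrier g)" and S: "S \<in> outer_actions K g n"
    and nonempty: "(Ext_outer K g n S :: ('k, 'n, 'g, 'e) lie_ext set set) \<noteq> {}"
  defines "\<Gamma> \<equiv> (ext_of_factor_system K g n :: _ \<Rightarrow> ('k, 'n, 'g, 'e) lie_ext set)"
  shows "(\<lambda>\<omega>. \<Gamma> (S, \<omega>)) ` factor_cocycles K g n S = Ext_outer K g n S \<and>
    affine_space_over (center_cocycle_group K g n S 2) (factor_cocycles K g n S)
      (\<lambda>\<eta>. \<lambda>\<omega>\<in>factor_cocycles K g n S. \<omega> \<otimes>\<^bsub>cochain_group K 2 g n\<^esub> \<eta>) \<and>
    (\<forall>\<omega>\<in>factor_cocycles K g n S.
      {\<omega>' \<in> factor_cocycles K g n S. \<Gamma> (S, \<omega>') = \<Gamma> (S, \<omega>)} =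
      {\<omega> \<otimes>\<^bsub>cochain_group K 2 g n\<^esub> \<beta> | \<beta>. \<beta> \<in> center_coboundaries K g n S 2}) \<and>
    (\<exists>\<phi>. affine_space_over (center_cohomology K g n S 2) (Ext_outer K g n S) \<phi> \<and>
      (\<forall>\<eta>\<in>center_cocycles K g n S 2. \<forall>\<omega>\<in>factor_cocycles K g n S.
        \<phi> (center_coboundaries K g n S 2 #>\<^bsub>center_cocycle_group K g n S 2\<^esub> \<eta>) (\<Gamma> (S, \<omega>)) =
        \<Gamma> (S, \<omega> \<otimes>\<^bsub>cochain_group K 2 g n\<^esub> \<eta>)))"
    (is "?surj \<and> ?affine \<and> ?fibres \<and> ?quotient")
proof (intro conjI)
  have SC: "S \<in> C1c K g n"
    using S by (simp add: outer_actions_def)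
  let ?F = "factor_cocycles K g n S"
  let ?\<phi> = "\<lambda>\<eta>. \<lambda>\<omega>\<in>?F. \<omega> \<otimes>\<^bsub>cochain_group K 2 g n\<^esub> \<eta>"
  show surj: ?surj
    using Ext_outer_eq[OF copy S] by (simp add: \<Gamma>_def)
  \<comment> \<open>A class in \<open>Ext_outer\<close> yields the base point for the affine space,
    which also gives the inclusion of coboundaries in cocycles.\<close>
  then obtain \<omega>0 where \<omega>0: "\<omega>0 \<in> ?F"
    using nonempty by blast
  then show affine: ?affine
    by (intro affine_factor_cocycles[OF SC]) auto
  show fibres: ?fibres
    using fibre_factor_cocycles[OF SC copy] by (simp add: \<Gamma>_def)
  have "center_coboundaries K g n S 2 \<subseteq> carrier (center_cocycle_group K g n S 2)"
    unfolding center_cocycle_group_simps by (rule center_coboundaries_subset[OF SC copy \<omega>0])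
  moreover have "{\<omega>' \<in> ?F. \<Gamma> (S, \<omega>') = \<Gamma> (S, \<omega>)} = {?\<phi> \<beta> \<omega> | \<beta>. \<beta> \<in> center_coboundaries K g n S 2}"
    if "\<omega> \<in> ?F" for \<omega>
    using fibres that by simp
  ultimately have "\<exists>\<psi>. affine_space_over (center_cohomology K g n S 2) ((\<lambda>\<omega>. \<Gamma> (S, \<omega>)) ` ?F) \<psi> \<and>
      (\<forall>\<eta>\<in>carrier (center_cocycle_group K g n S 2). \<forall>\<omega>\<in>?F.
        \<psi> (center_coboundaries K g n S 2 #>\<^bsub>center_cocycle_group K g n S 2\<^esub> \<eta>) (\<Gamma> (S, \<omega>)) = \<Gamma> (S, ?\<phi> \<eta> \<omega>))"
    unfolding center_cohomology_def by (rule affine_space_quotient[OF affine])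
  then show ?quotient
    unfolding surj center_cocycle_group_simps by (simp cong: ball_cong)
qed

end

theorem mainTheorem1:
  fixes K :: "'k top_field"
    and g :: "('k, 'g) top_lie_alg"
    and n :: "('k, 'n) top_lie_alg"
    and copy :: "'n \<times> 'g \<Rightarrow> 'e"
  assumes "topological_lie_algebra K g"
    and "topological_lie_algebra K n"
    and "inj_on copy (carrier n \<times> carrier g)"
  shows "let \<Gamma> = (ext_of_factor_system K g n ::
        ('g \<Rightarrow> 'n \<Rightarrow> 'n) \<times> ('g list \<Rightarrow> 'n) \<Rightarrow> ('k, 'n, 'g, 'e) lie_ext set)
    in
      (\<exists>\<Gamma>_bar. bij_betw \<Gamma>_bar
          (orbits (cochain_group K 1 g n) (factor_systems K g n) (C1_action K g n)) (Ext K g n) \<and>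
        (\<forall>f\<in>factor_systems K g n.
          \<Gamma>_bar (orbit (cochain_group K 1 g n) (C1_action K g n) f) = \<Gamma> f)) \<and>
      (\<forall>S\<in>outer_actions K g n.
        (Ext_outer K g n S :: ('k, 'n, 'g, 'e) lie_ext set set) \<noteq> {} \<longrightarrow>
          (\<lambda>\<omega>. \<Gamma> (S, \<omega>)) ` factor_cocycles K g n S = Ext_outer K g n S \<and>
          affine_space_over (center_cocycle_group K g n S 2) (factor_cocycles K g n S)
            (\<lambda>\<eta>. \<lambda>\<omega>\<in>factor_cocycles K g n S. \<omega> \<otimes>\<^bsub>cochain_group K 2 g n\<^esub> \<eta>) \<and>
          (\<forall>\<omega>\<in>factor_cocycles K g n S.
            {\<omega>' \<in> factor_cocycles K g n S. \<Gamma> (S, \<omega>') = \<Gamma> (S, \<omega>)} =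
            {\<omega> \<otimes>\<^bsub>cochain_group K 2 g n\<^esub> \<beta> | \<beta>. \<beta> \<in> center_coboundaries K g n S 2}) \<and>
          (\<exists>\<phi>. affine_space_over (center_cohomology K g n S 2) (Ext_outer K g n S) \<phi> \<and>
            (\<forall>\<eta>\<in>center_cocycles K g n S 2. \<forall>\<omega>\<in>factor_cocycles K g n S.
              \<phi> (center_coboundaries K g n S 2 #>\<^bsub>center_cocycle_group K g n S 2\<^esub> \<eta>) (\<Gamma> (S, \<omega>)) =
              \<Gamma> (S, \<omega> \<otimes>\<^bsub>cochain_group K 2 g n\<^esub> \<eta>))))"
proof -
  interpret lie_pair K g n
    using assms(1,2) by (rule lie_pair.intro)
  show ?thesis
    unfolding Let_def One_nat_def
    by (rule conjI[OF ext_bijection[OF assms(3)]], intro ballI impI, rule Ext_outer_affine[OF assms(3)])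
qed

end
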